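(* For the Luby-Randall-Sinclair lozenge-tiling Markov chain on a region which has width $w$, has $m$ (local) moves separating the top and bottom configurations, and contains $p$ places where a lattice path may be moved, after $$\frac{2+o(1)}{\pi^2}\,p\,w^2\log\frac{m}{\varepsilon}$$ steps, coalescence will occur except with probability $\varepsilon$. (For regions which are not simply connected, coalescence means coalescence within a given connected component of the state space.)
   Context: Asymptotics. The $o(1)$ term is for large regions: it tends to $0$ as the size $n$ of the region (its number of lozenges) tends to infinity. $\log$ is the natural logarithm. Region and paths. Consider the triangular lattice of unit equilateral triangles drawn with one family of edges vertical. A region is a finite connected union of unit triangles that can be tiled by lozenges, a lozenge being the union of two triangles sharing an edge. Horizontally rescale so that neighbouring vertical lines of the lattice are at distance 1. Given a tiling, draw in every lozenge that has two vertical sides a segment joining the midpoints of its vertical sides. These segments form nonintersecting lattice paths going left to right, each step moving by $1$ horizontally and $\pm\frac12$ vertically, with endpoints fixed by the region. Tilings correspond bijectively to such families of nonintersecting lattice paths ("routings"). Write $h_i(x)$ for the height of the $i$th path at horizontal coordinate $x$. If the region is not simply connected, the state space is restricted to configurations in which a specified set of paths passes under each hole; each such restricted set is a connected component. Parameters. $w$ is the horizontal distance between the leftmost start of a path and the rightmost end of a path. $p$ is the total number of internal (non-endpoint) points on the paths, i.e. the number of places where the chain might try to push a path up or down. There is a unique top and a unique bottom configuration (in the component), with every path at its maximal, respectively minimal, height; $m$ is the number of local moves (each changing the height of one path at one coordinate by 1) separating them, $m=\sum_i\sum_x(h^{\rm top}_i(x)-h^{\rm bot}_i(x))$. Chain.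 At each step choose uniformly one of the $p$ internal path points, say on path $i$ at coordinate $x$, and choose a direction, up or down, with probability $1/2$ each. If the direction is up and path $i$ has a local minimum at $x$ (that is, $h_i(x\pm1)=h_i(x)+\frac12$), let $k\ge0$ be the number of paths blocking the move, i.e. the smallest integer such that the point at coordinate $x$ and height $h_i(x)+k+1$ is not on any path. If raising by 1 the height at $x$ of path $i$ and of the $k$ blocking paths above it gives a valid configuration, then with probability $1/(k+1)$ all $k+1$ of these points are raised by 1, and otherwise nothing changes; if the border of the region prevents the movement, nothing changes. Pushing down a local maximum is defined symmetrically. In all other cases nothing changes. The stationary distribution is uniform. Coupling. All states are updated using the same path index $i$, the same coordinate $x$, the same direction, and the same uniform random variable $u\in[0,1]$ (a non-obstructed push involving $k+1$ paths being performed if and only if $u\le 1/(k+1)$); this coupling is monotone. Coalescence by time $t$ means that the coupled copies started from the top and bottom configurations are equal at time $t$.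
   Formalization: The o(1) is proved to tend to 0 as the width w tends to infinity (uniformly in all else), not merely as the number n of lozenges does; for bounded w the claim fails, e.g. for N unit hexagons (w=2) joined by forced lozenges, where coalescence takes about N log N steps. *)

theory Defs
  imports "HOL-Probability.Probability"
begin

(* Coordinates: the horizontal coordinate is rescaled so that consecutive vertical
   lattice lines are at distance 1, and the vertical coordinate counts HALF edge lengths.
   Lattice vertices are the integer points (x, y) with x + y odd, so the midpoints of
   vertical edges are the points with x + y even.  In these units a path step is (1, +1)
   or (1, -1), and a local move changes one height by 2. *)

(* Every unit triangle has exactly one vertical edge.  Rt x y and Lt x y are the triangles
   whose vertical edge has midpoint (x, y), pointing to the right and to the left. *)
datatype tri = Rt int int | Lt int int

fun corners :: "tri \<Rightarrow> (int \<times> int) set" where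
  "corners (Rt x y) = {(x, y - 1), (x, y + 1), (x + 1, y)}"
| "corners (Lt x y) = {(x, y - 1), (x, y + 1), (x - 1, y)}"

definition triangles :: "tri set" where
  "triangles = {t. \<forall>(x, y)\<in>corners t. odd (x + y)}"

definition share_edge :: "tri \<Rightarrow> tri \<Rightarrow> bool" where
  "share_edge s t \<longleftrightarrow> card (corners s \<inter> corners t) = 2"

definition lozenges :: "tri set set" where
  "lozenges = {{s, t} | s t. s \<in> triangles \<and> t \<in> triangles \<and> share_edge s t}"

definition tilings :: "tri set \<Rightarrow> tri set set set" where
  "tilings R = {T. T \<subseteq> lozenges \<and> partition_on R T}"

(* The union of the closed triangles of R is connected iff any two of them are linked by a
   chain in which consecutive triangles meet, possibly only in a corner. *)
definition region :: "tri set \<Rightarrow> bool" where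
  "region R \<longleftrightarrow> finite R \<and> R \<noteq> {} \<and> R \<subseteq> triangles \<and>
     (\<forall>s\<in>R. \<forall>t\<in>R. (s, t) \<in> {(a, b). a \<in> R \<and> b \<in> R \<and> corners a \<inter> corners b \<noteq> {}}\<^sup>*) \<and>
     tilings R \<noteq> {}"

(* Triangles lying in a hole, i.e. in a bounded component of the complement of the closed
   region.  Two complementary triangles meeting only in a corner are not joined by it,
   unless they are linked around that corner by complementary triangles. *)
definition hole_triangles :: "tri set \<Rightarrow> tri set" where
  "hole_triangles R = {t \<in> triangles - R.
     finite {s. (t, s) \<in> {(a, b). a \<in> triangles - R \<and> b \<in> triangles - R \<and> share_edge a b}\<^sup>*}}"

(* A lozenge has two vertical sides iff its triangles do not share their vertical edge; it
   is then {Rt x y, Lt (x + 1) y'} with y' = y + 1 or y' = y - 1, and its vertical sides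
   have midpoints (x, y) and (x + 1, y'). *)
definition segments :: "tri set set \<Rightarrow> ((int \<times> int) \<times> (int \<times> int)) set" where
  "segments T = {((x, y), (x + 1, y')) | x y y'. {Rt x y, Lt (x + 1) y'} \<in> T}"

(* Path endpoints are the midpoints of the vertical boundary edges of the region. *)
definition starts :: "tri set \<Rightarrow> (int \<times> int) set" where
  "starts R = {(x, y). Rt x y \<in> R \<and> Lt x y \<notin> R}"

definition ends :: "tri set \<Rightarrow> (int \<times> int) set" where
  "ends R = {(x, y). Lt x y \<in> R \<and> Rt x y \<notin> R}"

(* Paths are indexed by their starting points: h i x = Some y means that the path started
   at i passes through (x, y), and h i x = None that it does not meet the line x. *)
type_synonym routing = "(int \<times> int) \<Rightarrow> int \<Rightarrow> int option"

definition routing_of :: "tri set \<Rightarrow> tri set set \<Rightarrow> routing" where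
  "routing_of R T = (\<lambda>i x.
     if i \<in> starts R \<and> (\<exists>y. (i, (x, y)) \<in> (segments T)\<^sup>*)
     then Some (THE y. (i, (x, y)) \<in> (segments T)\<^sup>*) else None)"

definition routings :: "tri set \<Rightarrow> routing set" where
  "routings R = routing_of R ` tilings R"

(* The paths that cross the whole column occupied by a triangle outside the region, below
   that triangle. *)
fun passing_under :: "routing \<Rightarrow> tri \<Rightarrow> (int \<times> int) set" where
  "passing_under h (Rt x y) = {i. h i (x + 1) \<noteq> None \<and> (\<exists>z. h i x = Some z \<and> z < y)}"
| "passing_under h (Lt x y) = {i. h i (x - 1) \<noteq> None \<and> (\<exists>z. h i x = Some z \<and> z < y)}"

(* S prescribes which paths pass under each hole.  It is given triangle by triangle because
   a path that starts or ends on a non-convex hole can run under one part of it and over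
   another.  Without holes there is no restriction. *)
definition states :: "tri set \<Rightarrow> (tri \<Rightarrow> (int \<times> int) set) \<Rightarrow> routing set" where
  "states R S = {h \<in> routings R. \<forall>t\<in>hole_triangles R. passing_under h t = S t}"

definition lower :: "routing \<Rightarrow> routing \<Rightarrow> bool" where
  "lower g h \<longleftrightarrow> (\<forall>i. dom (g i) = dom (h i) \<and> (\<forall>x\<in>dom (g i). the (g i x) \<le> the (h i x)))"

definition top_state :: "tri set \<Rightarrow> (tri \<Rightarrow> (int \<times> int) set) \<Rightarrow> routing" where
  "top_state R S = (THE h. h \<in> states R S \<and> (\<forall>g\<in>states R S. lower g h))"

definition bottom_state :: "tri set \<Rightarrow> (tri \<Rightarrow> (int \<times> int) set) \<Rightarrow> routing" where
  "bottom_state R S = (THE h. h \<in> states R S \<and> (\<forall>g\<in>states R S. lower h g))"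

(* The width w.  For a region without any path the value is irrelevant, as then there are
   no sites and no moves. *)
definition width :: "tri set \<Rightarrow> nat" where
  "width R = nat (Max (fst ` ends R) - Min (fst ` starts R))"

(* Internal path points (path i, coordinate x).  The horizontal extent of each path is the
   same in all states, so the top state can be used to define them. *)
definition sites :: "tri set \<Rightarrow> (tri \<Rightarrow> (int \<times> int) set) \<Rightarrow> ((int \<times> int) \<times> int) set" where
  "sites R S = {(i, x). {x - 1, x, x + 1} \<subseteq> dom (top_state R S i)}"

(* The number m of local moves between bottom and top; the factor 1/2 is due to the heights
   being in half edge lengths. *)
definition num_moves :: "tri set \<Rightarrow> (tri \<Rightarrow> (int \<times> int) set) \<Rightarrow> real" where
  "num_moves R S = (\<Sum>i\<in>starts R. \<Sum>x\<in>dom (top_state R S i).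
     real_of_int (the (top_state R S i x) - the (bottom_state R S i x)) / 2)"

(* Number of paths blocking a push of the point (x, y) in direction d = 1 (up) or -1. *)
definition blocking :: "routing \<Rightarrow> int \<Rightarrow> int \<Rightarrow> int \<Rightarrow> nat" where
  "blocking h x y d = (LEAST k. \<forall>j. h j x \<noteq> Some (y + 2 * d * (int k + 1)))"

definition shift :: "routing \<Rightarrow> int \<Rightarrow> int \<Rightarrow> int \<Rightarrow> nat \<Rightarrow> routing" where
  "shift h x y d k = (\<lambda>j.
     if \<exists>l\<le>k. h j x = Some (y + 2 * d * int l) then (h j)(x \<mapsto> the (h j x) + 2 * d) else h j)"

type_synonym choice = "((int \<times> int) \<times> int) \<times> bool \<times> real"

fun update :: "tri set \<Rightarrow> choice \<Rightarrow> routing \<Rightarrow> routing" where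
  "update R ((i, x), up, u) h =
     (let d = (if up then 1 else - 1) in
      case h i x of
        None \<Rightarrow> h
      | Some y \<Rightarrow>
          (let k = blocking h x y d; h' = shift h x y d k in
           if h i (x - 1) = Some (y + d) \<and> h i (x + 1) = Some (y + d) \<and>
              h' \<in> routings R \<and> u \<le> 1 / (real k + 1)
           then h' else h))"

definition choice_law :: "tri set \<Rightarrow> (tri \<Rightarrow> (int \<times> int) set) \<Rightarrow> choice measure" where
  "choice_law R S = measure_pmf (pmf_of_set (sites R S)) \<Otimes>\<^sub>M
     (measure_pmf (bernoulli_pmf (1 / 2)) \<Otimes>\<^sub>M uniform_measure lborel {0..1})"

definition choices :: "tri set \<Rightarrow> (tri \<Rightarrow> (int \<times> int) set) \<Rightarrow> (nat \<Rightarrow> choice) measure" where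
  "choices R S = (\<Pi>\<^sub>M n\<in>UNIV. choice_law R S)"

(* All copies of the chain are driven by the same sequence of choices. *)
fun chain :: "tri set \<Rightarrow> (nat \<Rightarrow> choice) \<Rightarrow> routing \<Rightarrow> nat \<Rightarrow> routing" where
  "chain R \<omega> h 0 = h"
| "chain R \<omega> h (Suc n) = update R (\<omega> n) (chain R \<omega> h n)"

definition coalesced ::
    "tri set \<Rightarrow> (tri \<Rightarrow> (int \<times> int) set) \<Rightarrow> (nat \<Rightarrow> choice) \<Rightarrow> nat \<Rightarrow> bool" where
  "coalesced R S \<omega> n \<longleftrightarrow> chain R \<omega> (top_state R S) n = chain R \<omega> (bottom_state R S) n"

end

theory Submission imports Defs "HOL-Real_Asymp.Real_Asymp" begin

text \<open>
  The coupling is monotone, so it suffices to bound the expectation of the weighted distance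
  $\sum g(x)\,(h^{top}_i(x) - h^{bot}_i(x))$ between the two extreme copies.  A path at a local
  minimum blocked by $k$ others moves $k + 1$ points with probability $1/(k+1)$; hence the
  expected motion of a column is the discrete Laplacian of its heights, up to moves blocked by
  the border, and these only help.  If $(g(x-1) + g(x+1))/2 \le (1 - r)\,g(x)$, the
  weighted distance contracts by $1 - r/p$ per step.  The choice
  $g(x) = \cos(\beta x / w)$ with $\beta$ slightly below $\pi$ gives
  $r \approx \pi^2/(2w^2)$ while $g$ stays bounded below; the loss $\log(1/\min g)$ is
  of lower order than $\log m$ unless $m < w/2$, in which case few columns can move and a cruder
  $g$ supported on them suffices.

  The extreme states exist because states correspond to systems of disjoint paths and the pointwise
  maximum of two states is a state.  This needs that all states have the same path ends and the same
  vertical order of paths: the number of paths below a vertical edge on the border is the same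
  in all states, since the difference of two path families is a circulation, whose potential
  is constant on every complementary component.
\<close>

section \<open>Tilings and disjoint path systems\<close>

text \<open>Pushing whole stacks of paths leaves the border as the only obstacle. This is what makes
  the drift inequality work: the set of paths under a border edge is the same in all states, so a
  stack held by the border in one state is held at the same place in every state lying further in
  the direction of the push.

  With \<open>\<beta> = pi\<close> the cosine would almost vanish at the outer columns, and the
  ratio of its extreme values, of order \<open>w\<close>, would cost a term \<open>ln w\<close> that
  need not be small against \<open>ln m\<close>. The factor \<open>1 - 1 / ln w\<close> in
  \<open>\<beta>\<close> spoils the rate only by a factor tending to 1 and reduces the cost to
  \<open>ln (ln w)\<close>, which is negligible once \<open>m\<close> is at least about
  \<open>w / 2\<close>.

  If instead the number \<open>n\<close> of columns that can move satisfies
  \<open>n + 1 \<le> w / 2\<close>, the parabola contracts at rate \<open>4 / (n + 1)^2\<close>, at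
  least \<open>16 / w^2\<close> and thus more than three times the nominal
  \<open>pi^2 / (2 * w^2)\<close>. The surplus pays for its ratio of extreme values, which is at
  most \<open>n \<le> m\<close>.\<close>

lemma share_edge_cases:
  assumes "share_edge s t"
  obtains (vertical) x y where "{s, t} = {Lt x y, Rt x y}"
  | (slanted) x y y' where "{s, t} = {Rt x y, Lt (x + 1) y'}" "\<bar>y' - y\<bar> = 1"
proof -
  obtain p q where "corners s \<inter> corners t = {p, q}" and "p \<noteq> q"
    using assms unfolding share_edge_def card_2_iff by blast
  then have pq: "p \<noteq> q" "p \<in> corners s \<inter> corners t" "q \<in> corners s \<inter> corners t"
    by blast+
  have neq: "s \<noteq> t"
    using assms by (cases s) (auto simp: share_edge_def)
  have main: "thesis" if st: "{s, t} = {Rt x y, Lt x' y'}" for x y x' y'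
  proof -
    have "corners s \<inter> corners t = corners (Rt x y) \<inter> corners (Lt x' y')"
      using st by (auto simp: doubleton_eq_iff)
    then have "p \<in> corners (Rt x y) \<inter> corners (Lt x' y')" "q \<in> corners (Rt x y) \<inter> corners (Lt x' y')"
      using pq by auto
    then have "(x' = x \<and> y' = y) \<or> (x' = x + 1 \<and> \<bar>y' - y\<bar> = 1)"
      using pq(1) by auto
    then show thesis
    proof (elim disjE conjE)
      assume "x' = x" "y' = y"
      then have "{s, t} = {Lt x y, Rt x y}" using st by (simp add: insert_commute)
      then show thesis by (rule vertical)
    next
      assume "x' = x + 1" and y: "\<bar>y' - y\<bar> = 1"
      then have "{s, t} = {Rt x y, Lt (x + 1) y'}" using st by simp
      then show thesis using y by (rule slanted)
    qed
  qed
  show thesis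
  proof (cases s)
    case s: (Rt x y)
    show thesis
    proof (cases t)
      case (Rt x' y')
      then show thesis using pq s neq by auto
    next
      case (Lt x' y')
      then show thesis using s main by auto
    qed
  next
    case s: (Lt x y)
    show thesis
    proof (cases t)
      case (Lt x' y')
      then show thesis using pq s neq by auto
    next
      case (Rt x' y')
      then show thesis using s main by (metis insert_commute)
    qed
  qed
qed

lemma triangles_iff [simp]:
  "Rt x y \<in> triangles \<longleftrightarrow> even (x + y)"
  "Lt x y \<in> triangles \<longleftrightarrow> even (x + y)"
  by (auto simp: triangles_def)

lemma share_edge_vertical: "share_edge (Lt x y) (Rt x y)"
proof -
  have "corners (Lt x y) \<inter> corners (Rt x y) = {(x, y - 1), (x, y + 1)}" by auto
  then show ?thesis by (simp add: share_edge_def)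
qed

lemma share_edge_slanted:
  assumes "\<bar>y' - y\<bar> = 1"
  shows "share_edge (Rt x y) (Lt (x + 1) y')"
proof (cases "y' = y + 1")
  case True
  then have "corners (Rt x y) \<inter> corners (Lt (x + 1) y') = {(x, y + 1), (x + 1, y)}" by auto
  then show ?thesis by (simp add: share_edge_def)
next
  case False
  with assms have "y' = y - 1" by linarith
  then have "corners (Rt x y) \<inter> corners (Lt (x + 1) y') = {(x, y - 1), (x + 1, y)}" by auto
  then show ?thesis by (simp add: share_edge_def)
qed

lemma lozenge_cases:
  assumes "b \<in> lozenges"
  obtains x y where "b = {Lt x y, Rt x y}"
  | x y y' where "b = {Rt x y, Lt (x + 1) y'}" "\<bar>y' - y\<bar> = 1"
proof -
  obtain s t where "b = {s, t}" "share_edge s t"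
    using assms by (auto simp: lozenges_def)
  then show thesis
    using that share_edge_cases by metis
qed

lemma slanted_not_vertical [simp]:
  "{Rt x y, Lt (x + 1) y'} \<noteq> {Lt a b, Rt a b}"
  "{Lt a b, Rt a b} \<noteq> {Rt x y, Lt (x + 1) y'}"
  "{Rt (x - 1) y, Lt x y'} \<noteq> {Lt a b, Rt a b}"
proof -
  show *: "{Rt x y, Lt (x + 1) y'} \<noteq> {Lt a b, Rt a b}" for x
  proof
    assume "{Rt x y, Lt (x + 1) y'} = {Lt a b, Rt a b}"
    then have "x = a \<and> x + 1 = a"
      unfolding doubleton_eq_iff tri.inject by blast
    then show False by linarith
  qed
  show "{Lt a b, Rt a b} \<noteq> {Rt x y, Lt (x + 1) y'}" using * by metis
  show "{Rt (x - 1) y, Lt x y'} \<noteq> {Lt a b, Rt a b}" using *[of "x - 1"] by simp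
qed

text \<open>An intrinsic description of routings, essentially by conditions on neighbouring lines;
  \<open>routings_iff\<close> shows that it is exact. Joins and pushes are defined on height
  functions, and this description allows checking their validity without building a tiling.\<close>

locale path_system =
  fixes R :: "tri set" and h :: routing
  assumes finite_region: "finite R"
    and region_triangles: "R \<subseteq> triangles"
    and label: "h i x = Some y \<Longrightarrow> i \<in> starts R \<and> fst i \<le> x"
    and start: "i \<in> starts R \<Longrightarrow> h i (fst i) = Some (snd i)"
    and defined_back: "fst i \<le> x \<Longrightarrow> h i (x + 1) \<noteq> None \<Longrightarrow> h i x \<noteq> None"
    and step: "h i x = Some y \<Longrightarrow> h i (x + 1) = Some y' \<Longrightarrow> \<bar>y' - y\<bar> = 1"
    and disjoint: "h i x = Some y \<Longrightarrow> h j x = Some y \<Longrightarrow> i = j"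
    and inside: "h i x = Some y \<Longrightarrow> h i (x + 1) = Some y' \<Longrightarrow> Rt x y \<in> R \<and> Lt (x + 1) y' \<in> R"
    and finish: "h i x = Some y \<Longrightarrow> h i (x + 1) = None \<Longrightarrow> (x, y) \<in> ends R"
    and ends_hit: "(x, y) \<in> ends R \<Longrightarrow> \<exists>i. h i x = Some y"

lemma reach_column:
  assumes "(i, q) \<in> (segments T)\<^sup>*"
  shows "fst i \<le> fst q"
  using assms by (induction rule: rtrancl_induct) (auto simp: segments_def)

lemma reach_cases:
  assumes "(i, (x, y)) \<in> (segments T)\<^sup>*"
  obtains "i = (x, y)"
  | y0 where "fst i < x" "(i, (x - 1, y0)) \<in> (segments T)\<^sup>*" "{Rt (x - 1) y0, Lt x y} \<in> T"
  using assms
proof (cases rule: rtranclE)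
  case b: (step b)
  then obtain y0 where "b = (x - 1, y0)" "{Rt (x - 1) y0, Lt x y} \<in> T"
    by (auto simp: segments_def)
  then show thesis using b reach_column[OF b(1)] that(2) by auto
qed (use that in auto)

section \<open>From tilings to path systems\<close>

locale tiling =
  fixes R :: "tri set" and T :: "tri set set"
  assumes finite_R: "finite R" and R_triangles: "R \<subseteq> triangles" and tiling: "T \<in> tilings R"
begin

lemma blocks_disjoint: "b \<in> T \<Longrightarrow> c \<in> T \<Longrightarrow> t \<in> b \<Longrightarrow> t \<in> c \<Longrightarrow> b = c"
  using tiling by (auto simp: tilings_def partition_on_def disjoint_def)

lemma block_subset: "b \<in> T \<Longrightarrow> b \<subseteq> R"
  using tiling by (auto simp: tilings_def partition_on_def)

lemma block_lozenge: "b \<in> T \<Longrightarrow> b \<in> lozenges"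
  using tiling by (auto simp: tilings_def)

lemma covered: "t \<in> R \<Longrightarrow> \<exists>b\<in>T. t \<in> b"
  using tiling by (auto simp: tilings_def partition_on_def)

lemma Rt_cases:
  assumes "Rt x y \<in> R"
  obtains "{Lt x y, Rt x y} \<in> T" | y' where "{Rt x y, Lt (x + 1) y'} \<in> T"
proof -
  obtain b where b: "b \<in> T" "Rt x y \<in> b" using covered[OF assms] by auto
  from block_lozenge[OF b(1)] show thesis
  proof (cases rule: lozenge_cases)
    case (1 x' y')
    then show thesis using b that(1) by simp
  next
    case (2 x' y0 y')
    then have "{Rt x y, Lt (x + 1) y'} \<in> T" using b by simp
    then show thesis by (rule that(2))
  qed
qed

lemma Lt_cases:
  assumes "Lt x y \<in> R"
  obtains "{Lt x y, Rt x y} \<in> T" | y0 where "{Rt (x - 1) y0, Lt x y} \<in> T"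
proof -
  obtain b where b: "b \<in> T" "Lt x y \<in> b" using covered[OF assms] by auto
  from block_lozenge[OF b(1)] show thesis
  proof (cases rule: lozenge_cases)
    case (1 x' y')
    then show thesis using b that(1) by simp
  next
    case (2 x' y0 y')
    then have "{Rt (x - 1) y0, Lt x y} \<in> T" using b by simp
    then show thesis by (rule that(2))
  qed
qed

lemma segment_step:
  assumes "{Rt x y, Lt (x + 1) y'} \<in> T"
  shows "\<bar>y' - y\<bar> = 1"
  using block_lozenge[OF assms]
proof (cases rule: lozenge_cases)
  case (1 x0 y0)
  then show ?thesis by simp
next
  case (2 x0 y0 z)
  then have "y0 = y" "z = y'" by (simp_all add: doubleton_eq_iff)
  then show ?thesis using 2 by simp
qed

lemma segment_right_unique:
  assumes "{Rt x y, Lt (x + 1) y'} \<in> T" "{Rt x y, Lt (x + 1) y''} \<in> T"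
  shows "y' = y''"
  using blocks_disjoint[OF assms, of "Rt x y"] by (auto simp: doubleton_eq_iff)

lemma segment_left_unique:
  assumes "{Rt x y, Lt z w} \<in> T" "{Rt x y', Lt z w} \<in> T"
  shows "y = y'"
  using blocks_disjoint[OF assms, of "Lt z w"] by (auto simp: doubleton_eq_iff)

lemma reach_unique:
  assumes "(i, (x, y)) \<in> (segments T)\<^sup>*" "(i, (x, y')) \<in> (segments T)\<^sup>*"
  shows "y = y'"
  using assms
proof (induction "nat (x - fst i)" arbitrary: x y y' rule: less_induct)
  case less
  from less.prems(1) show ?case
  proof (cases rule: reach_cases)
    case 1
    with less.prems(2) show ?thesis by (cases rule: reach_cases) auto
  next
    case (2 y0)
    from less.prems(2) show ?thesis
    proof (cases rule: reach_cases)
      case 1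
      with 2 show ?thesis by auto
    next
      case (2 y1)
      then have "y1 = y0" using less.hyps[of "x - 1"] \<open>(i, (x - 1, y0)) \<in> _\<close> by auto
      then show ?thesis using segment_right_unique[of "x - 1" y0 y y'] 2 \<open>{Rt (x - 1) y0, Lt x y} \<in> T\<close> by auto
    qed
  qed
qed

text \<open>Segments are also unique towards the left, so two paths through a common point can be
  followed back together until one of them is at its start. No segment enters a start, since the
  triangle to its left is not in \<open>R\<close>; hence the other path starts there too.\<close>

lemma reach_start_unique:
  assumes "(i, (x, y)) \<in> (segments T)\<^sup>*" "(j, (x, y)) \<in> (segments T)\<^sup>*"
    and "i \<in> starts R" "j \<in> starts R"
  shows "i = j"
  using assms(1,2)
proof (induction "nat (x - fst i)" arbitrary: x y rule: less_induct)
  case less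
  from less.prems(1) show ?case
  proof (cases rule: reach_cases)
    case 1
    with assms(3) have "Lt x y \<notin> R" by (auto simp: starts_def)
    with less.prems(2) 1 block_subset show ?thesis by (cases rule: reach_cases) auto
  next
    case (2 y0)
    then have L: "Lt x y \<in> R" using block_subset by auto
    from less.prems(2) show ?thesis
    proof (cases rule: reach_cases)
      case 1
      with L assms(4) show ?thesis by (auto simp: starts_def)
    next
      case (2 y1)
      then have "y1 = y0" using \<open>{Rt (x - 1) y0, Lt x y} \<in> T\<close> segment_left_unique by blast
      then show ?thesis using less.hyps[of "x - 1" y0] 2 \<open>fst i < x\<close> \<open>(i, (x - 1, y0)) \<in> _\<close> by auto
    qed
  qed
qed

lemma routing_of_eq: "routing_of R T i x = Some y \<longleftrightarrow> i \<in> starts R \<and> (i, (x, y)) \<in> (segments T)\<^sup>*"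
proof -
  have "(THE y. (i, (x, y)) \<in> (segments T)\<^sup>*) = z" if "(i, (x, z)) \<in> (segments T)\<^sup>*" for z
    using that reach_unique by blast
  then show ?thesis by (auto simp: routing_of_def)
qed

lemma routing_of_None: "routing_of R T i x = None \<longleftrightarrow> i \<notin> starts R \<or> (\<forall>y. (i, (x, y)) \<notin> (segments T)\<^sup>*)"
  by (auto simp: routing_of_def)

lemma routing_of_segment:
  assumes "routing_of R T i x = Some y" "routing_of R T i (x + 1) = Some y'"
  shows "{Rt x y, Lt (x + 1) y'} \<in> T"
proof -
  have r: "(i, (x, y)) \<in> (segments T)\<^sup>*" "(i, (x + 1, y')) \<in> (segments T)\<^sup>*"
    using assms by (auto simp: routing_of_eq)
  from r(2) show ?thesis
  proof (cases rule: reach_cases)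
    case 1
    with reach_column[OF r(1)] show ?thesis by auto
  next
    case (2 y0)
    with reach_unique[OF r(1)] have "y0 = y" by auto
    with 2 show ?thesis by auto
  qed
qed

text \<open>The left triangle must belong to a lozenge with two vertical sides, so a segment enters
  the point. Following segments to the left cannot go on forever in a finite region and can stop
  only at a start.\<close>

lemma exists_start:
  assumes "Lt x y \<in> R" "{Lt x y, Rt x y} \<notin> T"
  shows "\<exists>i\<in>starts R. (i, (x, y)) \<in> (segments T)\<^sup>*"
proof -
  define C where "C = (\<lambda>t. case t of Rt a b \<Rightarrow> a | Lt a b \<Rightarrow> a) ` R"
  have C: "a \<in> C" if "Lt a b \<in> R" for a b
    using that by (auto simp: C_def image_iff intro!: bexI[of _ "Lt a b"])
  have "finite C" using finite_R by (simp add: C_def)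
  \<comment> \<open>A column bounding the walk on the left, so that \<open>nat (x - c)\<close>
    decreases.\<close>
  define c where "c = Min C"
  have cle: "c \<le> a" if "Lt a b \<in> R" for a b
    unfolding c_def using C[OF that] \<open>finite C\<close> by simp
  show ?thesis
    using assms
  proof (induction "nat (x - c)" arbitrary: x y rule: less_induct)
    case less
    obtain y0 where y0: "{Rt (x - 1) y0, Lt x y} \<in> T"
      by (rule Lt_cases[OF less.prems(1)]) (use less.prems(2) in auto)
    then have s: "((x - 1, y0), (x, y)) \<in> segments T"
      by (auto simp: segments_def intro: exI[of _ "x - 1"])
    have Rt: "Rt (x - 1) y0 \<in> R" using y0 block_subset by auto
    show ?case
    proof (cases "Lt (x - 1) y0 \<in> R")
      case False
      then have "(x - 1, y0) \<in> starts R" using Rt by (auto simp: starts_def)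
      then show ?thesis using s by blast
    next
      case True
      have "{Lt (x - 1) y0, Rt (x - 1) y0} \<notin> T"
        using blocks_disjoint[OF y0, of "{Lt (x - 1) y0, Rt (x - 1) y0}" "Rt (x - 1) y0"] by auto
      moreover have "nat (x - 1 - c) < nat (x - c)" using cle[OF True] by simp
      ultimately obtain i where "i \<in> starts R" "(i, (x - 1, y0)) \<in> (segments T)\<^sup>*"
        using less.hyps True by blast
      then show ?thesis using s by (meson rtrancl.rtrancl_into_rtrancl)
    qed
  qed
qed

lemma path_system_routing_of: "path_system R (routing_of R T)"
proof
  fix i j :: "int \<times> int" and x y y' :: int
  let ?h = "routing_of R T"
  show "finite R" "R \<subseteq> triangles" by (fact finite_R R_triangles)+
  show "i \<in> starts R \<and> fst i \<le> x" if "?h i x = Some y"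
    using that reach_column[of i "(x, y)"] by (auto simp: routing_of_eq)
  show "?h i (fst i) = Some (snd i)" if "i \<in> starts R"
    using that by (simp add: routing_of_eq)
  show "?h i x \<noteq> None" if le: "fst i \<le> x" and def: "?h i (x + 1) \<noteq> None"
  proof -
    obtain z where z: "i \<in> starts R" "(i, (x + 1, z)) \<in> (segments T)\<^sup>*"
      using def routing_of_eq by (metis not_None_eq)
    from z(2) show ?thesis
      by (cases rule: reach_cases) (use le z in \<open>auto simp: routing_of_None\<close>)
  qed
  show "\<bar>y' - y\<bar> = 1" if "?h i x = Some y" "?h i (x + 1) = Some y'"
    using segment_step routing_of_segment that by blast
  show "i = j" if "?h i x = Some y" "?h j x = Some y"
    using that reach_start_unique unfolding routing_of_eq by blast
  show "Rt x y \<in> R \<and> Lt (x + 1) y' \<in> R" if "?h i x = Some y" "?h i (x + 1) = Some y'"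
    using routing_of_segment[OF that] block_subset by auto
  show "(x, y) \<in> ends R" if h: "?h i x = Some y" "?h i (x + 1) = None"
  proof -
    have r: "i \<in> starts R" "(i, (x, y)) \<in> (segments T)\<^sup>*" using h by (auto simp: routing_of_eq)
    have no_seg: "{Rt x y, Lt (x + 1) z} \<notin> T" for z
    proof
      assume "{Rt x y, Lt (x + 1) z} \<in> T"
      then have "((x, y), (x + 1, z)) \<in> segments T" by (auto simp: segments_def)
      then have "(i, (x + 1, z)) \<in> (segments T)\<^sup>*" using r(2) by (meson rtrancl.rtrancl_into_rtrancl)
      then show False using h(2) r(1) by (auto simp: routing_of_None)
    qed
    from r(2) show ?thesis
    proof (cases rule: reach_cases)
      case 1
      then have "Rt x y \<in> R" "Lt x y \<notin> R" using r(1) by (auto simp: starts_def)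
      from this(1) show ?thesis
        by (rule Rt_cases) (use no_seg block_subset \<open>Lt x y \<notin> R\<close> in auto)
    next
      case (2 y0)
      then have L: "Lt x y \<in> R" using block_subset by auto
      have "{Lt x y, Rt x y} \<notin> T"
        using blocks_disjoint[OF 2(3), of "{Lt x y, Rt x y}" "Lt x y"] by auto
      then have "Rt x y \<notin> R" using no_seg by (meson Rt_cases)
      then show ?thesis using L by (simp add: ends_def)
    qed
  qed
  show "\<exists>i. ?h i x = Some y" if "(x, y) \<in> ends R"
  proof -
    have "Lt x y \<in> R" "Rt x y \<notin> R" using that by (auto simp: ends_def)
    moreover from this have "{Lt x y, Rt x y} \<notin> T" using block_subset by auto
    ultimately show ?thesis using exists_start routing_of_eq by blast
  qed
qed

end

section \<open>From path systems back to tilings\<close>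

context path_system
begin

definition path_tiling :: "tri set set" where
  "path_tiling =
     {{Rt x y, Lt (x + 1) y'} | x y y'. \<exists>i. h i x = Some y \<and> h i (x + 1) = Some y'} \<union>
     {{Lt x y, Rt x y} | x y. Lt x y \<in> R \<and> Rt x y \<in> R \<and> (\<forall>i. h i x \<noteq> Some y)}"

lemma path_tilingI:
  "h i x = Some y \<Longrightarrow> h i (x + 1) = Some y' \<Longrightarrow> {Rt x y, Lt (x + 1) y'} \<in> path_tiling"
  "Lt x y \<in> R \<Longrightarrow> Rt x y \<in> R \<Longrightarrow> (\<And>i. h i x \<noteq> Some y) \<Longrightarrow> {Lt x y, Rt x y} \<in> path_tiling"
  unfolding path_tiling_def
  by (rule UnI1, intro CollectI exI conjI, rule refl, assumption, assumption)
    (rule UnI2, intro CollectI exI conjI allI, rule refl, assumption, assumption, assumption)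

lemma path_tilingE:
  assumes "b \<in> path_tiling"
  obtains x y y' i where "b = {Rt x y, Lt (x + 1) y'}" "h i x = Some y" "h i (x + 1) = Some y'"
  | x y where "b = {Lt x y, Rt x y}" "\<And>i. h i x \<noteq> Some y" "Lt x y \<in> R" "Rt x y \<in> R"
  using assms unfolding path_tiling_def
proof (elim UnE CollectE exE conjE)
  fix x y y' i
  assume "b = {Rt x y, Lt (x + 1) y'}" "h i x = Some y" "h i (x + 1) = Some y'"
  then show thesis by (rule that(1))
next
  fix x y
  assume "b = {Lt x y, Rt x y}" "Lt x y \<in> R" "Rt x y \<in> R" "\<forall>i. h i x \<noteq> Some y"
  then show thesis using that(2) by blast
qed

lemma point_even:
  assumes "h i x = Some y"
  shows "even (x + y)"
proof -
  have "Lt x y \<in> R \<or> Rt x y \<in> R"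
  proof (cases "h i (x + 1)")
    case None
    from finish[OF assms this] show ?thesis by (simp add: ends_def)
  next
    case (Some y')
    from inside[OF assms this] show ?thesis by simp
  qed
  then have "Lt x y \<in> triangles \<or> Rt x y \<in> triangles" using region_triangles by blast
  then show ?thesis by simp
qed

lemma first_point: "h i x = Some y \<Longrightarrow> h i (x - 1) = None \<Longrightarrow> i = (x, y)"
proof -
  assume h: "h i x = Some y" "h i (x - 1) = None"
  have "\<not> fst i \<le> x - 1" using defined_back[of i "x - 1"] h by auto
  moreover have "i \<in> starts R" "fst i \<le> x" using label h by auto
  ultimately have "fst i = x" by linarith
  then show ?thesis using start[OF \<open>i \<in> starts R\<close>] h by (auto intro: prod_eqI)
qed

lemma left_inside:
  assumes "h i x = Some y" "h i (x - 1) \<noteq> None"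
  shows "Lt x y \<in> R"
proof -
  obtain z where "h i (x - 1) = Some z" using assms(2) by blast
  then show ?thesis using inside[of i "x - 1" z y] assms(1) by simp
qed

lemma right_inside:
  assumes "h i x = Some y" "h i (x + 1) \<noteq> None"
  shows "Rt x y \<in> R"
  using inside[OF assms(1)] assms(2) by blast

lemma Rt_point:
  assumes "Rt x y \<in> R"
  shows "(\<exists>i. h i x = Some y) \<or> Lt x y \<in> R"
proof (cases "Lt x y \<in> R")
  case False
  then have "(x, y) \<in> starts R" using assms by (simp add: starts_def)
  from start[OF this] have "h (x, y) x = Some y" by simp
  then show ?thesis by blast
qed auto

lemma Lt_point:
  assumes "Lt x y \<in> R"
  shows "(\<exists>i. h i x = Some y) \<or> Rt x y \<in> R"
proof (cases "Rt x y \<in> R")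
  case False
  then have "(x, y) \<in> ends R" using assms by (simp add: ends_def)
  then show ?thesis using ends_hit by blast
qed auto

lemma Rt_continues:
  assumes "Rt x y \<in> R" "h i x = Some y"
  shows "\<exists>y'. h i (x + 1) = Some y'"
proof (rule ccontr)
  assume "\<not> ?thesis"
  then have "h i (x + 1) = None" by simp
  from finish[OF assms(2) this] show False using assms(1) by (simp add: ends_def)
qed

lemma Lt_continues:
  assumes "Lt x y \<in> R" "h i x = Some y"
  shows "\<exists>y'. h i (x - 1) = Some y'"
proof (rule ccontr)
  assume "\<not> ?thesis"
  then have "h i (x - 1) = None" by auto
  then have "i = (x, y)" using assms first_point by blast
  then show False using label[OF assms(2)] assms(1) by (auto simp: starts_def)
qed

text \<open>Every vertical border edge lies on a path, as a start or by \<open>ends_hit\<close>.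
  Hence an edge off all paths has both of its triangles in \<open>R\<close>, and these two can be
  paired; all other triangles are used by exactly one step of a path.\<close>

lemma path_tiling: "path_tiling \<in> tilings R"
proof -
  have inR: "b \<subseteq> R" if "b \<in> path_tiling" for b
    using that by (cases rule: path_tilingE) (use inside in auto)
  have "path_tiling \<subseteq> lozenges"
  proof
    fix b assume b: "b \<in> path_tiling"
    have "\<exists>s t. b = {s, t} \<and> share_edge s t"
      using b
    proof (rule path_tilingE)
      fix x y y' i
      assume bl: "b = {Rt x y, Lt (x + 1) y'}" and "h i x = Some y" "h i (x + 1) = Some y'"
      then have "share_edge (Rt x y) (Lt (x + 1) y')" by (intro share_edge_slanted step)
      then show ?thesis using bl by (intro exI conjI)
    next
      fix x y
      assume "b = {Lt x y, Rt x y}"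
      then show ?thesis using share_edge_vertical by (intro exI conjI)
    qed
    moreover have "b \<subseteq> triangles" using inR[OF b] region_triangles by auto
    ultimately show "b \<in> lozenges" by (auto simp: lozenges_def)
  qed
  moreover have "partition_on R path_tiling"
  proof (rule partition_onI)
    show "{} \<notin> path_tiling" by (auto simp: path_tiling_def)
    show "\<Union>path_tiling = R"
    proof
      show "\<Union>path_tiling \<subseteq> R" using inR by auto
      show "R \<subseteq> \<Union>path_tiling"
      proof
        fix t assume t: "t \<in> R"
        show "t \<in> \<Union>path_tiling"
        proof (cases t)
          case (Rt x y)
          then have tR: "Rt x y \<in> R" using t by simp
          show ?thesis
          proof (cases "\<exists>i. h i x = Some y")
            case True
            then obtain i where i: "h i x = Some y" by blast
            then obtain y' where "h i (x + 1) = Some y'" using Rt_continues[OF tR] by blast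
            from path_tilingI(1)[OF i this] show ?thesis using Rt by blast
          next
            case False
            then have "{Lt x y, Rt x y} \<in> path_tiling"
              using Rt_point[OF tR] tR by (intro path_tilingI) blast+
            then show ?thesis using Rt by blast
          qed
        next
          case (Lt x y)
          then have tR: "Lt x y \<in> R" using t by simp
          show ?thesis
          proof (cases "\<exists>i. h i x = Some y")
            case True
            then obtain i where i: "h i x = Some y" by blast
            then obtain y' where "h i (x - 1) = Some y'" using Lt_continues[OF tR] by blast
            from path_tilingI(1)[OF this, of y] i show ?thesis using Lt by auto
          next
            case False
            then have "{Lt x y, Rt x y} \<in> path_tiling"
              using Lt_point[OF tR] tR by (intro path_tilingI) blast+
            then show ?thesis using Lt by blast
          qed
        qed
      qed
    qed
    show "disjnt b c" if "b \<in> path_tiling" "c \<in> path_tiling" "b \<noteq> c" for b c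
    proof (rule ccontr)
      assume "\<not> disjnt b c"
      then obtain t where "t \<in> b" "t \<in> c" by (auto simp: disjnt_def)
      show False
        using that(1)
      proof (rule path_tilingE)
        fix x y y' i
        assume b: "b = {Rt x y, Lt (x + 1) y'}" "h i x = Some y" "h i (x + 1) = Some y'"
        from that(2) show False
        proof (rule path_tilingE)
          fix a d d' j
          assume c: "c = {Rt a d, Lt (a + 1) d'}" "h j a = Some d" "h j (a + 1) = Some d'"
          have "a = x \<and> (d = y \<or> d' = y')"
            using b c \<open>t \<in> b\<close> \<open>t \<in> c\<close> by auto
          then have "i = j" using b c disjoint by blast
          then show False using b c \<open>a = x \<and> _\<close> that(3) by auto
        next
          fix a d
          assume c: "c = {Lt a d, Rt a d}" and "\<And>i. h i a \<noteq> Some d"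
          then have "h i a \<noteq> Some d" by blast
          then show False using b c \<open>t \<in> b\<close> \<open>t \<in> c\<close> by auto
        qed
      next
        fix x y
        assume b: "b = {Lt x y, Rt x y}" and free: "\<And>i. h i x \<noteq> Some y"
        from that(2) show False
        proof (rule path_tilingE)
          fix a d d' j
          assume c: "c = {Rt a d, Lt (a + 1) d'}" "h j a = Some d" "h j (a + 1) = Some d'"
          have "h j x \<noteq> Some y" by (rule free)
          then show False using b c \<open>t \<in> b\<close> \<open>t \<in> c\<close> by auto
        next
          fix a d
          assume "c = {Lt a d, Rt a d}"
          then show False using b \<open>t \<in> b\<close> \<open>t \<in> c\<close> that(3) by auto
        qed
      qed
    qed
  qed
  ultimately show ?thesis by (simp add: tilings_def)
qed

lemma segments_path_tiling:
  "segments path_tiling = {((x, y), (x + 1, y')) | x y y'. \<exists>i. h i x = Some y \<and> h i (x + 1) = Some y'}"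
proof -
  have "{Rt x y, Lt (x + 1) y'} \<in> path_tiling \<longleftrightarrow> (\<exists>i. h i x = Some y \<and> h i (x + 1) = Some y')" for x y y'
  proof
    assume "{Rt x y, Lt (x + 1) y'} \<in> path_tiling"
    then show "\<exists>i. h i x = Some y \<and> h i (x + 1) = Some y'"
    proof (cases rule: path_tilingE)
      case (1 a b b' i)
      then have "a = x" "b = y" "b' = y'" by (simp_all add: doubleton_eq_iff)
      then show ?thesis using 1 by blast
    qed simp
  qed (use path_tilingI in blast)
  then show ?thesis by (simp add: segments_def)
qed

lemma routing_of_path_tiling: "routing_of R path_tiling = h"
proof -
  interpret T: tiling R path_tiling
    by (rule tiling.intro) (fact finite_region, fact region_triangles, fact path_tiling)
  have fwd: "h i (fst q) = Some (snd q)" if "(i, q) \<in> (segments path_tiling)\<^sup>*" "i \<in> starts R" for i q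
    using that(1)
  proof (induction rule: rtrancl_induct)
    case base
    then show ?case using start that(2) by simp
  next
    case (step q r)
    then obtain j where "h j (fst q) = Some (snd q)" "h j (fst r) = Some (snd r)"
      by (auto simp: segments_path_tiling)
    then show ?case using step.IH disjoint by metis
  qed
  have bwd: "(i, (x, y)) \<in> (segments path_tiling)\<^sup>*" if "h i x = Some y" for i x y
    using that
  proof (induction "nat (x - fst i)" arbitrary: x y rule: less_induct)
    case less
    show ?case
    proof (cases "h i (x - 1)")
      case None
      then show ?thesis using first_point less.prems by simp
    next
      case (Some z)
      moreover have "fst i \<le> x - 1" using label[OF Some] by simp
      ultimately have "(i, (x - 1, z)) \<in> (segments path_tiling)\<^sup>*" by (intro less.hyps) auto
      moreover have "((x - 1, z), (x - 1 + 1, y)) \<in> segments path_tiling"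
        unfolding segments_path_tiling
        by (rule CollectI, rule exI[of _ "x - 1"], rule exI[of _ z], rule exI[of _ y], intro conjI exI[of _ i])
          (use Some less.prems in auto)
      ultimately show ?thesis by (simp add: rtrancl.rtrancl_into_rtrancl)
    qed
  qed
  show ?thesis
  proof (intro ext)
    fix i x
    have "routing_of R path_tiling i x = Some y \<longleftrightarrow> h i x = Some y" for y
      unfolding T.routing_of_eq using fwd[of i "(x, y)"] bwd[of i x y] label[of i x y] by auto
    then show "routing_of R path_tiling i x = h i x"
      by (metis not_None_eq)
  qed
qed

end

lemma routings_iff:
  assumes "finite R" "R \<subseteq> triangles"
  shows "h \<in> routings R \<longleftrightarrow> path_system R h"
proof
  assume "h \<in> routings R"
  then obtain T where "T \<in> tilings R" "h = routing_of R T" by (auto simp: routings_def)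
  then show "path_system R h" using tiling.path_system_routing_of assms tiling.intro by blast
next
  assume "path_system R h"
  then interpret path_system R h .
  show "h \<in> routings R"
    using path_tiling routing_of_path_tiling by (force simp: routings_def)
qed

section \<open>Path counts along the border\<close>

text \<open>Counts on the line itself, including paths that start or end there, whereas
  \<open>passing_under\<close> counts only paths that cross a column next to the line.\<close>

definition below :: "routing \<Rightarrow> int \<Rightarrow> int \<Rightarrow> (int \<times> int) set" where
  "below h x y = {i. \<exists>z. h i x = Some z \<and> z < y}"

text \<open>Heights on one line have the same parity, so distinct ones differ by at least 2; two
  simultaneous unit steps can then make them meet but not exchange them.\<close>

lemma parallel_steps:
  fixes x y y' z z' :: int
  assumes "\<bar>z' - z\<bar> = 1" "\<bar>y' - y\<bar> = 1" "even (x + z)" "even (x + y)" "z \<noteq> y" "z' \<noteq> y'"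
  shows "z < y \<longleftrightarrow> z' < y'"
proof -
  have "even ((x + y) - (x + z))" using assms(3,4) by (rule dvd_diff[rotated])
  then have "even (y - z)" by (simp only: add_diff_cancel_left)
  then obtain k where k: "y - z = 2 * k" by (rule evenE)
  consider "k \<ge> 1" | "k \<le> - 1" using k assms(5) by linarith
  then show ?thesis by cases (use k assms(1,2,6) in linarith)+
qed

lemma
  assumes "finite R"
  shows finite_starts: "finite (starts R)" and finite_ends: "finite (ends R)"
proof -
  let ?f = "\<lambda>t. case t of Rt x y \<Rightarrow> (x, y) | Lt x y \<Rightarrow> (x, y)"
  have "starts R \<subseteq> ?f ` R" "ends R \<subseteq> ?f ` R" by (force simp: starts_def ends_def)+
  then show "finite (starts R)" "finite (ends R)" using assms finite_surj by blast+
qed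

context path_system
begin

lemma point_in_region: "h i x = Some y \<Longrightarrow> Rt x y \<in> R \<or> Lt x y \<in> R"
  using finish[of i x y] right_inside[of i x y] by (cases "h i (x + 1)") (auto simp: ends_def)

lemma finite_below: "finite (below h x y)"
proof (rule finite_subset)
  show "below h x y \<subseteq> starts R" using label unfolding below_def by blast
qed (use finite_region finite_starts in blast)

text \<open>The paths lost between the line and the column to its right are those ending below
  \<open>y\<close>, and their number depends on the region only. So for comparing two routings the
  column count and the line count are interchangeable; \<open>card_passing_Lt\<close> does the same
  on the left.\<close>

lemma card_passing_Rt:
  "card (passing_under h (Rt x y)) + card {z. z < y \<and> (x, z) \<in> ends R} = card (below h x y)"
proof -
  define E where "E = {i \<in> below h x y. h i (x + 1) = None}"
  have "inj_on (\<lambda>i. the (h i x)) E"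
  proof (rule inj_onI)
    fix i j assume "i \<in> E" "j \<in> E" "the (h i x) = the (h j x)"
    then have "h i x = Some (the (h i x))" "h j x = Some (the (h i x))"
      unfolding E_def below_def by force+
    then show "i = j" by (rule disjoint)
  qed
  moreover have "(\<lambda>i. the (h i x)) ` E = {z. z < y \<and> (x, z) \<in> ends R}"
  proof (intro equalityI subsetI)
    fix z assume "z \<in> (\<lambda>i. the (h i x)) ` E"
    then obtain i where "h i x = Some z" "z < y" "h i (x + 1) = None"
      unfolding E_def below_def by force
    then show "z \<in> {z. z < y \<and> (x, z) \<in> ends R}" using finish by blast
  next
    fix z assume z: "z \<in> {z. z < y \<and> (x, z) \<in> ends R}"
    then obtain i where i: "h i x = Some z" using ends_hit by blast
    have "Rt x z \<notin> R" using z by (simp add: ends_def)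
    then have "h i (x + 1) = None" using right_inside[OF i] by blast
    then have "i \<in> E" using i z unfolding E_def below_def by simp
    then show "z \<in> (\<lambda>i. the (h i x)) ` E" using i by (metis image_eqI option.sel)
  qed
  ultimately have "card E = card {z. z < y \<and> (x, z) \<in> ends R}" using card_image by metis
  moreover have "card (below h x y) = card (passing_under h (Rt x y)) + card E"
  proof -
    have "below h x y = passing_under h (Rt x y) \<union> E" "passing_under h (Rt x y) \<inter> E = {}"
      unfolding E_def below_def by auto
    then show ?thesis using finite_below[of x y] by (simp add: card_Un_disjoint)
  qed
  ultimately show ?thesis by simp
qed

lemma card_passing_Lt:
  "card (passing_under h (Lt x y)) + card {z. z < y \<and> (x, z) \<in> starts R} = card (below h x y)"
proof -
  define E where "E = {i \<in> below h x y. h i (x - 1) = None}"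
  have "E = Pair x ` {z. z < y \<and> (x, z) \<in> starts R}"
  proof (intro equalityI subsetI)
    fix i assume "i \<in> E"
    then obtain z where z: "h i x = Some z" "z < y" "h i (x - 1) = None"
      unfolding E_def below_def by blast
    then have "i = (x, z)" using first_point by blast
    then show "i \<in> Pair x ` {z. z < y \<and> (x, z) \<in> starts R}" using label[OF z(1)] z(2) by blast
  next
    fix i assume "i \<in> Pair x ` {z. z < y \<and> (x, z) \<in> starts R}"
    then obtain z where z: "i = (x, z)" "z < y" "(x, z) \<in> starts R" by blast
    have "h i (x - 1) = None"
    proof (rule ccontr)
      assume "h i (x - 1) \<noteq> None"
      then obtain w where "h i (x - 1) = Some w" by blast
      from label[OF this] show False using z(1) by simp
    qed
    then show "i \<in> E" using start[OF z(3)] z unfolding E_def below_def by simp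
  qed
  then have "card E = card {z. z < y \<and> (x, z) \<in> starts R}"
    by (simp add: card_image inj_on_def)
  moreover have "card (below h x y) = card (passing_under h (Lt x y)) + card E"
  proof -
    have "below h x y = passing_under h (Lt x y) \<union> E" "passing_under h (Lt x y) \<inter> E = {}"
      unfolding E_def below_def by auto
    then show ?thesis using finite_below[of x y] by (simp add: card_Un_disjoint)
  qed
  ultimately show ?thesis by simp
qed

text \<open>A path crossing this column misses the heights \<open>y\<close> and \<open>y'\<close>,
  since there it would use a missing triangle, and by parity it stays on one side of the slanted
  edge.\<close>

lemma passing_slanted:
  assumes "Rt x y \<notin> R" "Lt (x + 1) y' \<notin> R" "\<bar>y' - y\<bar> = 1" "even (x + y)"
  shows "passing_under h (Rt x y) = passing_under h (Lt (x + 1) y')"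
proof -
  have "z < y \<longleftrightarrow> z' < y'" if z: "h i x = Some z" "h i (x + 1) = Some z'" for i z z'
  proof -
    have "z \<noteq> y" "z' \<noteq> y'" using inside[OF z] assms by auto
    then show ?thesis
      using step[OF z] assms(3,4) point_even[OF z(1)] by (intro parallel_steps)
  qed
  then show ?thesis by force
qed

lemma order_step:
  assumes "h i x = Some a" "h j x = Some b" "h i (x + 1) = Some a'" "h j (x + 1) = Some b'"
  shows "a < b \<longleftrightarrow> a' < b'"
proof -
  have *: "\<bar>a' - a\<bar> = 1" "\<bar>b' - b\<bar> = 1" "even (x + a)" "even (x + b)"
    using step[OF assms(1,3)] step[OF assms(2,4)] point_even assms by blast+
  have eq: "a = b \<longleftrightarrow> a' = b'"
  proof
    assume "a = b"
    then have "i = j" using disjoint[OF assms(1)] assms(2) by simp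
    then show "a' = b'" using assms by simp
  next
    assume "a' = b'"
    then have "i = j" using disjoint[OF assms(3)] assms(4) by simp
    then show "a = b" using assms by simp
  qed
  show ?thesis
  proof (cases "a = b")
    case False
    then show ?thesis using * eq by (intro parallel_steps) auto
  qed (use eq in simp)
qed

end

section \<open>Comparison of two path systems\<close>

locale path_system_pair = g: path_system R g + h: path_system R h
  for R :: "tri set" and g h :: routing
begin

text \<open>Only cardinalities are compared: these propagate through the complement of the region.
  That the same paths are counted follows later, once the vertical order is known to agree.\<close>

definition same_passing :: "tri \<Rightarrow> bool" where
  "same_passing t \<longleftrightarrow> card (passing_under g t) = card (passing_under h t)"

lemma same_passing_vertical:
  "same_passing (Rt x y) \<longleftrightarrow> card (below g x y) = card (below h x y)"
  "same_passing (Lt x y) \<longleftrightarrow> card (below g x y) = card (below h x y)"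
  unfolding same_passing_def
  using g.card_passing_Rt[of x y] h.card_passing_Rt[of x y]
    g.card_passing_Lt[of x y] h.card_passing_Lt[of x y]
  by linarith+

lemma same_passing_slanted:
  assumes "Rt x y \<notin> R" "Lt (x + 1) y' \<notin> R" "\<bar>y' - y\<bar> = 1" "even (x + y)"
  shows "same_passing (Rt x y) \<longleftrightarrow> same_passing (Lt (x + 1) y')"
  unfolding same_passing_def using g.passing_slanted[OF assms] h.passing_slanted[OF assms] by simp

lemma same_passing_adjacent:
  assumes "s \<in> triangles - R" "t \<in> triangles - R" "share_edge s t"
  shows "same_passing s \<longleftrightarrow> same_passing t"
  using assms(3)
proof (cases rule: share_edge_cases)
  case (vertical x y)
  then show ?thesis using same_passing_vertical[of x y] by (auto simp: doubleton_eq_iff)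
next
  case (slanted x y y')
  have "{s, t} \<subseteq> triangles - R" using assms(1,2) by simp
  then have *: "Rt x y \<in> triangles - R" "Lt (x + 1) y' \<in> triangles - R"
    unfolding slanted(1) by blast+
  have "even (x + y)" using *(1) by simp
  then have "same_passing (Rt x y) \<longleftrightarrow> same_passing (Lt (x + 1) y')"
    using same_passing_slanted[OF _ _ slanted(2)] * by blast
  then show ?thesis using slanted by (auto simp: doubleton_eq_iff)
qed

lemma same_passing_connected:
  assumes "(s, t) \<in> {(a, b). a \<in> triangles - R \<and> b \<in> triangles - R \<and> share_edge a b}\<^sup>*"
  shows "same_passing s \<longleftrightarrow> same_passing t"
  using assms
proof (induction rule: rtrancl_induct)
  case (step t u)
  then have "same_passing t \<longleftrightarrow> same_passing u" using same_passing_adjacent by blast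
  with step.IH show ?case by simp
qed simp

lemma region_box:
  obtains M where "0 < M" "\<And>x y. Rt x y \<in> R \<or> Lt x y \<in> R \<Longrightarrow> \<bar>x\<bar> < M \<and> \<bar>y\<bar> < M"
proof -
  define f where "f = (\<lambda>t. case t of Rt x y \<Rightarrow> max \<bar>x\<bar> \<bar>y\<bar> | Lt x y \<Rightarrow> max \<bar>x\<bar> \<bar>y\<bar>)"
  define M where "M = Max (insert 0 (f ` R)) + 1"
  have fin: "finite (insert 0 (f ` R))" using g.finite_region by simp
  have "f t \<le> M - 1" if "t \<in> R" for t
    unfolding M_def using Max_ge[OF fin, of "f t"] that by simp
  from this[of "Rt _ _"] this[of "Lt _ _"]
  have "\<bar>x\<bar> < M \<and> \<bar>y\<bar> < M" if "Rt x y \<in> R \<or> Lt x y \<in> R" for x y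
    using that unfolding f_def by force
  moreover have "0 < M" unfolding M_def using Max_ge[OF fin, of 0] by simp
  ultimately show thesis using that by blast
qed

text \<open>The unbounded component reaches triangles left of the whole region, where nothing passes.\<close>

lemma same_passing_outside:
  assumes t: "t \<in> triangles - R" and inf: "infinite {s. (t, s) \<in>
    {(a, b). a \<in> triangles - R \<and> b \<in> triangles - R \<and> share_edge a b}\<^sup>*}"
  shows "same_passing t"
proof -
  obtain M where M: "0 < M" "\<And>x y. Rt x y \<in> R \<or> Lt x y \<in> R \<Longrightarrow> \<bar>x\<bar> < M \<and> \<bar>y\<bar> < M"
    using region_box by blast
  have empty: "below k x y = {}" if "path_system R k" "M \<le> \<bar>x\<bar> \<or> y \<le> - M" for k x y
  proof (rule ccontr)
    assume "below k x y \<noteq> {}"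
    then obtain i z where z: "k i x = Some z" "z < y" unfolding below_def by blast
    have "\<bar>x\<bar> < M \<and> \<bar>z\<bar> < M"
      by (rule M(2)) (rule path_system.point_in_region[OF that(1) z(1)])
    then show False using that(2) z(2) by linarith
  qed
  have g: "path_system R g" and h: "path_system R h" by unfold_locales
  have low: "same_passing (Rt x y)" if "M \<le> \<bar>x\<bar> \<or> y \<le> - M" for x y
    using that same_passing_vertical(1) empty[OF g] empty[OF h] by simp
  \<comment> \<open>Above the region the counts are compared by moving to the right across slanted
    edges of missing triangles, beginning at the line \<open>- M\<close>, which no path
    meets.\<close>
  have high: "same_passing (Rt x y)" if "- M \<le> x" "M \<le> y" "even (x + y)" for x y
    using that
  proof (induction x arbitrary: y rule: int_ge_induct)
    case base
    then show ?case using low M(1) by simp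
  next
    case (step x)
    have out: "Rt a b \<notin> R" "Lt a b \<notin> R" if "M \<le> b" for a b using M(2)[of a b] that by auto
    have "same_passing (Rt x (y + 1))" using step.prems by (intro step.IH) auto
    moreover have "Rt x (y + 1) \<notin> R" "Lt (x + 1) y \<notin> R" using out step.prems by auto
    ultimately have "same_passing (Lt (x + 1) y)"
      using same_passing_slanted[of x "y + 1" y] step.prems by auto
    then show ?case using same_passing_vertical by blast
  qed
  \<comment> \<open>An infinite component contains a triangle outside this finite box, where
    \<open>low\<close> or \<open>high\<close> applies; the value is then carried back along the
    component.\<close>
  define Box where "Box = (\<lambda>(x, y). Rt x y) ` ({- M..M} \<times> {- M..M}) \<union> (\<lambda>(x, y). Lt x y) ` ({- M..M} \<times> {- M..M})"
  have "finite Box" unfolding Box_def by auto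
  then obtain s where s: "(t, s) \<in>
    {(a, b). a \<in> triangles - R \<and> b \<in> triangles - R \<and> share_edge a b}\<^sup>*" "s \<notin> Box"
    using inf by (metis (no_types, lifting) finite_subset mem_Collect_eq subsetI)
  have "s \<in> triangles" using s(1) t by (cases rule: rtranclE) auto
  have Rt: "same_passing (Rt x y)" if "s = Rt x y \<or> s = Lt x y" for x y
  proof -
    have "even (x + y)" using that \<open>s \<in> triangles\<close> by auto
    moreover have "(x, y) \<notin> {- M..M} \<times> {- M..M}" using s(2) that unfolding Box_def by force
    ultimately show ?thesis using low[of x y] high[of x y] by fastforce
  qed
  have "same_passing s"
    using Rt same_passing_vertical by (cases s) auto
  then show ?thesis using same_passing_connected[OF s(1)] by simp
qed

text \<open>The invariant of a sweep over the lines from left to right. With a common order, equal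
  counts below a border edge become equal sets of paths.\<close>

definition consistent :: "int \<Rightarrow> bool" where
  "consistent x \<longleftrightarrow> {i. g i x \<noteq> None} = {i. h i x \<noteq> None} \<and>
     (\<forall>i j. g i x \<noteq> None \<longrightarrow> g j x \<noteq> None \<longrightarrow>
        (the (g i x) < the (g j x) \<longleftrightarrow> the (h i x) < the (h j x)))"

lemma consistent_dom: "consistent x \<Longrightarrow> g i x = None \<longleftrightarrow> h i x = None"
  unfolding consistent_def by blast

lemma consistent_less:
  assumes "consistent x" "g i x = Some a" "g j x = Some b" "h i x = Some a'" "h j x = Some b'"
  shows "a < b \<longleftrightarrow> a' < b'"
  using assms unfolding consistent_def by (metis option.distinct(1) option.sel)

end

text \<open>Both sets are initial segments of the same order, hence nested, and nested finite sets
  of equal size coincide.\<close>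

lemma down_sets_eq:
  fixes f f' :: "'a \<Rightarrow> int"
  assumes "finite L" "\<And>i j. i \<in> L \<Longrightarrow> j \<in> L \<Longrightarrow> f i < f j \<longleftrightarrow> f' i < f' j"
    and "card {i \<in> L. f i < a} = card {i \<in> L. f' i < a'}"
  shows "{i \<in> L. f i < a} = {i \<in> L. f' i < a'}"
proof -
  have "{i \<in> L. f i < a} \<subseteq> {i \<in> L. f' i < a'} \<or> {i \<in> L. f' i < a'} \<subseteq> {i \<in> L. f i < a}"
  proof (rule ccontr)
    assume "\<not> ?thesis"
    then obtain i j where "i \<in> L" "f i < a" "\<not> f' i < a'" "j \<in> L" "f' j < a'" "\<not> f j < a" by blast
    then show False using assms(2)[of i j] by linarith
  qed
  then show ?thesis
  proof
    assume "{i \<in> L. f i < a} \<subseteq> {i \<in> L. f' i < a'}"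
    then show ?thesis using assms(1,3) by (intro card_subset_eq) auto
  next
    assume "{i \<in> L. f' i < a'} \<subseteq> {i \<in> L. f i < a}"
    then show ?thesis using assms(1,3) by (intro card_subset_eq[symmetric]) auto
  qed
qed

text \<open>Any two states agree on the number of paths below a boundary edge of a vertical line.\<close>

locale same_boundary_counts = path_system_pair +
  assumes boundary_count:
    "even (x + y) \<Longrightarrow> Rt x y \<notin> R \<or> Lt x y \<notin> R \<Longrightarrow> card (below g x y) = card (below h x y)"
begin

lemma below_eq:
  assumes "consistent x" "card (below g x y) = card (below h x y)"
  shows "below g x y = below h x y"
proof -
  define L where "L = {i. g i x \<noteq> None}"
  have L': "L = {i. h i x \<noteq> None}" using assms(1) unfolding L_def consistent_def by blast
  have eq: "below g x y = {i \<in> L. the (g i x) < y}" "below h x y = {i \<in> L. the (h i x) < y}"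
    unfolding below_def L_def using L'[unfolded L_def] by force+
  have "finite L"
  proof (rule finite_subset)
    show "L \<subseteq> starts R" unfolding L_def using g.label by blast
  qed (use g.finite_region finite_starts in blast)
  moreover have "the (g i x) < the (g j x) \<longleftrightarrow> the (h i x) < the (h j x)" if ij: "i \<in> L" "j \<in> L" for i j
  proof -
    obtain a b a' b' where "g i x = Some a" "g j x = Some b" "h i x = Some a'" "h j x = Some b'"
      using ij[unfolded L_def] ij[unfolded L'] by blast
    then show ?thesis using consistent_less[OF assms(1)] by simp
  qed
  ultimately show ?thesis
    using assms(2) unfolding eq by (rule down_sets_eq)
qed

text \<open>Let \<open>j\<close> be the path that \<open>h\<close> has at this end. The sets of
  paths strictly below the end agree in both states, so \<open>j\<close> is not below it in
  \<open>g\<close> and \<open>i\<close> is not below it in \<open>h\<close>; the common order then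
  forces both to be at height \<open>y\<close>, and disjointness gives \<open>i = j\<close>.\<close>

lemma end_same:
  assumes "consistent x" "(x, y) \<in> ends R" "g i x = Some y"
  shows "h i x = Some y"
proof -
  have Rt: "Rt x y \<notin> R" using assms(2) by (simp add: ends_def)
  have "even (x + y)" using g.point_even assms(3) by blast
  then have B: "below g x y = below h x y" using below_eq boundary_count assms(1) Rt by blast
  obtain j where j: "h j x = Some y" using h.ends_hit assms(2) by blast
  have "g j x \<noteq> None" "h i x \<noteq> None"
    using assms(1,3) j unfolding consistent_def by blast+
  then obtain a b where a: "g j x = Some a" and b: "h i x = Some b" by blast
  have "j \<notin> below g x y" unfolding B by (simp add: below_def j)
  moreover have "i \<notin> below h x y" unfolding B[symmetric] by (simp add: below_def assms(3))
  ultimately have "y \<le> a" "y \<le> b" using a b by (simp_all add: below_def)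
  moreover have "y < a \<longleftrightarrow> b < y"
    using assms(1,3) a b j unfolding consistent_def by (metis option.distinct(1) option.sel)
  ultimately have "a = y" by linarith
  then have "i = j" using a assms(3) g.disjoint by blast
  then show ?thesis using j by simp
qed

end

lemma (in path_system_pair) swap: "path_system_pair R h g"
  by unfold_locales

lemma (in path_system_pair) consistent_swap:
  "path_system_pair.consistent h g x \<longleftrightarrow> consistent x"
proof -
  interpret s: path_system_pair R h g by (rule swap)
  show ?thesis unfolding s.consistent_def consistent_def by blast
qed

context same_boundary_counts
begin

lemma swap_counts: "same_boundary_counts R h g"
  by unfold_locales (use boundary_count in auto)

lemma continue_same:
  assumes "consistent x" "g i x \<noteq> None" "g i (x + 1) = None"
  shows "h i (x + 1) = None"
proof -
  obtain y where y: "g i x = Some y" using assms(2) by blast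
  have e: "(x, y) \<in> ends R" using g.finish[OF y assms(3)] .
  then have "h i x = Some y" using end_same[OF assms(1) _ y] by blast
  moreover have "Rt x y \<notin> R" using e by (simp add: ends_def)
  ultimately show ?thesis using h.right_inside by blast
qed

text \<open>Paths present on both lines keep their order because they are disjoint, and new paths
  begin at starts, which do not depend on the state. Only the order between an old path and a new
  one needs an argument, and it comes from the border count at the start.\<close>

lemma consistent_step:
  assumes "consistent x"
  shows "consistent (x + 1)"
proof -
  interpret s: same_boundary_counts R h g by (rule swap_counts)
  have cs: "s.consistent x" using assms consistent_swap by blast
  have dom0: "g i x \<noteq> None \<longleftrightarrow> h i x \<noteq> None" for i
    using assms unfolding consistent_def by blast
  have new: "k i (x + 1) = Some (snd i) \<and> i \<in> starts R \<and> fst i = x + 1"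
    if k: "path_system R k" "k i x = None" "k i (x + 1) \<noteq> None" for k i
  proof -
    interpret k: path_system R k by (rule k(1))
    obtain z where z: "k i (x + 1) = Some z" using k(3) by blast
    have "i = (x + 1, z)" using k.first_point[OF z] k(2) by simp
    then show ?thesis using k.label[OF z] z by simp
  qed
  have g: "path_system R g" and h: "path_system R h" by unfold_locales
  have dom1: "g i (x + 1) \<noteq> None \<longleftrightarrow> h i (x + 1) \<noteq> None" for i
  proof (cases "g i x = None")
    case True
    then have "h i x = None" using dom0 by blast
    then show ?thesis
      using True new[OF g, of i] new[OF h, of i] g.start[of i] h.start[of i] by force
  next
    case False
    then show ?thesis
      using continue_same[OF assms False] s.continue_same[OF cs, of i] dom0[of i] by metis
  qed
  define L where "L = {i. g i x \<noteq> None \<and> g i (x + 1) \<noteq> None}"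
  have "finite L"
  proof (rule finite_subset)
    show "L \<subseteq> starts R" unfolding L_def using g.label by blast
  qed (use g.finite_region finite_starts in blast)
  have old: "the (g i (x + 1)) < the (g j (x + 1)) \<longleftrightarrow> the (h i (x + 1)) < the (h j (x + 1))"
    if ij: "i \<in> L" "j \<in> L" for i j
  proof -
    obtain a b a' b' where ab: "g i x = Some a" "g j x = Some b" "g i (x + 1) = Some a'" "g j (x + 1) = Some b'"
      using ij unfolding L_def by blast
    obtain c d c' d' where cd: "h i x = Some c" "h j x = Some d" "h i (x + 1) = Some c'" "h j (x + 1) = Some d'"
      using ij dom0[of i] dom0[of j] dom1[of i] dom1[of j] unfolding L_def by blast
    have "a < b \<longleftrightarrow> c < d" using assms ab cd unfolding consistent_def by (metis option.distinct(1) option.sel)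
    then show ?thesis using g.order_step[OF ab] h.order_step[OF cd] ab cd by simp
  qed
  \<comment> \<open>The new starts \<open>N\<close> below \<open>y\<close> are common to both
    states. Subtracting them from the equal border counts leaves equally many old paths below
    \<open>y\<close>, and \<open>down_sets_eq\<close> applies.\<close>
  have mixed: "the (g j (x + 1)) < y \<longleftrightarrow> the (h j (x + 1)) < y"
    if st: "(x + 1, y) \<in> starts R" and "j \<in> L" for y j
  proof -
    define N where "N = {i \<in> starts R. fst i = x + 1 \<and> snd i < y}"
    have split: "below k (x + 1) y = N \<union> {i \<in> L. the (k i (x + 1)) < y}" "N \<inter> L = {}"
      if k: "path_system R k" "\<And>i. k i x = None \<longleftrightarrow> g i x = None"
        "\<And>i. k i (x + 1) = None \<longleftrightarrow> g i (x + 1) = None" for k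
    proof -
      interpret k: path_system R k by (rule k(1))
      show "N \<inter> L = {}"
        unfolding N_def L_def using g.label by force
      show "below k (x + 1) y = N \<union> {i \<in> L. the (k i (x + 1)) < y}"
      proof (intro equalityI subsetI)
        fix i assume "i \<in> below k (x + 1) y"
        then obtain z where z: "k i (x + 1) = Some z" "z < y" unfolding below_def by blast
        show "i \<in> N \<union> {i \<in> L. the (k i (x + 1)) < y}"
        proof (cases "k i x = None")
          case True
          then show ?thesis using new[OF k(1) True] z unfolding N_def by auto
        next
          case False
          then have "i \<in> L" using z k(2)[of i] k(3)[of i] unfolding L_def by auto
          then show ?thesis using z by simp
        qed
      next
        fix i assume "i \<in> N \<union> {i \<in> L. the (k i (x + 1)) < y}"
        then show "i \<in> below k (x + 1) y"
        proof
          assume "i \<in> N"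
          then show ?thesis using k.start[of i] unfolding N_def below_def by simp
        next
          assume i: "i \<in> {i \<in> L. the (k i (x + 1)) < y}"
          then obtain z where "k i (x + 1) = Some z" using k(3)[of i] unfolding L_def by auto
          then show ?thesis using i unfolding below_def by simp
        qed
      qed
    qed
    have "finite N" unfolding N_def using g.finite_region finite_starts by simp
    have "Lt (x + 1) y \<notin> R" using st by (simp add: starts_def)
    moreover have "even (x + 1 + y)"
      using g.point_even[OF g.start[OF st]] by simp
    ultimately have "card (below g (x + 1) y) = card (below h (x + 1) y)"
      using boundary_count by blast
    moreover have "card (below g (x + 1) y) = card N + card {i \<in> L. the (g i (x + 1)) < y}"
      using split[OF g] \<open>finite N\<close> \<open>finite L\<close> by (subst split[OF g]) (auto intro!: card_Un_disjoint)
    moreover have "card (below h (x + 1) y) = card N + card {i \<in> L. the (h i (x + 1)) < y}"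
    proof -
      have dh: "h i x = None \<longleftrightarrow> g i x = None" "h i (x + 1) = None \<longleftrightarrow> g i (x + 1) = None" for i
        using dom0 dom1 by blast+
      show ?thesis
        using split[OF h dh] \<open>finite N\<close> \<open>finite L\<close> by (subst split[OF h dh]) (auto intro!: card_Un_disjoint)
    qed
    ultimately have "{i \<in> L. the (g i (x + 1)) < y} = {i \<in> L. the (h i (x + 1)) < y}"
      using \<open>finite L\<close> old by (intro down_sets_eq) auto
    then show ?thesis using \<open>j \<in> L\<close> by blast
  qed
  have "the (g i (x + 1)) < the (g j (x + 1)) \<longleftrightarrow> the (h i (x + 1)) < the (h j (x + 1))"
    if ij: "g i (x + 1) \<noteq> None" "g j (x + 1) \<noteq> None" for i j
  proof -
    have L: "g k x \<noteq> None \<longleftrightarrow> k \<in> L" if "g k (x + 1) \<noteq> None" for k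
      using that unfolding L_def by blast
    have newpos: "g k (x + 1) = Some (snd k) \<and> h k (x + 1) = Some (snd k) \<and> (x + 1, snd k) \<in> starts R"
      if "g k (x + 1) \<noteq> None" "k \<notin> L" for k
    proof -
      have "g k x = None" "h k x = None" using that L dom0 by blast+
      then show ?thesis using new[OF g] new[OF h] that(1) dom1 by (metis prod.collapse)
    qed
    have ne: "the (k a (x + 1)) \<noteq> the (k b (x + 1))"
      if "path_system R k" "k a (x + 1) \<noteq> None" "k b (x + 1) \<noteq> None" "a \<noteq> b" for k a b
      using that path_system.disjoint[OF that(1), of a "x + 1" _ b] by force
    show ?thesis
    proof (cases "i = j")
      case False
      have h_ij: "h i (x + 1) \<noteq> None" "h j (x + 1) \<noteq> None" using ij dom1 by blast+
      have neq: "the (g i (x + 1)) \<noteq> the (g j (x + 1))" "the (h i (x + 1)) \<noteq> the (h j (x + 1))"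
        using ne g h ij h_ij False by blast+
      consider "i \<in> L" "j \<in> L" | "i \<in> L" "j \<notin> L" | "i \<notin> L" "j \<in> L" | "i \<notin> L" "j \<notin> L" by blast
      then show ?thesis
      proof cases
        case 1
        then show ?thesis by (rule old)
      next
        case 2
        then show ?thesis using newpos[OF ij(2)] mixed[of "snd j" i] by simp
      next
        case 3
        then show ?thesis using newpos[OF ij(1)] mixed[of "snd i" j] neq by (simp add: not_less_iff_gr_or_eq) linarith
      next
        case 4
        then show ?thesis using newpos[OF ij(1)] newpos[OF ij(2)] by simp
      qed
    qed simp
  qed
  then show ?thesis unfolding consistent_def using dom1 by blast
qed

lemma consistent: "consistent x"
proof -
  obtain M where M: "0 < M" "\<And>x y. Rt x y \<in> R \<or> Lt x y \<in> R \<Longrightarrow> \<bar>x\<bar> < M \<and> \<bar>y\<bar> < M"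
    using region_box by blast
  have left: "consistent x" if "x \<le> - M" for x
  proof -
    have "k i x = None" if "path_system R k" for k i
    proof (rule ccontr)
      assume "k i x \<noteq> None"
      then obtain y where "k i x = Some y" by blast
      from M(2)[OF path_system.point_in_region[OF that this]] show False using \<open>x \<le> - M\<close> by linarith
    qed
    from this[OF g.path_system_axioms] this[OF h.path_system_axioms] show ?thesis
      unfolding consistent_def by simp
  qed
  show ?thesis
  proof (cases "x \<le> - M")
    case False
    then have "- M \<le> x" by simp
    then show ?thesis
      by (induction x rule: int_ge_induct) (use left consistent_step in auto)
  qed (rule left)
qed

end

section \<open>The lattice of states\<close>

text \<open>With \<open>d = 1\<close> this is the usual order and \<open>join d\<close> the maximum, with \<open>d = - 1\<close> the reverse
  order and the minimum, so that pushes in both directions are treated at once.\<close>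

definition ord :: "int \<Rightarrow> routing \<Rightarrow> routing \<Rightarrow> bool" where
  "ord d g h \<longleftrightarrow> (\<forall>i x a b. g i x = Some a \<longrightarrow> h i x = Some b \<longrightarrow> d * a \<le> d * b)"

definition join :: "int \<Rightarrow> routing \<Rightarrow> routing \<Rightarrow> routing" where
  "join d g h = (\<lambda>i x. case g i x of None \<Rightarrow> None | Some a \<Rightarrow>
     (case h i x of None \<Rightarrow> None | Some b \<Rightarrow> Some (if d * a \<le> d * b then b else a)))"

lemma ordD: "ord d g h \<Longrightarrow> g i x = Some a \<Longrightarrow> h i x = Some b \<Longrightarrow> d * a \<le> d * b"
  unfolding ord_def by blast

lemma ord_minus: "ord (- d) g h \<longleftrightarrow> ord d h g"
  unfolding ord_def by auto

lemma ord_refl: "ord d h h"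
  unfolding ord_def by simp

text \<open>By parity, unequal heights differ by at least 2, and one step cannot reverse them. So
  the maximum follows a single one of the two paths on both lines.\<close>

lemma extreme_step:
  fixes a a' b b' y y' :: int
  assumes "a \<le> y" "b \<le> y" "a' \<le> y'" "b' \<le> y'" "y = a \<or> y = b" "y' = a' \<or> y' = b'"
    and "\<bar>a' - a\<bar> = 1" "\<bar>b' - b\<bar> = 1" "even (b - a)"
  shows "\<bar>y' - y\<bar> = 1"
proof -
  obtain n where n: "b - a = 2 * n" using assms(9) by (rule evenE)
  consider "n = 0" | "n \<ge> 1" | "n \<le> - 1" by linarith
  then show ?thesis
  proof cases
    case 1
    then have "b = a" using n by simp
    then show ?thesis using assms by auto
  next
    case 2
    then have "y = b" using assms(1,2,5) n by auto
    moreover have "a' \<le> b'" using 2 n assms(7,8) by linarith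
    then have "y' = b'" using assms(3,4,6) by auto
    ultimately show ?thesis using assms(8) by simp
  next
    case 3
    then have "y = a" using assms(1,2,5) n by auto
    moreover have "b' \<le> a'" using 3 n assms(7,8) by linarith
    then have "y' = a'" using assms(3,4,6) by auto
    ultimately show ?thesis using assms(7) by simp
  qed
qed

section \<open>States of one connected component\<close>

locale component =
  fixes R :: "tri set" and S :: "tri \<Rightarrow> (int \<times> int) set"
  assumes region: "region R" and nonempty: "states R S \<noteq> {}"
begin

abbreviation "\<Omega> \<equiv> states R S"

lemma finite_region: "finite R" and region_triangles: "R \<subseteq> triangles"
  using region unfolding region_def by blast+

lemma path_system: "h \<in> \<Omega> \<Longrightarrow> path_system R h"
  using routings_iff[OF finite_region region_triangles] unfolding states_def by blast

lemma passing: "h \<in> \<Omega> \<Longrightarrow> t \<in> hole_triangles R \<Longrightarrow> passing_under h t = S t"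
  unfolding states_def by blast

lemma statesI:
  "path_system R h \<Longrightarrow> (\<And>t. t \<in> hole_triangles R \<Longrightarrow> passing_under h t = S t) \<Longrightarrow> h \<in> \<Omega>"
  using routings_iff[OF finite_region region_triangles] unfolding states_def by blast

text \<open>A missing triangle at the edge lies either in a hole, where \<open>S\<close> prescribes
  the passing paths, or in an infinite component of the complement, where all routings have the same
  counts.\<close>

lemma same_boundary_counts:
  assumes "g \<in> \<Omega>" "h \<in> \<Omega>"
  shows "same_boundary_counts R g h"
proof -
  interpret path_system_pair R g h
    using assms by (intro path_system_pair.intro path_system)
  have same: "same_passing t" if t: "t \<in> triangles" "t \<notin> R" for t
  proof (cases "t \<in> hole_triangles R")
    case True
    then show ?thesis unfolding same_passing_def using assms passing by simp
  next
    case False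
    then show ?thesis using t by (intro same_passing_outside) (simp_all add: hole_triangles_def)
  qed
  show ?thesis
  proof
    fix x y :: int assume e: "even (x + y)" and "Rt x y \<notin> R \<or> Lt x y \<notin> R"
    then have "same_passing (Rt x y) \<or> same_passing (Lt x y)"
      using same[of "Rt x y"] same[of "Lt x y"] by (auto simp del: even_add)
    then show "card (below g x y) = card (below h x y)" using same_passing_vertical by blast
  qed
qed

lemma dom_eq:
  assumes "g \<in> \<Omega>" "h \<in> \<Omega>"
  shows "g i x = None \<longleftrightarrow> h i x = None"
proof -
  interpret same_boundary_counts R g h using same_boundary_counts[OF assms] .
  show ?thesis using consistent_dom consistent by blast
qed

lemma defined_transfer:
  assumes "g \<in> \<Omega>" "h \<in> \<Omega>" "g i x = Some a"
  obtains b where "h i x = Some b"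
  using dom_eq[OF assms(1,2), of i x] assms(3) by auto

lemma order_eq:
  assumes "g \<in> \<Omega>" "h \<in> \<Omega>" "g i x = Some a" "g j x = Some b" "h i x = Some a'" "h j x = Some b'"
  shows "a < b \<longleftrightarrow> a' < b'"
proof -
  interpret same_boundary_counts R g h using same_boundary_counts[OF assms(1,2)] .
  show ?thesis using consistent_less[OF consistent assms(3-6)] .
qed

lemma end_eq:
  assumes "g \<in> \<Omega>" "h \<in> \<Omega>" "(x, y) \<in> ends R" "g i x = Some y"
  shows "h i x = Some y"
proof -
  interpret same_boundary_counts R g h using same_boundary_counts[OF assms(1,2)] .
  show ?thesis using end_same[OF consistent assms(3,4)] .
qed

lemma first_eq:
  assumes "g \<in> \<Omega>" "h \<in> \<Omega>" "g i x = Some y" "g i (x - 1) = None"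
  shows "h i x = Some y"
proof -
  interpret g: path_system R g using assms path_system by blast
  interpret h: path_system R h using assms path_system by blast
  have "i = (x, y)" using g.first_point assms by blast
  then show ?thesis using h.start g.label[OF assms(3)] by force
qed

lemma last_eq:
  assumes "g \<in> \<Omega>" "h \<in> \<Omega>" "g i x = Some y" "g i (x + 1) = None"
  shows "h i x = Some y"
  using path_system.finish[OF path_system[OF assms(1)] assms(3,4)] end_eq assms by blast

lemma below_eq:
  assumes "g \<in> \<Omega>" "h \<in> \<Omega>" "even (x + y)" "Rt x y \<notin> R \<or> Lt x y \<notin> R"
  shows "below g x y = below h x y"
proof -
  interpret same_boundary_counts R g h using same_boundary_counts[OF assms(1,2)] .
  show ?thesis using below_eq[OF consistent boundary_count[OF assms(3,4)]] .
qed

lemma point_even: "h \<in> \<Omega> \<Longrightarrow> h i x = Some y \<Longrightarrow> even (x + y)"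
  using path_system.point_even path_system by blast

lemma even_difference:
  assumes "g \<in> \<Omega>" "h \<in> \<Omega>" "g i x = Some a" "h j x = Some b"
  shows "even (b - a)"
proof -
  have "even (x + a)" "even (x + b)" using point_even assms by blast+
  then have "even ((x + b) - (x + a))" by (rule dvd_diff[rotated])
  then show ?thesis by simp
qed

lemma finite_states: "finite \<Omega>"
proof -
  have "tilings R \<subseteq> Pow (Pow R)" unfolding tilings_def partition_on_def by auto
  then have "finite (tilings R)" using finite_region by (simp add: finite_subset)
  then show ?thesis unfolding states_def routings_def by simp
qed

lemma join_cases:
  assumes "join d g h i x = Some z"
  obtains a b where "g i x = Some a" "h i x = Some b" "d * a \<le> d * z" "d * b \<le> d * z" "z = a \<or> z = b"
  using assms unfolding join_def by (fastforce split: option.splits if_splits)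

lemma join_Some:
  "g i x = Some a \<Longrightarrow> h i x = Some b \<Longrightarrow> join d g h i x = Some (if d * a \<le> d * b then b else a)"
  unfolding join_def by simp

lemma join_None: "g \<in> \<Omega> \<Longrightarrow> h \<in> \<Omega> \<Longrightarrow> join d g h i x = None \<longleftrightarrow> g i x = None"
  using dom_eq[of g h i x] unfolding join_def by (simp split: option.splits)

text \<open>The common vertical order keeps the extreme heights of two different paths apart, and
  \<open>end_eq\<close> keeps the ends in place. The remaining conditions are inherited from
  \<open>g\<close> or \<open>h\<close>, except for the step size, which is
  \<open>extreme_step\<close>.\<close>

lemma join_path_system:
  assumes gh: "g \<in> \<Omega>" "h \<in> \<Omega>" and d: "d = 1 \<or> d = - 1"
  shows "path_system R (join d g h)"
proof
  interpret g: path_system R g using gh path_system by blast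
  interpret h: path_system R h using gh path_system by blast
  let ?k = "join d g h"
  fix i j :: "int \<times> int" and x y y' :: int
  show "finite R" "R \<subseteq> triangles" by (fact finite_region region_triangles)+
  show "i \<in> starts R \<and> fst i \<le> x" if "?k i x = Some y"
    using that by (rule join_cases) (use g.label in blast)
  show "?k i (fst i) = Some (snd i)" if "i \<in> starts R"
    using join_Some[of g i "fst i" "snd i" h "snd i" d] g.start[OF that] h.start[OF that] by simp
  show "?k i x \<noteq> None" if "fst i \<le> x" "?k i (x + 1) \<noteq> None"
    using that g.defined_back[of i x] join_None[OF gh] by simp
  show "\<bar>y' - y\<bar> = 1" if k: "?k i x = Some y" "?k i (x + 1) = Some y'"
  proof -
    obtain a b where ab: "g i x = Some a" "h i x = Some b" "d * a \<le> d * y" "d * b \<le> d * y" "y = a \<or> y = b"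
      using k(1) by (rule join_cases)
    obtain a' b' where ab': "g i (x + 1) = Some a'" "h i (x + 1) = Some b'"
      "d * a' \<le> d * y'" "d * b' \<le> d * y'" "y' = a' \<or> y' = b'"
      using k(2) by (rule join_cases)
    have s: "\<bar>a' - a\<bar> = 1" "\<bar>b' - b\<bar> = 1" using g.step h.step ab ab' by blast+
    have e: "even (b - a)" using even_difference[OF gh ab(1,2)] .
    show ?thesis
      using d
    proof
      assume "d = 1"
      then have "a \<le> y" "b \<le> y" "a' \<le> y'" "b' \<le> y'" using ab(3,4) ab'(3,4) by simp_all
      from extreme_step[OF this ab(5) ab'(5) s e] show ?thesis .
    next
      \<comment> \<open>The minimum is reduced to the maximum by negating all heights.\<close>
      assume "d = - 1"
      then have le: "- a \<le> - y" "- b \<le> - y" "- a' \<le> - y'" "- b' \<le> - y'" using ab(3,4) ab'(3,4) by simp_all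
      have ev: "even (- b - - a)" using e by simp
      have eq: "- y = - a \<or> - y = - b" "- y' = - a' \<or> - y' = - b'" using ab(5) ab'(5) by simp_all
      have neg: "\<bar>- p - - q\<bar> = \<bar>p - q\<bar>" for p q :: int
        by (simp add: abs_if)
      have st: "\<bar>- a' - - a\<bar> = 1" "\<bar>- b' - - b\<bar> = 1" unfolding neg by (fact s)+
      from extreme_step[OF le eq st ev] have "\<bar>- y' - - y\<bar> = 1" .
      then show ?thesis unfolding neg .
    qed
  qed
  show "i = j" if k: "?k i x = Some y" "?k j x = Some y"
  proof (rule ccontr)
    assume ne: "i \<noteq> j"
    obtain a b where ab: "g i x = Some a" "h i x = Some b" "d * a \<le> d * y" "d * b \<le> d * y" "y = a \<or> y = b"
      using k(1) by (rule join_cases)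
    obtain a' b' where ab': "g j x = Some a'" "h j x = Some b'"
      "d * a' \<le> d * y" "d * b' \<le> d * y" "y = a' \<or> y = b'"
      using k(2) by (rule join_cases)
    have "a \<noteq> a'" "b \<noteq> b'" using g.disjoint h.disjoint ab ab' ne by blast+
    moreover have "a < a' \<longleftrightarrow> b < b'" using order_eq[OF gh ab(1) ab'(1) ab(2) ab'(2)] .
    ultimately show False using ab(3-5) ab'(3-5) d by (elim disjE) simp_all
  qed
  show "Rt x y \<in> R \<and> Lt (x + 1) y' \<in> R" if k: "?k i x = Some y" "?k i (x + 1) = Some y'"
  proof -
    obtain a b where ab: "g i x = Some a" "h i x = Some b" "y = a \<or> y = b"
      using k(1) by (rule join_cases)
    obtain a' b' where ab': "g i (x + 1) = Some a'" "h i (x + 1) = Some b'" "y' = a' \<or> y' = b'"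
      using k(2) by (rule join_cases)
    show ?thesis using g.inside[OF ab(1) ab'(1)] h.inside[OF ab(2) ab'(2)] ab(3) ab'(3) by blast
  qed
  show "(x, y) \<in> ends R" if k: "?k i x = Some y" "?k i (x + 1) = None"
  proof -
    obtain a b where ab: "g i x = Some a" "h i x = Some b" "y = a \<or> y = b"
      using k(1) by (rule join_cases)
    have "g i (x + 1) = None" "h i (x + 1) = None" using k(2) join_None[OF gh] dom_eq[OF gh] by simp_all
    then show ?thesis using g.finish h.finish ab by blast
  qed
  show "\<exists>i. ?k i x = Some y" if e: "(x, y) \<in> ends R"
  proof -
    obtain i where i: "g i x = Some y" using g.ends_hit[OF e] by blast
    then have "h i x = Some y" by (rule end_eq[OF gh e])
    then have "?k i x = Some y" using join_Some[of g i x y h y d] i by simp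
    then show ?thesis by blast
  qed
qed

text \<open>At each point the join takes one of two heights that lie on the same side of the hole
  triangle, so it passes the hole on that side as well.\<close>

lemma join_state:
  assumes gh: "g \<in> \<Omega>" "h \<in> \<Omega>" and d: "d = 1 \<or> d = - 1"
  shows "join d g h \<in> \<Omega>"
proof (rule statesI)
  show "path_system R (join d g h)" using join_path_system[OF assms] .
  have side: "(\<exists>z. join d g h i x = Some z \<and> z < y) \<longleftrightarrow> (\<exists>z. g i x = Some z \<and> z < y)"
    if "(\<exists>z. g i x = Some z \<and> z < y) \<longleftrightarrow> (\<exists>z. h i x = Some z \<and> z < y)" for i x y
    using that unfolding join_def by (auto split: option.splits)
  fix t assume t: "t \<in> hole_triangles R"
  then have p: "passing_under g t = S t" "passing_under h t = S t" using passing gh by blast+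
  have "passing_under (join d g h) t = passing_under g t"
  proof (cases t)
    case (Rt x y)
    have "(join d g h i (x + 1) \<noteq> None \<and> (\<exists>z. join d g h i x = Some z \<and> z < y)) \<longleftrightarrow>
      (g i (x + 1) \<noteq> None \<and> (\<exists>z. g i x = Some z \<and> z < y))" for i
    proof (cases "g i (x + 1) = None")
      case False
      then have "h i (x + 1) \<noteq> None" using dom_eq[OF gh] by simp
      moreover have "i \<in> passing_under g t \<longleftrightarrow> i \<in> passing_under h t" using p by simp
      ultimately have "(\<exists>z. g i x = Some z \<and> z < y) \<longleftrightarrow> (\<exists>z. h i x = Some z \<and> z < y)"
        using False unfolding Rt passing_under.simps mem_Collect_eq by blast
      from side[OF this] show ?thesis using False join_None[OF gh] by simp
    qed (use join_None[OF gh] in simp)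
    then show ?thesis unfolding Rt passing_under.simps by blast
  next
    case (Lt x y)
    have "(join d g h i (x - 1) \<noteq> None \<and> (\<exists>z. join d g h i x = Some z \<and> z < y)) \<longleftrightarrow>
      (g i (x - 1) \<noteq> None \<and> (\<exists>z. g i x = Some z \<and> z < y))" for i
    proof (cases "g i (x - 1) = None")
      case False
      then have "h i (x - 1) \<noteq> None" using dom_eq[OF gh] by simp
      moreover have "i \<in> passing_under g t \<longleftrightarrow> i \<in> passing_under h t" using p by simp
      ultimately have "(\<exists>z. g i x = Some z \<and> z < y) \<longleftrightarrow> (\<exists>z. h i x = Some z \<and> z < y)"
        using False unfolding Lt passing_under.simps mem_Collect_eq by blast
      from side[OF this] show ?thesis using False join_None[OF gh] by simp
    qed (use join_None[OF gh] in simp)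
    then show ?thesis unfolding Lt passing_under.simps by blast
  qed
  then show "passing_under (join d g h) t = S t" using p by simp
qed

lemma ord_join: "ord d g (join d g h)" "ord d h (join d g h)"
proof -
  have "\<exists>a b. g i x = Some a \<and> h i x = Some b \<and> d * a \<le> d * z \<and> d * b \<le> d * z"
    if "join d g h i x = Some z" for i x z
    using that by (rule join_cases) blast
  then show "ord d g (join d g h)" "ord d h (join d g h)"
    unfolding ord_def by fastforce+
qed

text \<open>\<open>ord\<close> compares heights only where both are defined, so transitivity relies
  on the common domain of all states.\<close>

lemma ord_trans:
  assumes "ord d f g" "ord d g h" "f \<in> \<Omega>" "g \<in> \<Omega>"
  shows "ord d f h"
  unfolding ord_def
proof (intro allI impI)
  fix i x a b assume ab: "f i x = Some a" "h i x = Some b"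
  obtain c where c: "g i x = Some c" using defined_transfer[OF assms(3,4) ab(1)] .
  show "d * a \<le> d * b" using ordD[OF assms(1) ab(1) c] ordD[OF assms(2) c ab(2)] by simp
qed

lemma ord_antisym:
  assumes "ord d g h" "ord d h g" "g \<in> \<Omega>" "h \<in> \<Omega>" "d \<noteq> 0"
  shows "g = h"
proof (intro ext)
  fix i x
  show "g i x = h i x"
  proof (cases "g i x")
    case None
    then show ?thesis using dom_eq[OF assms(3,4), of i x] by simp
  next
    case (Some a)
    then obtain b where b: "h i x = Some b" using defined_transfer[OF assms(3,4)] by blast
    have "d * a = d * b" using ordD[OF assms(1) Some b] ordD[OF assms(2) b Some] by simp
    then show ?thesis using Some b assms(5) by simp
  qed
qed

lemma extreme_exists:
  assumes d: "d = 1 \<or> d = - 1"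
  shows "\<exists>h\<in>\<Omega>. \<forall>g\<in>\<Omega>. ord d g h"
proof -
  have "\<exists>h\<in>\<Omega>. \<forall>g\<in>F. ord d g h" if "finite F" "F \<noteq> {}" "F \<subseteq> \<Omega>" for F
    using that
  proof (induction F rule: finite_ne_induct)
    case (singleton g)
    then show ?case using ord_refl by blast
  next
    case (insert g F)
    then obtain h where h: "h \<in> \<Omega>" "\<forall>f\<in>F. ord d f h" by blast
    have g: "g \<in> \<Omega>" using insert by blast
    have "ord d f (join d g h)" if "f \<in> insert g F" for f
    proof (cases "f = g")
      case False
      then have "f \<in> F" "f \<in> \<Omega>" using that insert.prems by blast+
      then show ?thesis using ord_trans[of d f h] h ord_join(2) by blast
    qed (use ord_join(1)[of d g h] in simp)
    then show ?case using join_state[OF g h(1) d] by blast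
  qed
  then show ?thesis using finite_states nonempty by blast
qed

lemma lower_iff: "g \<in> \<Omega> \<Longrightarrow> h \<in> \<Omega> \<Longrightarrow> lower g h \<longleftrightarrow> ord 1 g h"
proof
  assume gh: "g \<in> \<Omega>" "h \<in> \<Omega>"
  show "ord 1 g h" if "lower g h"
    unfolding ord_def
  proof (intro allI impI)
    fix i x a b assume "g i x = Some a" "h i x = Some b"
    moreover from this have "the (g i x) \<le> the (h i x)" using that unfolding lower_def by blast
    ultimately show "1 * a \<le> 1 * b" by simp
  qed
  show "lower g h" if o: "ord 1 g h"
    unfolding lower_def
  proof (intro allI conjI ballI)
    fix i
    show "dom (g i) = dom (h i)" using dom_eq[OF gh] unfolding dom_def by simp
    fix x assume "x \<in> dom (g i)"
    then obtain a where a: "g i x = Some a" by blast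
    then obtain b where "h i x = Some b" using defined_transfer[OF gh] by blast
    then show "the (g i x) \<le> the (h i x)" using ordD[OF o a] a by simp
  qed
qed

lemma extreme_unique:
  assumes "d = 1 \<or> d = - 1"
  shows "\<exists>!h. h \<in> \<Omega> \<and> (\<forall>g\<in>\<Omega>. ord d g h)"
proof -
  obtain h where h: "h \<in> \<Omega>" "\<forall>g\<in>\<Omega>. ord d g h" using extreme_exists[OF assms] by blast
  then show ?thesis using ord_antisym[of d _ h] assms by (intro ex1I[of _ h]) auto
qed

abbreviation "highest \<equiv> top_state R S"
abbreviation "lowest \<equiv> bottom_state R S"

lemma top_state: "highest \<in> \<Omega> \<and> (\<forall>g\<in>\<Omega>. ord 1 g highest)"
proof -
  have eq: "(h \<in> \<Omega> \<and> (\<forall>g\<in>\<Omega>. lower g h)) \<longleftrightarrow> (h \<in> \<Omega> \<and> (\<forall>g\<in>\<Omega>. ord 1 g h))" for h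
    using lower_iff by blast
  show ?thesis unfolding top_state_def eq by (rule theI'[OF extreme_unique]) simp
qed

lemma bottom_state: "lowest \<in> \<Omega> \<and> (\<forall>g\<in>\<Omega>. ord 1 lowest g)"
proof -
  have eq: "(h \<in> \<Omega> \<and> (\<forall>g\<in>\<Omega>. lower h g)) \<longleftrightarrow> (h \<in> \<Omega> \<and> (\<forall>g\<in>\<Omega>. ord (- 1) g h))" for h
    using lower_iff ord_minus[of 1] by blast
  have "lowest \<in> \<Omega> \<and> (\<forall>g\<in>\<Omega>. ord (- 1) g lowest)"
    unfolding bottom_state_def eq by (rule theI'[OF extreme_unique]) simp
  then show ?thesis using ord_minus[of 1] by blast
qed

end

section \<open>Pushes and monotonicity\<close>

text \<open>A local minimum for \<open>d = 1\<close> and a local maximum for \<open>d = - 1\<close>: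
  exactly the points that may be pushed in direction \<open>d\<close>.\<close>

definition extremum :: "routing \<Rightarrow> int \<times> int \<Rightarrow> int \<Rightarrow> int \<Rightarrow> int \<Rightarrow> bool" where
  "extremum h i x y d \<longleftrightarrow> h i x = Some y \<and> h i (x - 1) = Some (y + d) \<and> h i (x + 1) = Some (y + d)"

definition pushed :: "routing \<Rightarrow> int \<Rightarrow> int \<Rightarrow> int \<Rightarrow> routing" where
  "pushed h x y d = shift h x y d (blocking h x y d)"

definition push :: "tri set \<Rightarrow> int \<Rightarrow> int \<times> int \<Rightarrow> int \<Rightarrow> real \<Rightarrow> routing \<Rightarrow> routing" where
  "push R d i x u h = (case h i x of None \<Rightarrow> h | Some y \<Rightarrow>
     if extremum h i x y d \<and> pushed h x y d \<in> routings R \<and> u \<le> 1 / (real (blocking h x y d) + 1)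
     then pushed h x y d else h)"

lemma update_eq: "update R ((i, x), up, u) h = push R (if up then 1 else - 1) i x u h"
  by (simp add: push_def pushed_def extremum_def Let_def split: option.split)

definition stacked :: "routing \<Rightarrow> int \<Rightarrow> int \<Rightarrow> int \<Rightarrow> int \<times> int \<Rightarrow> bool" where
  "stacked h x y d j \<longleftrightarrow> (\<exists>l\<le>blocking h x y d. h j x = Some (y + 2 * d * int l))"

lemma pushed_apply:
  "pushed h x y d j z = (if z = x \<and> stacked h x y d j then Some (the (h j x) + 2 * d) else h j z)"
  unfolding pushed_def shift_def stacked_def[symmetric] by simp

lemma pushed_None: "pushed h x y d j z = None \<longleftrightarrow> h j z = None"
  unfolding pushed_apply stacked_def by auto

text \<open>Heights on one line have equal parity, so a path strictly behind another position has
  room for a full push of 2.\<close>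

lemma parity_gap:
  fixes v w d :: int
  assumes "d = 1 \<or> d = - 1" "even (w - v)" "d * v \<le> d * w" "w \<noteq> v"
  shows "d * v + 2 \<le> d * w"
proof -
  obtain n where n: "w - v = 2 * n" using assms(2) by (rule evenE)
  show ?thesis
    using assms(1)
  proof
    assume "d = 1"
    then have "v \<le> w" using assms(3) by simp
    then have "1 \<le> n" using n assms(4) by linarith
    then show ?thesis using n \<open>d = 1\<close> by simp
  next
    assume "d = - 1"
    then have "w \<le> v" using assms(3) by simp
    then have "n \<le> - 1" using n assms(4) by linarith
    then show ?thesis using n \<open>d = - 1\<close> by simp
  qed
qed

context path_system
begin

lemma finite_column: "finite {z. \<exists>j. h j x = Some z}"
proof -
  have "{z. \<exists>j. h j x = Some z} \<subseteq> (\<lambda>j. the (h j x)) ` starts R"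
  proof
    fix z assume "z \<in> {z. \<exists>j. h j x = Some z}"
    then obtain j where j: "h j x = Some z" by blast
    then have "j \<in> starts R" using label by blast
    then show "z \<in> (\<lambda>j. the (h j x)) ` starts R" using j by (metis image_eqI option.sel)
  qed
  then show ?thesis using finite_starts[OF finite_region] finite_surj by blast
qed

text \<open>Only finitely many points of a line lie on paths, so the \<open>LEAST\<close> is
  attained.\<close>

lemma blocking_free:
  assumes "d \<noteq> 0"
  shows "h j x \<noteq> Some (y + 2 * d * (int (blocking h x y d) + 1))"
proof -
  have "\<exists>k. \<forall>j. h j x \<noteq> Some (y + 2 * d * (int k + 1))"
  proof (rule ccontr)
    assume "\<nexists>k. \<forall>j. h j x \<noteq> Some (y + 2 * d * (int k + 1))"
    then have "range (\<lambda>k. y + 2 * d * (int k + 1)) \<subseteq> {z. \<exists>j. h j x = Some z}" by blast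
    then have "finite (range (\<lambda>k. y + 2 * d * (int k + 1)))"
      using finite_column finite_subset by blast
    moreover have "inj (\<lambda>k. y + 2 * d * (int k + 1))" using assms by (auto simp: inj_def)
    ultimately show False using finite_imageD infinite_UNIV_nat by blast
  qed
  from LeastI_ex[OF this] show ?thesis unfolding blocking_def by blast
qed

lemma occupied:
  assumes "h i x = Some y" "l \<le> blocking h x y d"
  shows "\<exists>j. h j x = Some (y + 2 * d * int l)"
proof (cases l)
  case 0
  then show ?thesis using assms(1) by (intro exI[of _ i]) simp
next
  case (Suc m)
  then have "m < blocking h x y d" using assms(2) by simp
  from not_less_Least[OF this[unfolded blocking_def]]
  show ?thesis unfolding Suc by (simp add: add.commute)
qed

lemma le_blocking:
  assumes "d \<noteq> 0" "\<And>l. l < n \<Longrightarrow> \<exists>j. h j x = Some (y + 2 * d * (int l + 1))"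
  shows "n \<le> blocking h x y d"
  using assms(2)[of "blocking h x y d"] blocking_free[OF assms(1)] by (meson not_le)

lemma step_at:
  assumes "c = x - 1 \<or> c = x + 1" "h j x = Some a" "h j c = Some b"
  shows "\<bar>b - a\<bar> = 1"
  using assms(1)
proof
  assume "c = x - 1"
  then have "h j (c + 1) = Some a" using assms(2) by simp
  from step[OF assms(3) this] show ?thesis by linarith
qed (use step assms in blast)

text \<open>Induction along the stack: the neighbouring point of the next path has two possible
  heights, and one of them is already taken by the path before it. So all stacked paths have local
  extrema at \<open>x\<close>, provided that they continue to the line \<open>c\<close>.\<close>

lemma stack_neighbours:
  assumes d: "d = 1 \<or> d = - 1" and ext: "extremum h i x y d" and c: "c = x - 1 \<or> c = x + 1"
    and defined: "\<And>j. stacked h x y d j \<Longrightarrow> h j c \<noteq> None"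
    and "l \<le> blocking h x y d" "h j x = Some (y + 2 * d * int l)"
  shows "h j c = Some (y + d + 2 * d * int l)"
  using assms(5,6)
proof (induction l arbitrary: j)
  case 0
  have "h i x = Some y" "h i c = Some (y + d)" using ext c unfolding extremum_def by blast+
  moreover from this have "j = i" using 0 disjoint by simp
  ultimately show ?case by simp
next
  case (Suc l)
  have "h i x = Some y" using ext unfolding extremum_def by blast
  then obtain j0 where j0: "h j0 x = Some (y + 2 * d * int l)"
    using occupied[of i x y l d] Suc.prems by auto
  then have j0c: "h j0 c = Some (y + d + 2 * d * int l)" using Suc by simp
  have "stacked h x y d j" using Suc.prems unfolding stacked_def by blast
  then obtain w where w: "h j c = Some w" using defined by blast
  have "\<bar>w - (y + 2 * d * int (Suc l))\<bar> = 1" using step_at[OF c Suc.prems(2) w] .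
  moreover have "w \<noteq> y + d + 2 * d * int l"
  proof
    assume "w = y + d + 2 * d * int l"
    then have "j = j0" using disjoint w j0c by blast
    then show False using Suc.prems(2) j0 d by auto
  qed
  ultimately have "w = y + d + 2 * d * int (Suc l)" using d by auto
  then show ?case using w by simp
qed

text \<open>Isolates the possible obstructions to a push: a stacked path that starts or ends at
  \<open>x\<close>, or a triangle missing just beyond the stack. The contrapositive is the case
  distinction of \<open>blocked_pinned\<close>.\<close>

lemma path_system_pushed:
  assumes d: "d = 1 \<or> d = - 1" and ext: "extremum h i0 x y d"
    and left: "\<And>j. stacked h x y d j \<Longrightarrow> h j (x - 1) \<noteq> None"
    and right: "\<And>j. stacked h x y d j \<Longrightarrow> h j (x + 1) \<noteq> None"
    and room: "Rt x (y + 2 * d * (int (blocking h x y d) + 1)) \<in> R"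
      "Lt x (y + 2 * d * (int (blocking h x y d) + 1)) \<in> R"
  shows "path_system R (pushed h x y d)"
proof -
  define k where "k = blocking h x y d"
  have i0: "h i0 x = Some y" using ext unfolding extremum_def by blast
  have st: "\<exists>l\<le>k. h j x = Some (y + 2 * d * int l) \<and> pushed h x y d j x = Some (y + 2 * d * (int l + 1)) \<and>
      h j (x - 1) = Some (y + d + 2 * d * int l) \<and> h j (x + 1) = Some (y + d + 2 * d * int l) \<and>
      Rt x (y + 2 * d * (int l + 1)) \<in> R \<and> Lt x (y + 2 * d * (int l + 1)) \<in> R"
    if s: "stacked h x y d j" for j
  proof -
    obtain l where l: "l \<le> k" "h j x = Some (y + 2 * d * int l)"
      using s unfolding stacked_def k_def by blast
    have nb: "h j (x - 1) = Some (y + d + 2 * d * int l)" "h j (x + 1) = Some (y + d + 2 * d * int l)"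
      using stack_neighbours[OF d ext disjI1[OF refl] left] stack_neighbours[OF d ext disjI2[OF refl] right]
        l unfolding k_def by simp_all
    have "pushed h x y d j x = Some (y + 2 * d * (int l + 1))"
      unfolding pushed_apply using s l by (simp add: algebra_simps)
    moreover have "Rt x (y + 2 * d * (int l + 1)) \<in> R \<and> Lt x (y + 2 * d * (int l + 1)) \<in> R"
    proof (cases "l = k")
      case True
      then show ?thesis using room unfolding k_def by simp
    next
      case False
      then have "Suc l \<le> k" using l by simp
      then obtain j' where j': "h j' x = Some (y + 2 * d * int (Suc l))"
        using occupied[OF i0] unfolding k_def by blast
      then have "stacked h x y d j'" using \<open>Suc l \<le> k\<close> unfolding stacked_def k_def by blast
      then have "Rt x (y + 2 * d * int (Suc l)) \<in> R" "Lt x (y + 2 * d * int (Suc l)) \<in> R"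
        using left_inside[OF j'] right_inside[OF j'] left right by blast+
      then show ?thesis by (simp add: add.commute)
    qed
    ultimately show ?thesis using l nb by blast
  qed
  have old: "pushed h x y d j z = h j z" if "z \<noteq> x \<or> \<not> stacked h x y d j" for j z
    using that unfolding pushed_apply by auto
  show ?thesis
  proof
    let ?p = "pushed h x y d"
    fix i j :: "int \<times> int" and z w w' :: int
    show "finite R" "R \<subseteq> triangles" by (fact finite_region region_triangles)+
    show "i \<in> starts R \<and> fst i \<le> z" if p: "?p i z = Some w"
    proof -
      have "?p i z \<noteq> None" using p by simp
      then obtain v where "h i z = Some v" unfolding pushed_None by blast
      then show ?thesis by (rule label)
    qed
    show "?p i (fst i) = Some (snd i)" if i: "i \<in> starts R"
    proof -
      have "fst i \<noteq> x \<or> \<not> stacked h x y d i"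
      proof (rule ccontr)
        assume "\<not> ?thesis"
        then have "fst i = x" and "stacked h x y d i" by blast+
        then obtain v where "h i (x - 1) = Some v" using left by blast
        from label[OF this] show False using \<open>fst i = x\<close> by simp
      qed
      then show ?thesis using old start[OF i] by simp
    qed
    show "?p i z \<noteq> None" if "fst i \<le> z" "?p i (z + 1) \<noteq> None"
      using that defined_back unfolding pushed_None by blast
    show "\<bar>w' - w\<bar> = 1" if p: "?p i z = Some w" "?p i (z + 1) = Some w'"
    proof -
      consider "z = x" "stacked h x y d i" | "z + 1 = x" "stacked h x y d i"
        | "z \<noteq> x \<or> \<not> stacked h x y d i" "z + 1 \<noteq> x \<or> \<not> stacked h x y d i" by blast
      then show ?thesis
      proof cases
        case 1
        then have eq: "?p i (z + 1) = h i (x + 1)" "?p i z = ?p i x" using old[of "z + 1" i] by simp_all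
        obtain l where "?p i x = Some (y + 2 * d * (int l + 1))" "h i (x + 1) = Some (y + d + 2 * d * int l)"
          using st[OF 1(2)] by blast
        then have "w = y + 2 * d * (int l + 1)" "w' = y + d + 2 * d * int l" using p eq by simp_all
        then have "w' - w = - d" by (simp add: algebra_simps)
        then show ?thesis using d by auto
      next
        case 2
        then have "z = x - 1" by simp
        then have eq: "?p i z = h i (x - 1)" "?p i (z + 1) = ?p i x" using old[of z i] by simp_all
        obtain l where "?p i x = Some (y + 2 * d * (int l + 1))" "h i (x - 1) = Some (y + d + 2 * d * int l)"
          using st[OF 2(2)] by blast
        then have "w' = y + 2 * d * (int l + 1)" "w = y + d + 2 * d * int l" using p eq by simp_all
        then have "w' - w = d" by (simp add: algebra_simps)
        then show ?thesis using d by auto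
      next
        case 3
        then show ?thesis using old p step by simp
      qed
    qed
    \<comment> \<open>A moved path lands either on the free point beyond the stack or on a point
      whose path belongs to the stack and moves as well.\<close>
    have mixed: False
      if m: "stacked h x y d i" "\<not> stacked h x y d j" "?p i x = Some w" "h j x = Some w" for i j
    proof -
      obtain l where l: "l \<le> k" "?p i x = Some (y + 2 * d * (int l + 1))" using st[OF m(1)] by blast
      then have w: "w = y + 2 * d * (int l + 1)" using m(3) by simp
      show False
      proof (cases "l = k")
        case True
        then show ?thesis using blocking_free[of d j x y] d m(4) w unfolding k_def by auto
      next
        case False
        then have "Suc l \<le> k" using l by simp
        moreover have "h j x = Some (y + 2 * d * int (Suc l))" using m(4) w by (simp add: add.commute)
        ultimately show ?thesis using m(2) unfolding stacked_def k_def by blast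
      qed
    qed
    show "i = j" if p: "?p i z = Some w" "?p j z = Some w"
    proof (cases "z = x")
      case False
      then show ?thesis using old p disjoint by simp
    next
      case True
      consider "stacked h x y d i" "stacked h x y d j" | "stacked h x y d i" "\<not> stacked h x y d j"
        | "\<not> stacked h x y d i" "stacked h x y d j" | "\<not> stacked h x y d i" "\<not> stacked h x y d j" by blast
      then show ?thesis
      proof cases
        case 1
        have "\<exists>v. h j' x = Some v \<and> w = v + 2 * d" if "stacked h x y d j'" "?p j' x = Some w" for j'
          using st[OF that(1)] that(2) by (auto simp: algebra_simps)
        from this[OF 1(1)] this[OF 1(2)] p True obtain v v' where
          "h i x = Some v" "w = v + 2 * d" "h j x = Some v'" "w = v' + 2 * d" by blast
        then show ?thesis using disjoint by simp
      next
        case 2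
        then show ?thesis using mixed[OF 2] p True old[of x j] by simp
      next
        case 3
        then show ?thesis using mixed[OF 3(2,1)] p True old[of x i] by simp
      next
        case 4
        then show ?thesis using old p disjoint by simp
      qed
    qed
    show "Rt z w \<in> R \<and> Lt (z + 1) w' \<in> R" if p: "?p i z = Some w" "?p i (z + 1) = Some w'"
    proof -
      consider "z = x" "stacked h x y d i" | "z + 1 = x" "stacked h x y d i"
        | "z \<noteq> x \<or> \<not> stacked h x y d i" "z + 1 \<noteq> x \<or> \<not> stacked h x y d i" by blast
      then show ?thesis
      proof cases
        case 1
        then have n: "h i (x + 1) = Some w'" using old[of "z + 1" i] p by simp
        obtain l where l: "h i x = Some (y + 2 * d * int l)" "w = y + 2 * d * (int l + 1)" "Rt x w \<in> R"
          using st[OF 1(2)] p 1(1) by auto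
        then show ?thesis using inside[OF l(1) n] 1(1) by simp
      next
        case 2
        then have z: "z = x - 1" by simp
        then have n: "h i z = Some w" using old[of z i] p by simp
        obtain l where l: "h i (z + 1) = Some (y + 2 * d * int l)" "Lt x w' \<in> R"
          using st[OF 2(2)] p 2(1) by auto
        then show ?thesis using inside[OF n l(1)] 2(1) by simp
      next
        case 3
        then show ?thesis using old p inside by simp
      qed
    qed
    show "(z, w) \<in> ends R" if p: "?p i z = Some w" "?p i (z + 1) = None"
    proof -
      have n: "h i (z + 1) = None" using p(2) pushed_None by blast
      then have "z \<noteq> x \<or> \<not> stacked h x y d i" using right by blast
      then have "h i z = Some w" using old p(1) by simp
      then show ?thesis using finish n by blast
    qed
    show "\<exists>i. ?p i z = Some w" if e: "(z, w) \<in> ends R"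
    proof -
      obtain i where i: "h i z = Some w" using ends_hit e by blast
      have "Rt z w \<notin> R" using e by (simp add: ends_def)
      then have "h i (z + 1) = None" using right_inside[OF i] by blast
      then have "z \<noteq> x \<or> \<not> stacked h x y d i" using right by blast
      then show ?thesis using old i by metis
    qed
  qed
qed

end

section \<open>Pushes inside a component\<close>

context component
begin

text \<open>A push cannot carry a path across a hole triangle: by parity, a change of 2 that
  switches sides would have the path at the height of the triangle before or after the push, and a
  path crossing that column at this height would use the missing triangle.\<close>

lemma pushed_state:
  assumes h: "h \<in> \<Omega>" and d: "d = 1 \<or> d = - 1" and y: "h i x = Some y"
    and p: "path_system R (pushed h x y d)"
  shows "pushed h x y d \<in> \<Omega>"
proof (rule statesI[OF p])
  interpret h: path_system R h using path_system[OF h] .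
  interpret p: path_system R "pushed h x y d" by (fact p)
  have side: "(\<exists>z. pushed h x y d j X = Some z \<and> z < Y) \<longleftrightarrow> (\<exists>z. h j X = Some z \<and> z < Y)"
    if e: "even (X + Y)" and av: "h j X \<noteq> Some Y" "pushed h x y d j X \<noteq> Some Y" for j X Y
  proof (cases "X = x \<and> stacked h x y d j")
    case True
    then obtain z where z: "h j X = Some z" unfolding stacked_def by blast
    have pz: "pushed h x y d j X = Some (z + 2 * d)" unfolding pushed_apply using True z by simp
    have "even (X + z)" using h.point_even z by blast
    then have "even ((X + Y) - (X + z))" using e by (intro dvd_diff)
    then have "even (Y - z)" by simp
    then obtain n where n: "Y - z = 2 * n" by (rule evenE)
    have "z \<noteq> Y" "z + 2 * d \<noteq> Y" using av z pz by auto
    then have "n \<noteq> 0" "n \<noteq> d" using n by auto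
    then have "z + 2 * d < Y \<longleftrightarrow> z < Y" using n d by (elim disjE) linarith+
    then show ?thesis using z pz by simp
  next
    case False
    then show ?thesis unfolding pushed_apply by auto
  qed
  fix t assume t: "t \<in> hole_triangles R"
  then have tR: "t \<in> triangles" "t \<notin> R" unfolding hole_triangles_def by blast+
  have "passing_under (pushed h x y d) t = passing_under h t"
  proof (cases t)
    case (Rt X Y)
    then have e: "even (X + Y)" and R: "Rt X Y \<notin> R" using tR by simp_all
    have "(pushed h x y d j (X + 1) \<noteq> None \<and> (\<exists>z. pushed h x y d j X = Some z \<and> z < Y)) \<longleftrightarrow>
      (h j (X + 1) \<noteq> None \<and> (\<exists>z. h j X = Some z \<and> z < Y))" for j
    proof (cases "h j (X + 1) = None")
      case True
      then show ?thesis by (simp add: pushed_None)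
    next
      case False
      then have "pushed h x y d j (X + 1) \<noteq> None" by (simp add: pushed_None)
      then show ?thesis
        using side[OF e, of j] False R h.right_inside[of j X Y] p.right_inside[of j X Y] by blast
    qed
    then show ?thesis unfolding Rt passing_under.simps by blast
  next
    case (Lt X Y)
    then have e: "even (X + Y)" and R: "Lt X Y \<notin> R" using tR by simp_all
    have "(pushed h x y d j (X - 1) \<noteq> None \<and> (\<exists>z. pushed h x y d j X = Some z \<and> z < Y)) \<longleftrightarrow>
      (h j (X - 1) \<noteq> None \<and> (\<exists>z. h j X = Some z \<and> z < Y))" for j
    proof (cases "h j (X - 1) = None")
      case True
      then show ?thesis by (simp add: pushed_None)
    next
      case False
      then have "pushed h x y d j (X - 1) \<noteq> None" by (simp add: pushed_None)
      then show ?thesis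
        using side[OF e, of j] False R h.left_inside[of j X Y] p.left_inside[of j X Y] by blast
    qed
    then show ?thesis unfolding Lt passing_under.simps by blast
  qed
  then show "passing_under (pushed h x y d) t = S t" using passing[OF h t] by simp
qed

lemma pushed_routing_state:
  assumes "h \<in> \<Omega>" "d = 1 \<or> d = - 1" "h i x = Some y" "pushed h x y d \<in> routings R"
  shows "pushed h x y d \<in> \<Omega>"
  using assms pushed_state routings_iff[OF finite_region region_triangles] by blast

lemma order_transfer:
  assumes "b \<in> \<Omega>" "a \<in> \<Omega>" "d = 1 \<or> d = - 1" "b j x = Some v" "b j' x = Some v'"
    and "a j x = Some w" "a j' x = Some w'" "d * v < d * v'"
  shows "d * w < d * w'"
  using assms(3,8) order_eq[OF assms(1,2) assms(4,5,6,7)] order_eq[OF assms(1,2) assms(5,4,7,6)]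
  by (elim disjE) simp_all

text \<open>If one stacked path of \<open>b\<close> has the same height in \<open>a\<close>, the
  stacked paths behind it are squeezed: in \<open>a\<close> they are at least as far as in
  \<open>b\<close>, and the path ahead of them leaves no room.\<close>

lemma stack_pinned:
  assumes b: "b \<in> \<Omega>" and a: "a \<in> \<Omega>" and d: "d = 1 \<or> d = - 1" and o: "ord d b a"
    and i: "b i x = Some y" and l: "l \<le> blocking b x y d"
    and j: "b j x = Some (y + 2 * d * int l)" "a j x = Some (y + 2 * d * int l)"
    and "l' \<le> l" "b j' x = Some (y + 2 * d * int l')"
  shows "a j' x = Some (y + 2 * d * int l')"
proof -
  interpret b: path_system R b using path_system[OF b] .
  have "\<forall>j'. b j' x = Some (y + 2 * d * int l') \<longrightarrow> a j' x = Some (y + 2 * d * int l')"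
    using assms(9)
  proof (induction rule: inc_induct)
    case base
    then show ?case using j b.disjoint by blast
  next
    case (step n)
    show ?case
    proof (intro allI impI)
      fix j1 assume j1: "b j1 x = Some (y + 2 * d * int n)"
      obtain j2 where j2: "b j2 x = Some (y + 2 * d * int (Suc n))"
        using b.occupied[OF i, of "Suc n" d] step.hyps l by auto
      then have a2: "a j2 x = Some (y + 2 * d * int (Suc n))" using step.IH by blast
      obtain w where w: "a j1 x = Some w" using defined_transfer[OF b a j1] .
      have "d * (y + 2 * d * int n) < d * (y + 2 * d * int (Suc n))" using d by auto
      then have lt: "d * w < d * (y + 2 * d * int (Suc n))" using order_transfer[OF b a d j1 j2 w a2] by simp
      have "w = y + 2 * d * int n"
      proof (rule ccontr)
        assume "w \<noteq> y + 2 * d * int n"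
        from parity_gap[OF d even_difference[OF b a j1 w] ordD[OF o j1 w] this]
        show False using lt d by auto
      qed
      then show "a j1 x = Some (y + 2 * d * int n)" using w by simp
    qed
  qed
  then show ?thesis using assms(10) by blast
qed

lemma stack_bottom_pinned:
  assumes "b \<in> \<Omega>" "a \<in> \<Omega>" "d = 1 \<or> d = - 1" "ord d b a" "b i x = Some y"
    and "stacked b x y d j" "a j x = b j x"
  shows "a i x = Some y"
proof -
  obtain l where l: "l \<le> blocking b x y d" "b j x = Some (y + 2 * d * int l)"
    using assms(6) unfolding stacked_def by blast
  show ?thesis
    using stack_pinned[OF assms(1-5) l, of 0 i] assms(5,7) l(2) by simp
qed

text \<open>The opposite squeeze: the base of the stack of \<open>a\<close> is at the same place in
  \<open>b\<close>, and in \<open>b\<close> no path is further than in \<open>a\<close>, so the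
  paths of this stack cannot be elsewhere in \<open>b\<close>.\<close>

lemma stack_below:
  assumes b: "b \<in> \<Omega>" and a: "a \<in> \<Omega>" and d: "d = 1 \<or> d = - 1" and o: "ord d b a"
    and i: "b i x = Some y" "a i x = Some y" and "l \<le> blocking a x y d"
    and "a j x = Some (y + 2 * d * int l)"
  shows "b j x = Some (y + 2 * d * int l)"
  using assms(7,8)
proof (induction l arbitrary: j)
  case 0
  interpret a: path_system R a using path_system[OF a] .
  have "j = i" using 0 i a.disjoint by simp
  then show ?case using i by simp
next
  case (Suc l)
  interpret a: path_system R a using path_system[OF a] .
  obtain j0 where j0: "a j0 x = Some (y + 2 * d * int l)"
    using a.occupied[OF i(2), of l d] Suc.prems by auto
  then have b0: "b j0 x = Some (y + 2 * d * int l)" using Suc by simp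
  obtain v where v: "b j x = Some v" using defined_transfer[OF a b Suc.prems(2)] .
  have "d * (y + 2 * d * int l) < d * (y + 2 * d * int (Suc l))" using d by auto
  then have lt: "d * (y + 2 * d * int l) < d * v"
    using order_transfer[OF a b d j0 Suc.prems(2) b0 v] by simp
  have "v = y + 2 * d * int (Suc l)"
  proof (rule ccontr)
    assume "v \<noteq> y + 2 * d * int (Suc l)"
    then have "y + 2 * d * int (Suc l) \<noteq> v" by simp
    from parity_gap[OF d even_difference[OF b a v Suc.prems(2)] ordD[OF o v Suc.prems(2)] this]
    show False using lt d by auto
  qed
  then show ?case using v by simp
qed

text \<open>Hence the state that is ahead has the larger acceptance probability
  \<open>1 / (k + 1)\<close>: whenever the shared \<open>u\<close> lets \<open>b\<close> move, it
  lets \<open>a\<close> move.\<close>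

lemma blocking_antimono:
  assumes "b \<in> \<Omega>" "a \<in> \<Omega>" "d = 1 \<or> d = - 1" "ord d b a" "b i x = Some y" "a i x = Some y"
  shows "blocking a x y d \<le> blocking b x y d"
proof -
  interpret b: path_system R b using path_system[OF assms(1)] .
  interpret a: path_system R a using path_system[OF assms(2)] .
  show ?thesis
  proof (rule b.le_blocking)
    fix l assume "l < blocking a x y d"
    then have l: "Suc l \<le> blocking a x y d" by simp
    obtain j where "a j x = Some (y + 2 * d * int (Suc l))" using a.occupied[OF assms(6) l] by blast
    from stack_below[OF assms l this] have "b j x = Some (y + 2 * d * (int l + 1))"
      by (simp add: add.commute)
    then show "\<exists>j. b j x = Some (y + 2 * d * (int l + 1))" by blast
  qed (use assms(3) in auto)
qed

lemma pinned_extremum: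
  assumes b: "b \<in> \<Omega>" and a: "a \<in> \<Omega>" and d: "d = 1 \<or> d = - 1" and o: "ord d b a"
    and "extremum b i x y d" "a i x = Some y"
  shows "extremum a i x y d"
proof -
  interpret a: path_system R a using path_system[OF a] .
  have e: "b i (x - 1) = Some (y + d)" "b i (x + 1) = Some (y + d)"
    using assms(5) unfolding extremum_def by blast+
  have "a i c = Some (y + d)" if c: "c = x - 1 \<or> c = x + 1" and bc: "b i c = Some (y + d)" for c
  proof -
    obtain w where w: "a i c = Some w" using defined_transfer[OF b a bc] .
    have "\<bar>w - y\<bar> = 1" using a.step_at[OF c assms(6) w] .
    moreover have "d * (y + d) \<le> d * w" using ordD[OF o bc w] .
    ultimately have "w = y + d" using d by (elim disjE) auto
    then show ?thesis using w by simp
  qed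
  then show ?thesis using e assms(6) unfolding extremum_def by blast
qed

text \<open>Makes the border harmless in \<open>push_mono\<close>: if the push is valid in
  \<open>b\<close>, then the push of \<open>a\<close> is a join of two states and therefore valid by
  \<open>join_state\<close>.\<close>

lemma pushed_eq_join:
  assumes b: "b \<in> \<Omega>" and a: "a \<in> \<Omega>" and d: "d = 1 \<or> d = - 1" and o: "ord d b a"
    and i: "b i x = Some y" "a i x = Some y"
  shows "pushed a x y d = join d a (pushed b x y d)"
proof (intro ext)
  interpret a: path_system R a using path_system[OF a] .
  interpret b: path_system R b using path_system[OF b] .
  fix j z
  show "pushed a x y d j z = join d a (pushed b x y d) j z"
  proof (cases "a j z")
    case None
    then show ?thesis using pushed_None by (simp add: join_def)
  next
    case (Some w)
    obtain v where v: "b j z = Some v" using defined_transfer[OF a b Some] .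
    have le: "d * v \<le> d * w" using ordD[OF o v Some] .
    have ev: "even (w - v)" using even_difference[OF b a v Some] .
    have inj: "d * p = d * q \<longleftrightarrow> p = q" for p q using d by auto
    consider "z = x" "stacked a x y d j" | "z = x" "\<not> stacked a x y d j" "stacked b x y d j"
      | "z \<noteq> x \<or> \<not> stacked a x y d j" "z \<noteq> x \<or> \<not> stacked b x y d j" by blast
    then show ?thesis
    proof cases
      case 1
      then obtain l where l: "l \<le> blocking a x y d" "a j x = Some (y + 2 * d * int l)"
        unfolding stacked_def by blast
      have bj: "b j x = Some (y + 2 * d * int l)" using stack_below[OF b a d o i l] .
      moreover have "l \<le> blocking b x y d" using l(1) blocking_antimono[OF b a d o i] by simp
      ultimately have "stacked b x y d j" unfolding stacked_def by blast
      then have "pushed b x y d j z = Some (w + 2 * d)" "pushed a x y d j z = Some (w + 2 * d)"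
        unfolding pushed_apply using 1 l(2) bj Some by simp_all
      moreover have "d * w \<le> d * (w + 2 * d)" using d by auto
      ultimately show ?thesis using Some by (simp add: join_def)
    next
      case 2
      \<comment> \<open>If the path had not advanced between \<open>b\<close> and \<open>a\<close>,
        all stacked paths behind it would be pinned too, and it would belong to the stack of
        \<open>a\<close>.\<close>
      have "w \<noteq> v"
      proof
        assume "w = v"
        obtain l where l: "l \<le> blocking b x y d" "b j x = Some (y + 2 * d * int l)"
          using 2(3) unfolding stacked_def by blast
        then have aj: "a j x = Some (y + 2 * d * int l)" using \<open>w = v\<close> v Some 2(1) by simp
        have "l \<le> blocking a x y d"
        proof (rule a.le_blocking)
          fix l' assume "l' < l"
          then obtain j' where "b j' x = Some (y + 2 * d * int (Suc l'))"
            using b.occupied[OF i(1), of "Suc l'" d] l(1) by auto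
          from stack_pinned[OF b a d o i(1) l aj _ this] \<open>l' < l\<close>
          have "a j' x = Some (y + 2 * d * (int l' + 1))" by (simp add: add.commute)
          then show "\<exists>j. a j x = Some (y + 2 * d * (int l' + 1))" by blast
        qed (use d in auto)
        then show False using 2(2) aj unfolding stacked_def by blast
      qed
      then have "d * v + 2 \<le> d * w" by (rule parity_gap[OF d ev le])
      then have "d * (v + 2 * d) \<le> d * w" using d by auto
      moreover have "pushed b x y d j z = Some (v + 2 * d)" "pushed a x y d j z = Some w"
        unfolding pushed_apply using 2 v Some by simp_all
      ultimately show ?thesis using Some inj[of w "v + 2 * d"] by (auto simp: join_def)
    next
      case 3
      then have "pushed b x y d j z = Some v" "pushed a x y d j z = Some w"
        unfolding pushed_apply using v Some by auto
      then show ?thesis using Some le inj[of w v] by (auto simp: join_def)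
    qed
  qed
qed

text \<open>A push that is impossible for the border stays impossible after moving all paths towards it.\<close>

lemma blocked_pinned:
  assumes b: "b \<in> \<Omega>" and a: "a \<in> \<Omega>" and d: "d = 1 \<or> d = - 1" and o: "ord d b a"
    and ext: "extremum b i x y d" and blocked: "pushed b x y d \<notin> routings R"
  shows "a i x = Some y"
proof -
  interpret a: path_system R a using path_system[OF a] .
  interpret b: path_system R b using path_system[OF b] .
  have i: "b i x = Some y" using ext unfolding extremum_def by blast
  define z where "z = y + 2 * d * (int (blocking b x y d) + 1)"
  consider j where "stacked b x y d j" "b j (x - 1) = None" | j where "stacked b x y d j" "b j (x + 1) = None"
    | "Rt x z \<notin> R \<or> Lt x z \<notin> R"
    using b.path_system_pushed[OF d ext] blocked routings_iff[OF finite_region region_triangles]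
    unfolding z_def by blast
  then show ?thesis
  proof cases
    case (1 j)
    then obtain v where v: "b j x = Some v" unfolding stacked_def by blast
    then have "a j x = b j x" using first_eq[OF b a v 1(2)] by simp
    then show ?thesis using stack_bottom_pinned[OF b a d o i 1(1)] by simp
  next
    case (2 j)
    then obtain v where v: "b j x = Some v" unfolding stacked_def by blast
    then have "a j x = b j x" using last_eq[OF b a v 2(2)] by simp
    then show ?thesis using stack_bottom_pinned[OF b a d o i 2(1)] by simp
  next
    case 3
    have free: "b j x \<noteq> Some z" for j using b.blocking_free[of d j x y] d unfolding z_def by auto
    \<comment> \<open>With only one triangle missing, \<open>z\<close> would be a start or an end
      and thus on a path. With both missing, no state has a path at \<open>z\<close>, and by
      \<open>below_eq\<close> no path changes sides of \<open>z\<close> between two states.\<close>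
    then have out: "Rt x z \<notin> R" "Lt x z \<notin> R" using 3 b.Rt_point b.Lt_point by blast+
    obtain j where j: "b j x = Some (y + 2 * d * int (blocking b x y d))"
      using b.occupied[OF i, of "blocking b x y d" d] by blast
    then have st: "stacked b x y d j" unfolding stacked_def by blast
    define v where "v = y + 2 * d * int (blocking b x y d)"
    have v: "b j x = Some v" "z = v + 2 * d" using j unfolding v_def z_def by (simp_all add: algebra_simps)
    obtain w where w: "a j x = Some w" using defined_transfer[OF b a v(1)] .
    have "even (x + v)" using b.point_even v by blast
    then have "even (x + z)" unfolding v(2) by simp
    then have B: "below b x z = below a x z" using below_eq[OF b a] out by blast
    have "j \<in> below b x z \<longleftrightarrow> j \<in> below a x z" using B by simp
    then have side: "v < z \<longleftrightarrow> w < z" using v(1) w unfolding below_def by simp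
    have "w \<noteq> z" using a.point_in_region[OF w] out by blast
    have "w = v"
    proof (rule ccontr)
      assume "w \<noteq> v"
      from parity_gap[OF d even_difference[OF b a v(1) w] ordD[OF o v(1) w] this]
      show False using side \<open>w \<noteq> z\<close> v(2) d by (elim disjE) auto
    qed
    then show ?thesis using stack_bottom_pinned[OF b a d o i st] v(1) w by simp
  qed
qed

lemma ord_pushed:
  assumes "h \<in> \<Omega>" "d = 1 \<or> d = - 1"
  shows "ord d h (pushed h x y d)"
  unfolding ord_def pushed_apply using assms(2) by auto

text \<open>If the push were possible in \<open>a\<close>, its result would still be ahead of
  \<open>b\<close>, so \<open>blocked_pinned\<close> would keep path \<open>i\<close> at height
  \<open>y\<close> although the push has moved it.\<close>

lemma blocked_above:
  assumes b: "b \<in> \<Omega>" and a: "a \<in> \<Omega>" and d: "d = 1 \<or> d = - 1" and o: "ord d b a"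
    and ext: "extremum b i x y d" and blocked: "pushed b x y d \<notin> routings R"
  shows "extremum a i x y d" "pushed a x y d \<notin> routings R"
proof -
  have ai: "a i x = Some y" using blocked_pinned[OF assms] .
  show "extremum a i x y d" using pinned_extremum[OF b a d o ext ai] .
  show "pushed a x y d \<notin> routings R"
  proof
    assume "pushed a x y d \<in> routings R"
    then have p: "pushed a x y d \<in> \<Omega>" using pushed_routing_state[OF a d ai] by simp
    have "ord d b (pushed a x y d)" using ord_trans[OF o ord_pushed[OF a d] b a] .
    from blocked_pinned[OF b p d this ext blocked]
    have "pushed a x y d i x = Some y" .
    moreover have "stacked a x y d i" unfolding stacked_def using ai by (intro exI[of _ 0]) simp
    ultimately show False unfolding pushed_apply using ai d by auto
  qed
qed

lemma push_cases:
  obtains (stay) "push R d i x u h = h"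
  | (move) y where "extremum h i x y d" "pushed h x y d \<in> routings R"
      "u \<le> 1 / (real (blocking h x y d) + 1)" "push R d i x u h = pushed h x y d"
proof (cases "h i x")
  case None
  then show thesis using stay by (simp add: push_def)
next
  case (Some y)
  show thesis
  proof (cases "extremum h i x y d \<and> pushed h x y d \<in> routings R \<and> u \<le> 1 / (real (blocking h x y d) + 1)")
    case True
    then show thesis using move[of y] Some by (simp add: push_def)
  next
    case False
    then have "push R d i x u h = h" unfolding push_def Some by auto
    then show thesis by (rule stay)
  qed
qed

lemma push_state:
  assumes "h \<in> \<Omega>" "d = 1 \<or> d = - 1"
  shows "push R d i x u h \<in> \<Omega>"
proof (cases rule: push_cases[of d i x u h])
  case (move y)
  then have "h i x = Some y" unfolding extremum_def by blast
  from pushed_routing_state[OF assms this move(2)] show ?thesis unfolding move(4) .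
qed (use assms in simp)

lemma ord_push: "h \<in> \<Omega> \<Longrightarrow> d = 1 \<or> d = - 1 \<Longrightarrow> ord d h (push R d i x u h)"
  by (cases rule: push_cases[of d i x u h]) (simp_all add: ord_refl ord_pushed)

text \<open>The critical case is that \<open>b\<close> moves. If path \<open>i\<close> has the same
  height in \<open>a\<close>, then \<open>a\<close> moves too. Otherwise
  \<open>stack_bottom_pinned\<close> shows that every stacked path of \<open>b\<close> is strictly
  behind its position in \<open>a\<close>, and by parity it has room to move without
  overtaking.\<close>

lemma push_mono:
  assumes b: "b \<in> \<Omega>" and a: "a \<in> \<Omega>" and d: "d = 1 \<or> d = - 1" and o: "ord d b a"
  shows "ord d (push R d i x u b) (push R d i x u a)"
proof (cases rule: push_cases[of d i x u b])
  case stay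
  then show ?thesis using ord_trans[OF o ord_push[OF a d] b a] by simp
next
  case (move y)
  have i: "b i x = Some y" using move(1) unfolding extremum_def by blast
  have pb: "pushed b x y d \<in> \<Omega>" using pushed_routing_state[OF b d i move(2)] .
  show ?thesis
  proof (cases "a i x = Some y")
    case True
    have eq: "pushed a x y d = join d a (pushed b x y d)" using pushed_eq_join[OF b a d o i True] .
    have "pushed a x y d \<in> \<Omega>" unfolding eq using join_state[OF a pb d] .
    then have "pushed a x y d \<in> routings R" unfolding states_def by blast
    moreover have "extremum a i x y d" using pinned_extremum[OF b a d o move(1) True] .
    moreover have "u \<le> 1 / (real (blocking a x y d) + 1)"
    proof -
      have "blocking a x y d \<le> blocking b x y d" using blocking_antimono[OF b a d o i True] .
      then have "1 / (real (blocking b x y d) + 1) \<le> 1 / (real (blocking a x y d) + 1)"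
        by (intro divide_left_mono) auto
      then show ?thesis using move(3) by linarith
    qed
    ultimately have "push R d i x u a = pushed a x y d" using True unfolding push_def by simp
    then show ?thesis unfolding move(4) eq using ord_join(2) by simp
  next
    case False
    have "ord d (pushed b x y d) a"
      unfolding ord_def
    proof (intro allI impI)
      fix j z v w assume p: "pushed b x y d j z = Some v" and w: "a j z = Some w"
      show "d * v \<le> d * w"
      proof (cases "z = x \<and> stacked b x y d j")
        case True
        then obtain v0 where v0: "b j z = Some v0" unfolding stacked_def by blast
        have v: "v = v0 + 2 * d" using p v0 True unfolding pushed_apply by simp
        have "w \<noteq> v0" using stack_bottom_pinned[OF b a d o i, of j] False True v0 w by auto
        from parity_gap[OF d even_difference[OF b a v0 w] ordD[OF o v0 w] this]
        show ?thesis using v d by auto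
      next
        case False
        then have "b j z = Some v" using p unfolding pushed_apply by auto
        then show ?thesis using ordD[OF o _ w] by blast
      qed
    qed
    then show ?thesis unfolding move(4) using ord_trans[OF _ ord_push[OF a d] pb a] by simp
  qed
qed

lemma update_state: "h \<in> \<Omega> \<Longrightarrow> update R c h \<in> \<Omega>"
  using push_state by (cases c) (auto simp: update_eq simp del: update.simps)

lemma update_mono:
  assumes "b \<in> \<Omega>" "a \<in> \<Omega>" "ord 1 b a"
  shows "ord 1 (update R c b) (update R c a)"
proof -
  obtain i x up u where c: "c = ((i, x), up, u)" by (metis surj_pair)
  show ?thesis
  proof (cases up)
    case True
    then show ?thesis unfolding c update_eq using push_mono[OF assms(1,2) _ assms(3)] by simp
  next
    case False
    have "ord (- 1) a b" using assms(3) ord_minus by blast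
    then have "ord (- 1) (push R (- 1) i x u a) (push R (- 1) i x u b)"
      using push_mono[OF assms(2,1)] by simp
    then show ?thesis unfolding c update_eq ord_minus using False by simp
  qed
qed

end

section \<open>Drift of the weighted distance\<close>

definition gap :: "routing \<Rightarrow> routing \<Rightarrow> int \<times> int \<Rightarrow> int \<Rightarrow> real" where
  "gap a b i x = real_of_int (the (a i x) - the (b i x)) / 2"

definition active :: "tri set \<Rightarrow> int \<Rightarrow> routing \<Rightarrow> int \<times> int \<Rightarrow> int \<Rightarrow> bool" where
  "active R d h i x \<longleftrightarrow> extremum h i x (the (h i x)) d \<and> pushed h x (the (h i x)) d \<in> routings R"

definition blockers :: "int \<Rightarrow> routing \<Rightarrow> int \<times> int \<Rightarrow> int \<Rightarrow> nat" where
  "blockers d h i x = blocking h x (the (h i x)) d"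

text \<open>Twice the expected net number of points moved up when the site \<open>(i, x)\<close> is
  chosen: \<open>k + 1\<close> points move with probability \<open>1 / (k + 1)\<close>, so the
  number of blockers cancels.\<close>

definition net_moves :: "tri set \<Rightarrow> routing \<Rightarrow> int \<times> int \<Rightarrow> int \<Rightarrow> real" where
  "net_moves R h i x = of_bool (active R 1 h i x) - of_bool (active R (- 1) h i x)"

lemma push_active:
  "push R d i x u h =
     (if active R d h i x \<and> u \<le> 1 / (real (blockers d h i x) + 1) then pushed h x (the (h i x)) d else h)"
  unfolding push_def active_def blockers_def
  by (cases "h i x") (simp_all add: extremum_def)

context component
begin

abbreviation "P \<equiv> sites R S"

text \<open>Points off the sites have the same height in all states (\<open>gap_zero\<close>), so a
  difference of weights misses nothing. Writing the potential as such a difference lets the two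
  copies be updated separately.\<close>

definition weight :: "(int \<Rightarrow> real) \<Rightarrow> routing \<Rightarrow> real" where
  "weight g a = (\<Sum>(i, x)\<in>P. g x * real_of_int (the (a i x)) / 2)"

definition potential :: "(int \<Rightarrow> real) \<Rightarrow> routing \<Rightarrow> routing \<Rightarrow> real" where
  "potential g a b = (\<Sum>(i, x)\<in>P. g x * gap a b i x)"

lemma potential_eq: "potential g a b = weight g a - weight g b"
  unfolding potential_def weight_def sum_subtractf[symmetric]
  by (intro sum.cong) (auto simp: gap_def field_simps)

lemma sites_iff:
  assumes "h \<in> \<Omega>"
  shows "(i, x) \<in> P \<longleftrightarrow> h i (x - 1) \<noteq> None \<and> h i x \<noteq> None \<and> h i (x + 1) \<noteq> None"
  using dom_eq[OF assms conjunct1[OF top_state]] unfolding sites_def by (simp add: dom_def)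

lemma finite_points:
  assumes "h \<in> \<Omega>"
  shows "finite {(i, x). h i x \<noteq> None}"
proof -
  interpret h: path_system R h using path_system[OF assms] .
  interpret path_system_pair R h h by unfold_locales
  obtain M where M: "0 < M" "\<And>x y. Rt x y \<in> R \<or> Lt x y \<in> R \<Longrightarrow> \<bar>x\<bar> < M \<and> \<bar>y\<bar> < M"
    using region_box by blast
  have "{(i, x). h i x \<noteq> None} \<subseteq> starts R \<times> {- M..M}"
  proof (rule subsetI, elim CollectE case_prodE conjE)
    fix q i x assume q: "q = (i, x)" and "h i x \<noteq> None"
    then obtain y where y: "h i x = Some y" by blast
    have "\<bar>x\<bar> < M" using M(2)[OF h.point_in_region[OF y]] by blast
    then show "q \<in> starts R \<times> {- M..M}" using h.label[OF y] q by auto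
  qed
  then show ?thesis using finite_starts[OF finite_region] finite_subset by blast
qed

lemma finite_sites: "finite P"
proof (rule finite_subset)
  show "P \<subseteq> {(i, x). highest i x \<noteq> None}" using sites_iff top_state by auto
qed (use finite_points top_state in blast)

lemma movable:
  assumes "a \<in> \<Omega>" "b \<in> \<Omega>" "a i x = Some v" "b i x \<noteq> Some v"
  shows "(i, x) \<in> P"
  using assms first_eq[OF assms(1-3)] last_eq[OF assms(1-3)] sites_iff[OF assms(1), of i x] by auto

lemma gap_zero:
  assumes "a \<in> \<Omega>" "b \<in> \<Omega>" "(i, x) \<notin> P"
  shows "gap a b i x = 0"
proof (cases "a i x")
  case None
  then have "b i x = None" using dom_eq[OF assms(1,2), of i x] by simp
  then show ?thesis using None by (simp add: gap_def)
next
  case (Some v)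
  then have "b i x = Some v" using movable[OF assms(1,2)] assms(3) by blast
  then show ?thesis using Some by (simp add: gap_def)
qed

lemma gap_nat:
  assumes "a \<in> \<Omega>" "b \<in> \<Omega>" "ord 1 b a"
  shows "\<exists>n::nat. gap a b i x = real n"
proof (cases "a i x")
  case None
  then have "b i x = None" using dom_eq[OF assms(1,2), of i x] by simp
  then show ?thesis using None by (intro exI[of _ 0]) (simp add: gap_def)
next
  case (Some v)
  obtain w where w: "b i x = Some w" using defined_transfer[OF assms(1,2) Some] .
  have "even (v - w)" using even_difference[OF assms(2,1) w Some] .
  then obtain n where n: "v - w = 2 * n" by (rule evenE)
  moreover have "w \<le> v" using ordD[OF assms(3) w Some] by simp
  ultimately have "0 \<le> n" by simp
  moreover have "gap a b i x = real_of_int n" using Some w n by (simp add: gap_def)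
  ultimately show ?thesis by (intro exI[of _ "nat n"]) simp
qed

lemma gap_nonneg: "a \<in> \<Omega> \<Longrightarrow> b \<in> \<Omega> \<Longrightarrow> ord 1 b a \<Longrightarrow> 0 \<le> gap a b i x"
  using gap_nat[of a b i x] by auto

lemma gap_mono:
  assumes "a \<in> \<Omega>" "a' \<in> \<Omega>" "b \<in> \<Omega>" "b' \<in> \<Omega>" "ord 1 a a'" "ord 1 b' b"
  shows "gap a b i x \<le> gap a' b' i x"
proof (cases "a i x")
  case None
  then have "a' i x = None" "b i x = None" "b' i x = None"
    using dom_eq[OF assms(1,2), of i x] dom_eq[OF assms(1,3), of i x] dom_eq[OF assms(1,4), of i x] by simp_all
  then show ?thesis using None by (simp add: gap_def)
next
  case (Some v)
  obtain v' w w' where s: "a' i x = Some v'" "b i x = Some w" "b' i x = Some w'"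
    using defined_transfer[OF assms(1,2) Some] defined_transfer[OF assms(1,3) Some]
      defined_transfer[OF assms(1,4) Some] by metis
  have "v \<le> v'" "w' \<le> w" using ordD[OF assms(5) Some s(1)] ordD[OF assms(6) s(3,2)] by simp_all
  then show ?thesis using Some s by (simp add: gap_def)
qed

lemma gap_positive:
  assumes "a \<in> \<Omega>" "b \<in> \<Omega>" "ord 1 b a" "a \<noteq> b"
  shows "\<exists>i x. (i, x) \<in> P \<and> 1 \<le> gap a b i x"
proof -
  obtain i x where ne: "a i x \<noteq> b i x" using assms(4) by (metis ext)
  then obtain v where v: "a i x = Some v" using dom_eq[OF assms(1,2), of i x] by (cases "a i x") auto
  then obtain w where w: "b i x = Some w" using defined_transfer[OF assms(1,2)] by blast
  obtain n where n: "gap a b i x = real n" using gap_nat[OF assms(1-3)] by blast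
  have "gap a b i x \<noteq> 0" using ne v w by (simp add: gap_def)
  then have "1 \<le> gap a b i x" using n by simp
  moreover have "(i, x) \<in> P" using movable[OF assms(1,2) v] ne v by simp
  ultimately show ?thesis by blast
qed

lemma card_stacked:
  assumes h: "h \<in> \<Omega>" and d: "d = 1 \<or> d = - 1" and y: "h i x = Some y"
  shows "card {j. stacked h x y d j} = blocking h x y d + 1"
proof -
  interpret h: path_system R h using path_system[OF h] .
  let ?J = "{j. stacked h x y d j}" and ?k = "blocking h x y d"
  have "inj_on (\<lambda>j. the (h j x)) ?J"
  proof (rule inj_onI)
    fix j j' assume "j \<in> ?J" "j' \<in> ?J" and eq: "the (h j x) = the (h j' x)"
    then obtain v v' where v: "h j x = Some v" "h j' x = Some v'" unfolding stacked_def by blast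
    then have "v = v'" using eq by simp
    then show "j = j'" using v h.disjoint by blast
  qed
  moreover have "(\<lambda>j. the (h j x)) ` ?J = (\<lambda>l. y + 2 * d * int l) ` {..?k}"
  proof (intro equalityI subsetI)
    fix z assume "z \<in> (\<lambda>j. the (h j x)) ` ?J"
    then show "z \<in> (\<lambda>l. y + 2 * d * int l) ` {..?k}" unfolding stacked_def by force
  next
    fix z assume "z \<in> (\<lambda>l. y + 2 * d * int l) ` {..?k}"
    then obtain l where l: "l \<le> ?k" "z = y + 2 * d * int l" by blast
    obtain j where j: "h j x = Some (y + 2 * d * int l)" using h.occupied[OF y l(1)] by blast
    then have "j \<in> ?J" using l(1) unfolding stacked_def by blast
    then show "z \<in> (\<lambda>j. the (h j x)) ` ?J" using j l(2) by (metis image_eqI option.sel)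
  qed
  moreover have "inj_on (\<lambda>l. y + 2 * d * int l) {..?k}" using d by (auto simp: inj_on_def)
  ultimately show ?thesis by (metis card_atMost card_image Suc_eq_plus1)
qed

lemma weight_pushed:
  assumes h: "h \<in> \<Omega>" and d: "d = 1 \<or> d = - 1" and y: "h i x = Some y"
    and p: "pushed h x y d \<in> routings R"
  shows "weight g (pushed h x y d) = weight g h + d * (real (blocking h x y d) + 1) * g x"
proof -
  let ?J = "{j. stacked h x y d j}"
  have pO: "pushed h x y d \<in> \<Omega>" using pushed_routing_state[OF h d y p] .
  have sub: "(\<lambda>j. (j, x)) ` ?J \<subseteq> P"
  proof clarify
    fix a b assume s: "stacked h x y d (a, b)"
    then obtain v where v: "h (a, b) x = Some v" unfolding stacked_def by blast
    have "pushed h x y d (a, b) x \<noteq> Some v" unfolding pushed_apply using s v d by auto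
    then show "((a, b), x) \<in> P" using movable[OF h pO v] by blast
  qed
  have "weight g (pushed h x y d) - weight g h = potential g (pushed h x y d) h"
    by (simp add: potential_eq)
  also have "\<dots> = (\<Sum>(j, z)\<in>(\<lambda>j. (j, x)) ` ?J. g z * gap (pushed h x y d) h j z)"
    unfolding potential_def
  proof (rule sum.mono_neutral_right[OF finite_sites sub])
    have "pushed h x y d j z = h j z" if "(j, z) \<notin> (\<lambda>j. (j, x)) ` ?J" for j z
      using that unfolding pushed_apply by auto
    then show "\<forall>q\<in>P - (\<lambda>j. (j, x)) ` ?J. (case q of (j, z) \<Rightarrow> g z * gap (pushed h x y d) h j z) = 0"
      unfolding gap_def by (auto simp del: pushed_apply)
  qed
  also have "\<dots> = (\<Sum>j\<in>?J. g x * gap (pushed h x y d) h j x)"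
    by (subst sum.reindex) (auto simp: inj_on_def)
  also have "\<dots> = (\<Sum>j\<in>?J. g x * d)"
  proof (rule sum.cong)
    fix j assume "j \<in> ?J"
    then have s: "stacked h x y d j" by simp
    then obtain v where v: "h j x = Some v" unfolding stacked_def by blast
    show "g x * gap (pushed h x y d) h j x = g x * d"
      unfolding gap_def pushed_apply using s v by simp
  qed simp
  also have "\<dots> = d * (real (blocking h x y d) + 1) * g x"
    using card_stacked[OF h d y] by simp
  finally show ?thesis by simp
qed

lemma weight_push:
  assumes h: "h \<in> \<Omega>" and d: "d = 1 \<or> d = - 1"
  shows "weight g (push R d i x u h) = weight g h +
    (if active R d h i x \<and> u \<le> 1 / (real (blockers d h i x) + 1)
     then d * (real (blockers d h i x) + 1) * g x else 0)"
proof (cases "active R d h i x")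
  case True
  then have "h i x = Some (the (h i x))" "pushed h x (the (h i x)) d \<in> routings R"
    unfolding active_def extremum_def by blast+
  from weight_pushed[OF h d this] show ?thesis unfolding push_active blockers_def by simp
next
  case False
  then show ?thesis by (simp add: push_active)
qed

text \<open>The second difference of the heights is 2 at a valley, -2 at a peak and 0 on a
  slope.\<close>

lemma extremum_laplacian:
  assumes "h \<in> \<Omega>" "(i, x) \<in> P"
  shows "of_bool (extremum h i x (the (h i x)) 1) - of_bool (extremum h i x (the (h i x)) (- 1)) =
    real_of_int (the (h i (x - 1)) + the (h i (x + 1)) - 2 * the (h i x)) / 2"
proof -
  interpret h: path_system R h using path_system[OF assms(1)] .
  obtain u v w where uvw: "h i (x - 1) = Some u" "h i x = Some v" "h i (x + 1) = Some w"
    using assms sites_iff by blast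
  have "\<bar>u - v\<bar> = 1" "\<bar>w - v\<bar> = 1"
    using h.step_at[OF disjI1[OF refl] uvw(2,1)] h.step_at[OF disjI2[OF refl] uvw(2,3)] .
  then have "u = v + 1 \<or> u = v - 1" "w = v + 1 \<or> w = v - 1" by linarith+
  then show ?thesis using uvw unfolding extremum_def by (elim disjE) simp_all
qed

text \<open>The expected motion of a free path is the discrete Laplacian of its heights; the border
  only slows down the upper one of two ordered states when moving up, and the lower one when
  moving down.\<close>

lemma net_moves_le:
  assumes b: "b \<in> \<Omega>" and a: "a \<in> \<Omega>" and o: "ord 1 b a" and P: "(i, x) \<in> P"
  shows "net_moves R a i x - net_moves R b i x \<le>
    gap a b i (x - 1) + gap a b i (x + 1) - 2 * gap a b i x"
proof -
  define blocked where "blocked h d \<longleftrightarrow> extremum h i x (the (h i x)) d \<and> pushed h x (the (h i x)) d \<notin> routings R"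
    for h d
  have act: "of_bool (active R d h i x) = (of_bool (extremum h i x (the (h i x)) d) - of_bool (blocked h d) :: real)" for h d
    unfolding active_def blocked_def by auto
  have transfer: "blocked a' d" if "b' \<in> \<Omega>" "a' \<in> \<Omega>" "d = 1 \<or> d = - 1" "ord d b' a'" "blocked b' d" for a' b' d
  proof -
    have e: "extremum b' i x (the (b' i x)) d" "pushed b' x (the (b' i x)) d \<notin> routings R"
      using that(5) unfolding blocked_def by blast+
    have *: "extremum a' i x (the (b' i x)) d" "pushed a' x (the (b' i x)) d \<notin> routings R"
      using blocked_above[OF that(1-4) e] .
    then have "the (a' i x) = the (b' i x)" unfolding extremum_def by simp
    then show ?thesis using * unfolding blocked_def by simp
  qed
  have "ord (- 1) a b" using o ord_minus by blast
  then have "blocked b 1 \<longrightarrow> blocked a 1" "blocked a (- 1) \<longrightarrow> blocked b (- 1)"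
    using transfer[OF b a _ o] transfer[OF a b] by blast+
  then have "net_moves R a i x - net_moves R b i x \<le>
    (of_bool (extremum a i x (the (a i x)) 1) - of_bool (extremum a i x (the (a i x)) (- 1))) -
    (of_bool (extremum b i x (the (b i x)) 1) - of_bool (extremum b i x (the (b i x)) (- 1)))"
    unfolding net_moves_def act by auto
  also have "\<dots> = gap a b i (x - 1) + gap a b i (x + 1) - 2 * gap a b i x"
    unfolding extremum_laplacian[OF a P] extremum_laplacian[OF b P] gap_def by (simp add: field_simps)
  finally show ?thesis .
qed

text \<open>After the substitution, terms off the sites vanish with the gap, and the terms that the
  shift does not reach are nonnegative.\<close>

lemma sum_shifted_gap:
  assumes b: "b \<in> \<Omega>" and a: "a \<in> \<Omega>" and o: "ord 1 b a" and g: "\<And>x. 0 \<le> g x"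
  shows "(\<Sum>(i, x)\<in>P. g x * gap a b i (x + c)) \<le> (\<Sum>(i, x)\<in>P. g (x - c) * gap a b i x)"
proof -
  let ?Q = "(\<lambda>(i, x). (i, x + c)) ` P"
  have "(\<Sum>(i, x)\<in>P. g x * gap a b i (x + c)) = (\<Sum>(i, x)\<in>?Q. g (x - c) * gap a b i x)"
    by (subst sum.reindex) (auto simp: inj_on_def split_def)
  also have "\<dots> = (\<Sum>(i, x)\<in>?Q \<inter> P. g (x - c) * gap a b i x)"
  proof (rule sum.mono_neutral_right)
    have "gap a b i x = 0" if "(i, x) \<notin> P" for i x using gap_zero[OF a b that] .
    then show "\<forall>q\<in>?Q - ?Q \<inter> P. (case q of (i, x) \<Rightarrow> g (x - c) * gap a b i x) = 0"
      by (metis (mono_tags, lifting) DiffE IntI case_prod_beta mult_zero_right prod.collapse)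
  qed (use finite_sites in auto)
  also have "\<dots> \<le> (\<Sum>(i, x)\<in>P. g (x - c) * gap a b i x)"
    by (rule sum_mono2) (use finite_sites g gap_nonneg[OF a b o] in auto)
  finally show ?thesis .
qed

text \<open>Summation by parts moves the discrete Laplacian from the gaps to the weights. Where the
  gap is zero nothing is required of \<open>g\<close>, which lets a weight be supported on the
  columns that can move.\<close>

lemma drift:
  assumes b: "b \<in> \<Omega>" and a: "a \<in> \<Omega>" and o: "ord 1 b a" and g: "\<And>x. 0 \<le> g x"
    and super: "\<And>i x. (i, x) \<in> P \<Longrightarrow> 0 < gap a b i x \<Longrightarrow> (g (x - 1) + g (x + 1)) / 2 \<le> (1 - r) * g x"
  shows "(\<Sum>(i, x)\<in>P. g x * (net_moves R a i x - net_moves R b i x)) \<le> - 2 * r * potential g a b"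
proof -
  have "(\<Sum>(i, x)\<in>P. g x * (net_moves R a i x - net_moves R b i x)) \<le>
    (\<Sum>(i, x)\<in>P. g x * (gap a b i (x + - 1) + gap a b i (x + 1) - 2 * gap a b i x))"
    by (rule sum_mono) (use net_moves_le[OF b a o] g in \<open>auto intro!: mult_left_mono\<close>)
  also have "\<dots> = (\<Sum>(i, x)\<in>P. g x * gap a b i (x + - 1)) + (\<Sum>(i, x)\<in>P. g x * gap a b i (x + 1))
      - (\<Sum>(i, x)\<in>P. 2 * (g x * gap a b i x))"
    unfolding sum.distrib[symmetric] sum_subtractf[symmetric]
    by (rule sum.cong) (auto simp: algebra_simps)
  also have "\<dots> \<le> (\<Sum>(i, x)\<in>P. g (x - - 1) * gap a b i x) + (\<Sum>(i, x)\<in>P. g (x - 1) * gap a b i x)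
      - (\<Sum>(i, x)\<in>P. 2 * (g x * gap a b i x))"
    by (intro diff_right_mono add_mono sum_shifted_gap[OF b a o g])
  also have "\<dots> = (\<Sum>(i, x)\<in>P. (g (x - 1) + g (x + 1) - 2 * g x) * gap a b i x)"
    unfolding sum.distrib[symmetric] sum_subtractf[symmetric]
    by (rule sum.cong) (auto simp: algebra_simps)
  also have "\<dots> \<le> (\<Sum>(i, x)\<in>P. (- 2 * r * g x) * gap a b i x)"
  proof (rule sum_mono, clarify)
    fix p q x assume P: "((p, q), x) \<in> P"
    show "(g (x - 1) + g (x + 1) - 2 * g x) * gap a b (p, q) x \<le> - 2 * r * g x * gap a b (p, q) x"
    proof (cases "gap a b (p, q) x = 0")
      case False
      then have "0 < gap a b (p, q) x" using gap_nonneg[OF a b o, of "(p, q)" x] by simp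
      then have "g (x - 1) + g (x + 1) - 2 * g x \<le> - 2 * r * g x"
        using super[OF P] by (simp add: left_diff_distrib)
      then show ?thesis by (rule mult_right_mono) (use \<open>0 < gap a b (p, q) x\<close> in simp)
    qed simp
  qed
  also have "\<dots> = - 2 * r * potential g a b"
    unfolding potential_def sum_distrib_left by (rule sum.cong) (auto simp: algebra_simps)
  finally show ?thesis .
qed

end

section \<open>Contraction in expectation\<close>

abbreviation unit_uniform :: "real measure" where
  "unit_uniform \<equiv> uniform_measure lborel {0..1}"

lemma prob_space_unit_uniform: "prob_space unit_uniform"
  by (rule prob_space_uniform_measure) auto

lemma measure_unit_uniform:
  assumes "0 \<le> s" "s \<le> 1"
  shows "measure unit_uniform {..s} = s"
proof -
  have "{0..1} \<inter> {..s} = {0..s}" using assms by auto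
  then have "emeasure unit_uniform {..s} = ennreal s" using assms by (simp add: divide_ennreal_def)
  then show ?thesis using assms by (simp add: measure_def)
qed

text \<open>The two thresholds are the acceptance probabilities of the upper and the lower copy,
  which may differ although both copies use the same \<open>u\<close>.\<close>

lemma nn_integral_threshold:
  fixes c \<alpha> \<beta> s t :: real
  assumes "0 \<le> s" "s \<le> 1" "0 \<le> t" "t \<le> 1"
    and nonneg: "\<And>u. 0 \<le> c + \<alpha> * indicator {..s} u + \<beta> * indicator {..t} u"
  shows "0 \<le> c + \<alpha> * s + \<beta> * t"
    and "(\<integral>\<^sup>+u. ennreal (c + \<alpha> * indicator {..s} u + \<beta> * indicator {..t} u) \<partial>unit_uniform) =
      ennreal (c + \<alpha> * s + \<beta> * t)"
proof -
  interpret prob_space unit_uniform by (rule prob_space_unit_uniform)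
  let ?f = "\<lambda>u. c + \<alpha> * indicator {..s} u + \<beta> * indicator {..t} u"
  have ind: "integrable unit_uniform (indicator {..v} :: real \<Rightarrow> real)" for v
    using emeasure_finite[of "{..v}"]
    by (intro integrable_real_indicator) (auto simp: less_top[symmetric] simp del: emeasure_uniform_measure)
  have int: "integrable unit_uniform ?f" using ind by simp
  have "integral\<^sup>L unit_uniform ?f = c + \<alpha> * s + \<beta> * t"
    using ind measure_unit_uniform assms prob_space by simp
  moreover have "0 \<le> integral\<^sup>L unit_uniform ?f" by (rule Bochner_Integration.integral_nonneg) (rule nonneg)
  ultimately show "0 \<le> c + \<alpha> * s + \<beta> * t" and "(\<integral>\<^sup>+u. ennreal (?f u) \<partial>unit_uniform) = ennreal (c + \<alpha> * s + \<beta> * t)"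
    using nn_integral_eq_integral[OF int] nonneg by auto
qed

text \<open>The recursion of \<open>chain\<close> peels off the last choice; conditioning on the
  first one needs the chain restarted after it.\<close>

lemma chain_case_nat: "chain R (case_nat c \<omega>) h (Suc n) = chain R \<omega> (update R c h) n"
  by (induction n) (simp_all del: update.simps)

context component
begin

lemma prob_space_choice_law: "prob_space (choice_law R S)"
proof -
  interpret U: prob_space unit_uniform by (rule prob_space_unit_uniform)
  interpret B: pair_prob_space "measure_pmf (bernoulli_pmf (1 / 2))" unit_uniform ..
  interpret C: pair_prob_space "measure_pmf (pmf_of_set P)" "measure_pmf (bernoulli_pmf (1 / 2)) \<Otimes>\<^sub>M unit_uniform" ..
  show ?thesis unfolding choice_law_def by (rule C.prob_space_axioms)
qed

lemma sets_choice_law: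
  "sets (choice_law R S) = sets (count_space UNIV \<Otimes>\<^sub>M (count_space UNIV \<Otimes>\<^sub>M borel))"
  unfolding choice_law_def by (intro sets_pair_measure_cong) auto

lemma update_measurable:
  assumes "h \<in> \<Omega>"
  shows "(\<lambda>c. update R c h) \<in> choice_law R S \<rightarrow>\<^sub>M count_space \<Omega>"
proof -
  have push: "(\<lambda>u. push R d i x u h) \<in> borel \<rightarrow>\<^sub>M count_space \<Omega>" if d: "d = 1 \<or> d = - 1" for d i x
  proof (cases "active R d h i x")
    case True
    then have "h i x = Some (the (h i x))" "pushed h x (the (h i x)) d \<in> routings R"
      unfolding active_def extremum_def by blast+
    then have "pushed h x (the (h i x)) d \<in> \<Omega>" using pushed_routing_state[OF assms d] by blast
    then show ?thesis unfolding push_active using True assms by (intro measurable_If) auto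
  next
    case False
    then show ?thesis unfolding push_active using assms by simp
  qed
  have "(\<lambda>c. update R c h) \<in> count_space UNIV \<Otimes>\<^sub>M (count_space UNIV \<Otimes>\<^sub>M borel) \<rightarrow>\<^sub>M count_space \<Omega>"
  proof (intro measurable_pair_measure_countable1)
    fix s :: "(int \<times> int) \<times> int" and up :: bool
    obtain i x where "s = (i, x)" by (cases s)
    then show "(\<lambda>u. update R (s, up, u) h) \<in> borel \<rightarrow>\<^sub>M count_space \<Omega>"
      using push by (simp add: update_eq del: update.simps)
  qed auto
  then show ?thesis using measurable_cong_sets[OF sets_choice_law refl] by blast
qed

lemma potential_update_measurable:
  assumes "a \<in> \<Omega>" "b \<in> \<Omega>"
  shows "(\<lambda>c. ennreal (potential g (update R c a) (update R c b))) \<in> borel_measurable (choice_law R S)"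
proof -
  have "(\<lambda>c. weight g (update R c h)) \<in> borel_measurable (choice_law R S)" if "h \<in> \<Omega>" for h
    using update_measurable[OF that] by (rule measurable_compose) simp
  then show ?thesis unfolding potential_eq using assms by measurable
qed

lemma nn_integral_choice_law:
  assumes "P \<noteq> {}" "F \<in> borel_measurable (choice_law R S)"
  shows "(\<integral>\<^sup>+c. F c \<partial>choice_law R S) =
    (\<Sum>s\<in>P. (\<integral>\<^sup>+u. F (s, True, u) \<partial>unit_uniform) * ennreal (1 / 2) +
      (\<integral>\<^sup>+u. F (s, False, u) \<partial>unit_uniform) * ennreal (1 / 2)) / of_nat (card P)"
proof -
  interpret U: prob_space unit_uniform by (rule prob_space_unit_uniform)
  interpret B: pair_prob_space "measure_pmf (bernoulli_pmf (1 / 2))" unit_uniform ..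
  have F: "F \<in> borel_measurable (measure_pmf (pmf_of_set P) \<Otimes>\<^sub>M (measure_pmf (bernoulli_pmf (1 / 2)) \<Otimes>\<^sub>M unit_uniform))"
    using assms(2) unfolding choice_law_def .
  have F2: "(\<lambda>q. F (s, q)) \<in> borel_measurable (measure_pmf (bernoulli_pmf (1 / 2)) \<Otimes>\<^sub>M unit_uniform)" for s
    using F by (rule measurable_Pair2) simp
  have "(\<integral>\<^sup>+c. F c \<partial>choice_law R S) =
      (\<integral>\<^sup>+s. \<integral>\<^sup>+q. F (s, q) \<partial>(measure_pmf (bernoulli_pmf (1 / 2)) \<Otimes>\<^sub>M unit_uniform) \<partial>measure_pmf (pmf_of_set P))"
    unfolding choice_law_def using B.nn_integral_fst[OF F] by simp
  also have "\<dots> = (\<integral>\<^sup>+s. \<integral>\<^sup>+up. \<integral>\<^sup>+u. F (s, up, u) \<partial>unit_uniform \<partial>measure_pmf (bernoulli_pmf (1 / 2)) \<partial>measure_pmf (pmf_of_set P))"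
    using U.nn_integral_fst[OF F2] by simp
  also have "\<dots> = (\<Sum>s\<in>P. (\<integral>\<^sup>+u. F (s, True, u) \<partial>unit_uniform) * ennreal (1 / 2) +
      (\<integral>\<^sup>+u. F (s, False, u) \<partial>unit_uniform) * ennreal (1 / 2)) / of_nat (card P)"
    using assms(1) finite_sites by (simp add: nn_integral_pmf_of_set ennreal_of_nat_eq_real_of_nat)
  finally show ?thesis .
qed

lemma potential_nonneg:
  assumes "b \<in> \<Omega>" "a \<in> \<Omega>" "ord 1 b a" "\<And>x. 0 \<le> g x"
  shows "0 \<le> potential g a b"
  unfolding potential_def using assms gap_nonneg[OF assms(2,1,3)]
  by (intro sum_nonneg) (auto intro!: mult_nonneg_nonneg)

lemma nn_integral_push:
  fixes i :: "int \<times> int" and x :: int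
  assumes b: "b \<in> \<Omega>" and a: "a \<in> \<Omega>" and o: "ord 1 b a" and g: "\<And>x. 0 \<le> g x"
    and d: "d = (if up then 1 else - 1)"
  defines "V \<equiv> potential g a b + d * g x * (of_bool (active R d a i x) - of_bool (active R d b i x))"
  shows "0 \<le> V" "(\<integral>\<^sup>+u. ennreal (potential g (update R ((i, x), up, u) a) (update R ((i, x), up, u) b)) \<partial>unit_uniform) = ennreal V"
proof -
  define s where "s h = 1 / (real (blockers d h i x) + 1)" for h
  define \<gamma> where "\<gamma> h = (if active R d h i x then d * (real (blockers d h i x) + 1) * g x else 0)" for h
  have d': "d = 1 \<or> d = - 1" using d by simp
  have s: "0 \<le> s h" "s h \<le> 1" for h unfolding s_def by (auto simp: field_simps)
  have gs: "\<gamma> h * s h = d * g x * of_bool (active R d h i x)" for h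
    unfolding \<gamma>_def s_def by (simp add: field_simps)
  have w: "weight g (update R ((i, x), up, u) h) = weight g h + \<gamma> h * indicator {..s h} u" if "h \<in> \<Omega>" for h u
    unfolding update_eq d[symmetric] weight_push[OF that d'] \<gamma>_def s_def by (simp add: indicator_def)
  have eq: "potential g (update R ((i, x), up, u) a) (update R ((i, x), up, u) b) =
      potential g a b + \<gamma> a * indicator {..s a} u + (- \<gamma> b) * indicator {..s b} u" for u
    unfolding potential_eq w[OF a] w[OF b] by simp
  have nn: "0 \<le> potential g a b + \<gamma> a * indicator {..s a} u + (- \<gamma> b) * indicator {..s b} u" for u
    unfolding eq[symmetric]
    by (rule potential_nonneg[OF update_state[OF b] update_state[OF a] update_mono[OF b a o] g])
  have V: "V = potential g a b + \<gamma> a * s a + (- \<gamma> b) * s b"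
    unfolding V_def using gs[of a] gs[of b] by (simp add: algebra_simps)
  show "0 \<le> V" unfolding V by (rule nn_integral_threshold(1)[OF s s nn])
  show "(\<integral>\<^sup>+u. ennreal (potential g (update R ((i, x), up, u) a) (update R ((i, x), up, u) b)) \<partial>unit_uniform) = ennreal V"
    unfolding V eq by (rule nn_integral_threshold(2)[OF s s nn])
qed

text \<open>For a fixed site the two directions average to the potential plus \<open>g x / 2\<close>
  times the difference of the \<open>net_moves\<close>; averaging over all sites turns
  \<open>drift\<close> into the factor \<open>1 - r / card P\<close>. The values \<open>V\<close>
  are shown nonnegative because the integrals are taken in \<open>ennreal\<close>.\<close>

lemma expected_potential_step:
  assumes b: "b \<in> \<Omega>" and a: "a \<in> \<Omega>" and o: "ord 1 b a" and g: "\<And>x. 0 \<le> g x" and "P \<noteq> {}"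
    and super: "\<And>i x. (i, x) \<in> P \<Longrightarrow> 0 < gap a b i x \<Longrightarrow> (g (x - 1) + g (x + 1)) / 2 \<le> (1 - r) * g x"
  shows "(\<integral>\<^sup>+c. ennreal (potential g (update R c a) (update R c b)) \<partial>choice_law R S) \<le>
    ennreal ((1 - r / card P) * potential g a b)"
proof -
  define V where "V d = (\<lambda>(i, x). potential g a b + d * g x *
    (of_bool (active R d a i x) - of_bool (active R d b i x)))" for d :: int
  have V: "0 \<le> V (if up then 1 else - 1) s"
    "(\<integral>\<^sup>+u. ennreal (potential g (update R (s, up, u) a) (update R (s, up, u) b)) \<partial>unit_uniform) =
      ennreal (V (if up then 1 else - 1) s)" for up s
  proof -
    obtain i x where s: "s = (i, x)" by (cases s)
    show "0 \<le> V (if up then 1 else - 1) s"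
      unfolding V_def s case_prod_conv by (rule nn_integral_push(1)[OF b a o g refl])
    show "(\<integral>\<^sup>+u. ennreal (potential g (update R (s, up, u) a) (update R (s, up, u) b)) \<partial>unit_uniform) =
      ennreal (V (if up then 1 else - 1) s)"
      unfolding V_def s case_prod_conv by (rule nn_integral_push(2)[OF b a o g refl])
  qed
  have "(\<integral>\<^sup>+c. ennreal (potential g (update R c a) (update R c b)) \<partial>choice_law R S) =
    (\<Sum>s\<in>P. ennreal (V 1 s) * ennreal (1 / 2) + ennreal (V (- 1) s) * ennreal (1 / 2)) / of_nat (card P)"
    using nn_integral_choice_law[OF assms(5) potential_update_measurable[OF a b]]
      V(2)[of _ True] V(2)[of _ False] by (simp del: update.simps)
  also have "\<dots> = (\<Sum>s\<in>P. ennreal ((V 1 s + V (- 1) s) / 2)) / of_nat (card P)"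
  proof -
    have half: "ennreal p * ennreal (1 / 2) + ennreal q * ennreal (1 / 2) = ennreal ((p + q) / 2)"
      if "0 \<le> p" "0 \<le> q" for p q :: real
    proof -
      have "ennreal p * ennreal (1 / 2) + ennreal q * ennreal (1 / 2) = ennreal (p * (1 / 2)) + ennreal (q * (1 / 2))"
        using that by (simp only: ennreal_mult[symmetric] zero_le_divide_1_iff zero_le_numeral)
      also have "\<dots> = ennreal (p * (1 / 2) + q * (1 / 2))"
        using that by (intro ennreal_plus[symmetric]) simp_all
      finally show ?thesis by (simp add: add_divide_distrib)
    qed
    show ?thesis
      using half V(1)[of True] V(1)[of False] by simp
  qed
  also have "\<dots> = ennreal ((\<Sum>s\<in>P. (V 1 s + V (- 1) s) / 2) / card P)"
    using V(1)[of True] V(1)[of False] assms(5) finite_sites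
    by (subst sum_ennreal) (auto simp: ennreal_of_nat_eq_real_of_nat divide_ennreal sum_nonneg card_gt_0_iff)
  also have "(\<Sum>s\<in>P. (V 1 s + V (- 1) s) / 2) = card P * potential g a b +
      (\<Sum>(i, x)\<in>P. g x * (net_moves R a i x - net_moves R b i x)) / 2"
  proof -
    have "(\<Sum>s\<in>P. (V 1 s + V (- 1) s) / 2) =
      (\<Sum>s\<in>P. potential g a b + (case s of (i, x) \<Rightarrow> g x * (net_moves R a i x - net_moves R b i x)) / 2)"
      by (intro sum.cong) (auto simp: V_def net_moves_def field_simps)
    then show ?thesis by (simp add: sum.distrib sum_divide_distrib)
  qed
  also have "\<dots> / card P \<le> (1 - r / card P) * potential g a b"
  proof -
    have "0 < card P" using assms(5) finite_sites by (simp add: card_gt_0_iff)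
    moreover have "(\<Sum>(i, x)\<in>P. g x * (net_moves R a i x - net_moves R b i x)) \<le> - 2 * r * potential g a b"
      by (rule drift[OF b a o g]) (use super in blast)
    moreover have "(p * v + D / 2) / p \<le> (1 - r / p) * v" if "0 < p" "D \<le> - 2 * r * v" for p v D :: real
    proof -
      have "(p * v + D / 2) / p = v + D / (2 * p)" using that(1) by (simp add: field_simps)
      also have "\<dots> \<le> v + (- 2 * r * v) / (2 * p)"
        using that by (intro add_left_mono divide_right_mono) auto
      also have "\<dots> = (1 - r / p) * v" using that(1) by (simp add: field_simps)
      finally show ?thesis .
    qed
    ultimately show ?thesis by simp
  qed
  finally show ?thesis by (simp add: ennreal_leI)
qed

section \<open>The chain driven by independent choices\<close>

sublocale choice_sequence: sequence_space "choice_law R S"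
proof -
  interpret prob_space "choice_law R S" by (rule prob_space_choice_law)
  show "sequence_space (choice_law R S)" ..
qed

lemma choices_eq: "choices R S = choice_sequence.S"
  unfolding choices_def ..

lemma chain_state: "h \<in> \<Omega> \<Longrightarrow> chain R \<omega> h n \<in> \<Omega>"
  by (induction n) (simp_all add: update_state del: update.simps)

lemma chain_mono: "b \<in> \<Omega> \<Longrightarrow> a \<in> \<Omega> \<Longrightarrow> ord 1 b a \<Longrightarrow> ord 1 (chain R \<omega> b n) (chain R \<omega> a n)"
  by (induction n) (simp_all add: update_mono chain_state del: update.simps)

lemma chain_measurable:
  assumes "h \<in> \<Omega>"
  shows "(\<lambda>\<omega>. chain R \<omega> h n) \<in> choices R S \<rightarrow>\<^sub>M count_space \<Omega>"
proof (induction n)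
  case 0
  then show ?case using assms by simp
next
  case (Suc n)
  have "(\<lambda>\<omega>. \<omega> n) \<in> choices R S \<rightarrow>\<^sub>M choice_law R S"
    unfolding choices_def by (rule measurable_component_singleton) simp
  from measurable_compose[OF this update_measurable]
  have "(\<lambda>\<omega>. update R (\<omega> n) k) \<in> choices R S \<rightarrow>\<^sub>M count_space \<Omega>" if "k \<in> \<Omega>" for k
    using that .
  from measurable_compose_countable'[OF this Suc countable_finite[OF finite_states]]
  show ?case by (simp del: update.simps)
qed

lemma potential_chain_measurable:
  assumes "a \<in> \<Omega>" "b \<in> \<Omega>"
  shows "(\<lambda>\<omega>. ennreal (potential g (chain R \<omega> a n) (chain R \<omega> b n))) \<in> borel_measurable (choices R S)"
proof -
  have "(\<lambda>\<omega>. weight g (chain R \<omega> h n)) \<in> borel_measurable (choices R S)" if "h \<in> \<Omega>" for h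
    using chain_measurable[OF that] by (rule measurable_compose) simp
  then show ?thesis unfolding potential_eq using assms by measurable
qed

text \<open>Induction by conditioning on the first choice. The condition on \<open>g\<close> refers
  to the extreme states because the gaps of any ordered pair are at most theirs, so it holds along
  the whole run; \<open>r \<le> 1\<close> keeps the factor nonnegative.\<close>

lemma expected_potential:
  assumes "b \<in> \<Omega>" "a \<in> \<Omega>" "ord 1 b a" and g: "\<And>x. 0 \<le> g x" and "P \<noteq> {}" and r: "r \<le> 1"
    and super: "\<And>i x. (i, x) \<in> P \<Longrightarrow> 0 < gap highest lowest i x \<Longrightarrow>
      (g (x - 1) + g (x + 1)) / 2 \<le> (1 - r) * g x"
  shows "(\<integral>\<^sup>+\<omega>. ennreal (potential g (chain R \<omega> a n) (chain R \<omega> b n)) \<partial>choices R S) \<le>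
    ennreal ((1 - r / card P) ^ n * potential g a b)"
  using assms(1-3)
proof (induction n arbitrary: a b)
  case 0
  interpret C: prob_space "choices R S"
    unfolding choices_eq by (rule choice_sequence.prob_space_axioms)
  show ?case by (simp add: C.emeasure_space_1)
next
  case (Suc n)
  let ?q = "1 - r / card P"
  have "1 \<le> card P" using assms(5) finite_sites by (simp add: Suc_leI card_gt_0_iff)
  then have q: "0 \<le> ?q" using r by (simp add: field_simps)
  let ?F = "\<lambda>\<omega>. ennreal (potential g (chain R \<omega> a (Suc n)) (chain R \<omega> b (Suc n)))"
  have F: "?F \<in> borel_measurable choice_sequence.S"
    using potential_chain_measurable[OF Suc.prems(2,1)] unfolding choices_eq .
  interpret C: prob_space choice_sequence.S by (rule choice_sequence.prob_space_axioms)
  have "(\<integral>\<^sup>+\<omega>. ?F \<omega> \<partial>choices R S) =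
      (\<integral>\<^sup>+\<omega>. ?F \<omega> \<partial>distr (choice_law R S \<Otimes>\<^sub>M choice_sequence.S) choice_sequence.S (\<lambda>(s, \<omega>). case_nat s \<omega>))"
    unfolding choices_eq choice_sequence.PiM_iter ..
  also have "\<dots> = (\<integral>\<^sup>+z. ?F ((\<lambda>(s, \<omega>). case_nat s \<omega>) z) \<partial>(choice_law R S \<Otimes>\<^sub>M choice_sequence.S))"
    using F by (intro nn_integral_distr) auto
  also have "\<dots> = (\<integral>\<^sup>+c. \<integral>\<^sup>+\<omega>. ?F (case_nat c \<omega>) \<partial>choice_sequence.S \<partial>choice_law R S)"
    using F by (subst choice_sequence.nn_integral_fst[symmetric]) auto
  also have "\<dots> \<le> (\<integral>\<^sup>+c. ennreal (?q ^ n) * ennreal (potential g (update R c a) (update R c b)) \<partial>choice_law R S)"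
  proof (rule nn_integral_mono)
    fix c
    have "(\<integral>\<^sup>+\<omega>. ?F (case_nat c \<omega>) \<partial>choice_sequence.S) =
      (\<integral>\<^sup>+\<omega>. ennreal (potential g (chain R \<omega> (update R c a) n) (chain R \<omega> (update R c b) n)) \<partial>choices R S)"
      unfolding chain_case_nat choices_eq ..
    also have "\<dots> \<le> ennreal (?q ^ n * potential g (update R c a) (update R c b))"
      using Suc.prems by (intro Suc.IH update_state update_mono)
    also have "\<dots> = ennreal (?q ^ n) * ennreal (potential g (update R c a) (update R c b))"
      using q by (intro ennreal_mult') auto
    finally show "(\<integral>\<^sup>+\<omega>. ?F (case_nat c \<omega>) \<partial>choice_sequence.S) \<le> \<dots>" .
  qed
  also have "\<dots> = ennreal (?q ^ n) * (\<integral>\<^sup>+c. ennreal (potential g (update R c a) (update R c b)) \<partial>choice_law R S)"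
    by (rule nn_integral_cmult[OF potential_update_measurable[OF Suc.prems(2,1)]])
  also have "\<dots> \<le> ennreal (?q ^ n) * ennreal (?q * potential g a b)"
  proof (intro mult_left_mono expected_potential_step[OF Suc.prems g assms(5)] super)
    fix i x assume "0 < gap a b i x"
    moreover have "gap a b i x \<le> gap highest lowest i x"
      using gap_mono Suc.prems top_state bottom_state by blast
    ultimately show "0 < gap highest lowest i x" by linarith
  qed auto
  also have "\<dots> = ennreal (?q ^ Suc n * potential g a b)"
    using q by (subst ennreal_mult'[symmetric]) (simp_all add: mult_ac)
  finally show ?case .
qed

lemma num_moves_eq: "num_moves R S = (\<Sum>(i, x)\<in>P. gap highest lowest i x)"
proof -
  have top: "highest \<in> \<Omega>" and bot: "lowest \<in> \<Omega>" using top_state bottom_state by blast+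
  have dom: "finite (dom (highest i))" for i
  proof (rule finite_subset)
    show "dom (highest i) \<subseteq> snd ` {(i, x). highest i x \<noteq> None}"
    proof
      fix x assume "x \<in> dom (highest i)"
      then have "(i, x) \<in> {(i, x). highest i x \<noteq> None}" by (simp add: dom_def)
      then show "x \<in> snd ` {(i, x). highest i x \<noteq> None}" by (rule rev_image_eqI) simp
    qed
  qed (use finite_points[OF top] in simp)
  have fin: "finite (starts R)" using finite_starts[OF finite_region] .
  have "num_moves R S = (\<Sum>(i, x)\<in>Sigma (starts R) (\<lambda>i. dom (highest i)). gap highest lowest i x)"
    unfolding num_moves_def gap_def using dom fin by (subst sum.Sigma) auto
  also have "\<dots> = (\<Sum>(i, x)\<in>P. gap highest lowest i x)"
  proof (rule sum.mono_neutral_right)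
    show "finite (Sigma (starts R) (\<lambda>i. dom (highest i)))" using dom fin by simp
    show "P \<subseteq> Sigma (starts R) (\<lambda>i. dom (highest i))"
    proof (rule subsetI)
      fix q assume "q \<in> P"
      moreover obtain i x where q: "q = (i, x)" by (cases q)
      ultimately obtain y where y: "highest i x = Some y" using sites_iff[OF top, of i x] by blast
      then show "q \<in> Sigma (starts R) (\<lambda>i. dom (highest i))"
        using path_system.label[OF path_system[OF top] y] q by blast
    qed
    show "\<forall>q\<in>Sigma (starts R) (\<lambda>i. dom (highest i)) - P. (case q of (i, x) \<Rightarrow> gap highest lowest i x) = 0"
      using gap_zero[OF top bot] by (metis (mono_tags, lifting) DiffE case_prod_beta prod.collapse)
  qed
  finally show ?thesis .
qed

lemma lowest_le_highest: "ord 1 lowest highest"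
  using top_state bottom_state by blast

text \<open>Markov's inequality: gaps are integers, so two distinct ordered copies have a gap of at
  least 1 somewhere and hence potential at least \<open>c\<close>, while the initial potential is at
  most \<open>C * num_moves R S\<close>.\<close>

lemma coalescence_probability:
  assumes g: "\<And>x. 0 \<le> g x" and r: "r \<le> 1" and "0 < c"
    and super: "\<And>i x. (i, x) \<in> P \<Longrightarrow> 0 < gap highest lowest i x \<Longrightarrow>
      (g (x - 1) + g (x + 1)) / 2 \<le> (1 - r) * g x"
    and bounds: "\<And>i x. (i, x) \<in> P \<Longrightarrow> 0 < gap highest lowest i x \<Longrightarrow> c \<le> g x \<and> g x \<le> C"
  shows "measure (choices R S) {\<omega> \<in> space (choices R S). coalesced R S \<omega> t} \<ge>
    1 - num_moves R S * (C / c) * exp (- (r * t / card P))"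
proof -
  interpret prob_space "choices R S"
    unfolding choices_eq by (rule choice_sequence.prob_space_axioms)
  have top: "highest \<in> \<Omega>" and bot: "lowest \<in> \<Omega>" using top_state bottom_state by blast+
  show ?thesis
  proof (cases "highest = lowest")
    case True
    then have "{\<omega> \<in> space (choices R S). coalesced R S \<omega> t} = space (choices R S)"
      unfolding coalesced_def by simp
    moreover have "num_moves R S = 0" unfolding num_moves_eq True by (intro sum.neutral) (auto simp: gap_def)
    ultimately show ?thesis using prob_space by simp
  next
    case False
    then have "P \<noteq> {}" using gap_positive[OF top bot lowest_le_highest] by blast
    define q where "q = 1 - r / card P"
    have "1 \<le> card P" using \<open>P \<noteq> {}\<close> finite_sites by (simp add: Suc_leI card_gt_0_iff)
    then have q: "0 \<le> q" using r unfolding q_def by (simp add: field_simps)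
    define Bad where "Bad = {\<omega> \<in> space (choices R S). \<not> coalesced R S \<omega> t}"
    have good: "{\<omega> \<in> space (choices R S). coalesced R S \<omega> t} \<in> sets (choices R S)"
    proof -
      have "(\<lambda>\<omega>. chain R \<omega> highest t) \<in> choices R S \<rightarrow>\<^sub>M count_space \<Omega>"
        "(\<lambda>\<omega>. chain R \<omega> lowest t) \<in> choices R S \<rightarrow>\<^sub>M count_space \<Omega>"
        using chain_measurable top bot by blast+
      then have "{\<omega> \<in> space (choices R S). chain R \<omega> highest t = h \<and> chain R \<omega> lowest t = h} \<in> sets (choices R S)"
        if "h \<in> \<Omega>" for h using that by measurable
      then have "(\<Union>h\<in>\<Omega>. {\<omega> \<in> space (choices R S). chain R \<omega> highest t = h \<and> chain R \<omega> lowest t = h}) \<in> sets (choices R S)"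
        using finite_states by (intro sets.finite_UN) auto
      moreover have "(\<Union>h\<in>\<Omega>. {\<omega> \<in> space (choices R S). chain R \<omega> highest t = h \<and> chain R \<omega> lowest t = h}) =
          {\<omega> \<in> space (choices R S). coalesced R S \<omega> t}"
        using chain_state[OF bot] unfolding coalesced_def by auto
      ultimately show ?thesis by simp
    qed
    have Bad: "Bad = space (choices R S) - {\<omega> \<in> space (choices R S). coalesced R S \<omega> t}"
      unfolding Bad_def by blast
    have "c \<le> potential g (chain R \<omega> highest t) (chain R \<omega> lowest t)" if "\<omega> \<in> Bad" for \<omega>
    proof -
      let ?a = "chain R \<omega> highest t" and ?b = "chain R \<omega> lowest t"
      have ab: "?a \<in> \<Omega>" "?b \<in> \<Omega>" "ord 1 ?b ?a"
        using chain_state top bot chain_mono lowest_le_highest by blast+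
      have "?a \<noteq> ?b" using that unfolding Bad_def coalesced_def by blast
      then obtain i x where ix: "(i, x) \<in> P" "1 \<le> gap ?a ?b i x" using gap_positive[OF ab] by blast
      have "gap ?a ?b i x \<le> gap highest lowest i x"
        using gap_mono ab top bot top_state bottom_state by blast
      then have "c \<le> g x" using bounds[OF ix(1)] ix(2) by linarith
      then have "c * 1 \<le> g x * gap ?a ?b i x" using ix(2) g assms(3) by (intro mult_mono) auto
      also have "\<dots> = (case (i, x) of (i, x) \<Rightarrow> g x * gap ?a ?b i x)" by simp
      also have "\<dots> \<le> potential g ?a ?b"
        unfolding potential_def using ix(1) finite_sites g gap_nonneg[OF ab]
        by (intro member_le_sum) auto
      finally show ?thesis by simp
    qed
    then have "(\<integral>\<^sup>+\<omega>. ennreal c * indicator Bad \<omega> \<partial>choices R S) \<le>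
        (\<integral>\<^sup>+\<omega>. ennreal (potential g (chain R \<omega> highest t) (chain R \<omega> lowest t)) \<partial>choices R S)"
      by (intro nn_integral_mono) (auto simp: indicator_def intro!: ennreal_leI)
    also have "\<dots> \<le> ennreal (q ^ t * potential g highest lowest)"
      unfolding q_def by (rule expected_potential[OF bot top lowest_le_highest g \<open>P \<noteq> {}\<close> r super])
    finally have "ennreal c * emeasure (choices R S) Bad \<le> ennreal (q ^ t * potential g highest lowest)"
      using good by (simp add: nn_integral_cmult_indicator Bad)
    then have "ennreal (c * prob Bad) \<le> ennreal (q ^ t * potential g highest lowest)"
      using assms(3) by (simp add: emeasure_eq_measure ennreal_mult)
    moreover have pot0: "0 \<le> potential g highest lowest"
      using potential_nonneg[OF bot top lowest_le_highest g] .
    ultimately have "c * prob Bad \<le> q ^ t * potential g highest lowest"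
      using q by simp
    also have "\<dots> \<le> exp (- (r * t / card P)) * (C * num_moves R S)"
    proof (rule mult_mono)
      have "q \<le> exp (- (r / card P))" unfolding q_def using exp_ge_add_one_self[of "- (r / card P)"] by simp
      then have "q ^ t \<le> exp (- (r / card P)) ^ t" using q by (intro power_mono)
      also have "\<dots> = exp (- (r * t / card P))" by (simp add: exp_of_nat_mult[symmetric] mult_ac)
      finally show "q ^ t \<le> exp (- (r * t / card P))" .
      have "potential g highest lowest \<le> (\<Sum>(i, x)\<in>P. C * gap highest lowest i x)"
        unfolding potential_def
      proof (rule sum_mono, clarify)
        fix p p' x assume P: "((p, p'), x) \<in> P"
        show "g x * gap highest lowest (p, p') x \<le> C * gap highest lowest (p, p') x"
          using gap_nonneg[OF top bot lowest_le_highest, of "(p, p')" x] bounds[OF P]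
          by (cases "gap highest lowest (p, p') x = 0") (auto intro!: mult_right_mono)
      qed
      also have "\<dots> = C * num_moves R S"
        unfolding num_moves_eq sum_distrib_left by (intro sum.cong) auto
      finally show "potential g highest lowest \<le> C * num_moves R S" .
    qed (use pot0 in auto)
    finally have "prob Bad \<le> num_moves R S * (C / c) * exp (- (r * t / card P))"
      using assms(3) by (simp add: field_simps)
    moreover have "prob Bad = 1 - prob {\<omega> \<in> space (choices R S). coalesced R S \<omega> t}"
      unfolding Bad using good by (rule prob_compl)
    ultimately show ?thesis by linarith
  qed
qed

end

section \<open>Choice of the weights\<close>

lemma x_cos_le_sin:
  fixes x :: real
  assumes "0 \<le> x" "x \<le> pi"
  shows "x * cos x \<le> sin x"
proof -
  have "sin 0 - 0 * cos 0 \<le> sin x - x * cos x"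
  proof (rule DERIV_nonneg_imp_nondecreasing[OF assms(1)])
    fix y assume y: "0 \<le> y" "y \<le> x"
    have "((\<lambda>x. sin x - x * cos x) has_real_derivative y * sin y) (at y)"
      by (auto intro!: derivative_eq_intros)
    moreover have "0 \<le> y * sin y" using y assms by (intro mult_nonneg_nonneg sin_ge_zero) auto
    ultimately show "\<exists>z. ((\<lambda>x. sin x - x * cos x) has_real_derivative z) (at y) \<and> 0 \<le> z" by blast
  qed
  then show ?thesis by simp
qed

text \<open>Half angles: \<open>1 - cos z\<close> is twice the square of \<open>sin (z / 2)\<close>,
  which is at least \<open>z / 2 * cos (z / 2)\<close>, and the squared cosine is at least
  \<open>1 - (z / 2)^2\<close>.\<close>

lemma one_minus_cos_ge:
  fixes z :: real
  assumes "0 \<le> z" "z \<le> pi"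
  shows "z\<^sup>2 / 2 * (1 - z\<^sup>2 / 4) \<le> 1 - cos z"
proof -
  have s: "sin (z / 2) \<le> z / 2" "0 \<le> sin (z / 2)" "0 \<le> cos (z / 2)"
    using assms sin_x_le_x[of "z / 2"] by (auto intro!: sin_ge_zero cos_ge_zero)
  have "(z / 2)\<^sup>2 * (1 - (z / 2)\<^sup>2) \<le> (z / 2)\<^sup>2 * (1 - (sin (z / 2))\<^sup>2)"
    using s by (intro mult_left_mono diff_left_mono power_mono) auto
  also have "\<dots> = (z / 2 * cos (z / 2))\<^sup>2"
    unfolding power_mult_distrib cos_squared_eq ..
  also have "\<dots> \<le> (sin (z / 2))\<^sup>2"
    using assms s x_cos_le_sin[of "z / 2"] by (intro power_mono) auto
  also have "(sin (z / 2))\<^sup>2 = (1 - cos z) / 2"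
    using cos_double_sin[of "z / 2"] by simp
  finally show ?thesis by (simp add: field_simps power2_eq_square)
qed

text \<open>The sine is at least its argument times the cosine, where the cosine is at least
  \<open>2 / 3\<close> on this range and \<open>pi / 2\<close> is at least \<open>3 / 2\<close>.
  Used to bound the cosine weight from below.\<close>

lemma le_sin_half_pi:
  fixes \<eta> :: real
  assumes "0 \<le> \<eta>" "\<eta> \<le> 1 / 2"
  shows "\<eta> \<le> sin (pi * \<eta> / 2)"
proof -
  have pi: "3 < pi" using pi_gt3 .
  have y: "0 \<le> pi * \<eta> / 2" "pi * \<eta> / 2 \<le> pi / 4" using assms by auto
  have "(2 :: real) / 3 \<le> sqrt 2 / 2" by (rule power2_le_imp_le) (auto simp: power_divide)
  also have "\<dots> = cos (pi / 4)" by (simp add: cos_45)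
  also have "\<dots> \<le> cos (pi * \<eta> / 2)" using y by (intro cos_monotone_0_pi_le) auto
  finally have c: "2 / 3 \<le> cos (pi * \<eta> / 2)" .
  have "\<eta> = (3 * \<eta> / 2) * (2 / 3)" by simp
  also have "\<dots> \<le> (pi * \<eta> / 2) * cos (pi * \<eta> / 2)"
    using c pi assms by (intro mult_mono) (auto intro!: mult_right_mono)
  also have "\<dots> \<le> sin (pi * \<eta> / 2)" using y by (intro x_cos_le_sin) auto
  finally show ?thesis .
qed

context component
begin

definition active_columns :: "int set" where
  "active_columns = {x. \<exists>i. (i, x) \<in> P \<and> 0 < gap highest lowest i x}"

definition left_end :: int where
  "left_end = Min (fst ` starts R)"

text \<open>A site has neighbours on its path on both sides. Hence the weights at
  \<open>x - 1\<close> and \<open>x + 1\<close> are still in the range where the cosine formula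
  defines them.\<close>

lemma site_between:
  assumes "(i, x) \<in> P"
  shows "left_end + 1 \<le> x" "x + 1 \<le> left_end + int (width R)"
proof -
  have top: "highest \<in> \<Omega>" using top_state by blast
  interpret h: path_system R highest using path_system[OF top] .
  obtain u v where uv: "highest i (x - 1) = Some u" "highest i (x + 1) = Some v"
    using assms sites_iff[OF top] by blast
  have "fst i \<in> fst ` starts R" "fst i \<le> x - 1" using h.label[OF uv(1)] by auto
  then show left: "left_end + 1 \<le> x"
  proof -
    have "Min (fst ` starts R) \<le> fst i"
      using finite_starts[OF finite_region] \<open>fst i \<in> fst ` starts R\<close> by (intro Min_le) auto
    then show ?thesis unfolding left_end_def using \<open>fst i \<le> x - 1\<close> by linarith
  qed
  have "\<exists>z\<ge>x + 1. highest i z \<noteq> None \<and> highest i (z + 1) = None"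
  proof (rule ccontr)
    assume no: "\<not> ?thesis"
    have "highest i z \<noteq> None" if "x + 1 \<le> z" for z
      using that
    proof (induction z rule: int_ge_induct)
      case base
      then show ?case using uv(2) by simp
    next
      case (step z)
      then show ?case by (intro notI) (use no in auto)
    qed
    then have "{x + 1..} \<subseteq> snd ` {(i, x). highest i x \<noteq> None}"
      by (auto intro!: rev_image_eqI[of "(i, _)"])
    then have "finite {x + 1..}" using finite_points[OF top] finite_surj by blast
    then show False using infinite_Ici by blast
  qed
  then obtain z w where z: "x + 1 \<le> z" "highest i z = Some w" "highest i (z + 1) = None" by blast
  have "z \<in> fst ` ends R" using h.finish[OF z(2,3)] by force
  then have "z \<le> Max (fst ` ends R)" using finite_ends[OF finite_region] by (intro Max_ge) auto
  then show "x + 1 \<le> left_end + int (width R)"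
    using z(1) left unfolding width_def left_end_def by linarith
qed

lemma finite_active_columns: "finite active_columns"
proof (rule finite_subset)
  show "active_columns \<subseteq> snd ` P" unfolding active_columns_def by force
qed (use finite_sites in simp)

lemma card_active_columns_width: "card active_columns \<le> width R - 1"
proof -
  have "active_columns \<subseteq> {left_end + 1..left_end + int (width R) - 1}"
    using site_between unfolding active_columns_def by fastforce
  then have "card active_columns \<le> card {left_end + 1..left_end + int (width R) - 1}"
    by (intro card_mono) auto
  then show ?thesis by simp
qed

lemma num_moves_nat: "\<exists>m::nat. num_moves R S = real m \<and> card active_columns \<le> m"
proof -
  have "\<forall>i x. \<exists>n::nat. gap highest lowest i x = real n"
    using gap_nat top_state bottom_state lowest_le_highest by blast
  then obtain n :: "int \<times> int \<Rightarrow> int \<Rightarrow> nat" where n: "\<And>i x. gap highest lowest i x = real (n i x)"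
    by metis
  let ?A = "{(i, x). (i, x) \<in> P \<and> 0 < n i x}"
  have A: "?A \<subseteq> P" by blast
  have "active_columns \<subseteq> snd ` ?A"
  proof
    fix x assume "x \<in> active_columns"
    then obtain i where "(i, x) \<in> P" "0 < n i x" unfolding active_columns_def n by auto
    then have "(i, x) \<in> ?A" by simp
    then show "x \<in> snd ` ?A" by (rule rev_image_eqI) simp
  qed
  then have "card active_columns \<le> card ?A"
    using surj_card_le[OF finite_subset[OF A finite_sites]] by blast
  also have "\<dots> = (\<Sum>(i, x)\<in>?A. 1)" by simp
  also have "\<dots> \<le> (\<Sum>(i, x)\<in>?A. n i x)" by (rule sum_mono) auto
  also have "\<dots> \<le> (\<Sum>(i, x)\<in>P. n i x)" using A finite_sites by (intro sum_mono2) auto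
  finally have "card active_columns \<le> (\<Sum>(i, x)\<in>P. n i x)" .
  moreover have "num_moves R S = real (\<Sum>(i, x)\<in>P. n i x)"
    unfolding num_moves_eq n by (simp add: case_prod_beta)
  ultimately show ?thesis by blast
qed

text \<open>A cosine is an eigenfunction of averaging over the two neighbours, with eigenvalue
  \<open>cos \<theta>\<close>, so the contraction condition holds with equality. At the ends of the
  range its phase is \<open>pi / 2 - pi * \<eta> / 2\<close> up to sign, which keeps the weight at
  least \<open>\<eta>\<close>.\<close>

lemma coalescence_cosine:
  assumes \<eta>: "0 < \<eta>" "\<eta> \<le> 1 / 2" and w: "2 \<le> width R"
  shows "measure (choices R S) {\<omega> \<in> space (choices R S). coalesced R S \<omega> t} \<ge>
    1 - num_moves R S * (1 / \<eta>) * exp (- ((1 - cos (pi * (1 - \<eta>) / width R)) * t / card P))"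
proof -
  define w where "w = real (width R)"
  define \<theta> where "\<theta> = pi * (1 - \<eta>) / w"
  define \<phi> where "\<phi> x = \<theta> * (real_of_int (x - left_end) - w / 2)" for x
  \<comment> \<open>Cut off outside the range because the weight must be nonnegative
    everywhere.\<close>
  define g where "g x = (if left_end \<le> x \<and> x \<le> left_end + int (width R) then cos (\<phi> x) else 0)" for x
  have w2: "2 \<le> w" using w unfolding w_def by simp
  have \<theta>: "0 \<le> \<theta>" "\<theta> * (w / 2) = pi / 2 - pi * \<eta> / 2"
    unfolding \<theta>_def using \<eta> w2 by (auto simp: field_simps)
  have cos: "\<eta> \<le> cos (\<phi> x)" if "left_end \<le> x" "x \<le> left_end + int (width R)" for x
  proof -
    have "0 \<le> real_of_int (x - left_end)" "real_of_int (x - left_end) \<le> w"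
      using that unfolding w_def by linarith+
    then have "\<bar>real_of_int (x - left_end) - w / 2\<bar> \<le> w / 2" by linarith
    from mult_left_mono[OF this \<theta>(1)] have "\<bar>\<phi> x\<bar> \<le> \<theta> * (w / 2)"
      unfolding \<phi>_def abs_mult using \<theta>(1) by simp
    then have "\<bar>\<phi> x\<bar> \<le> pi / 2 - pi * \<eta> / 2" using \<theta>(2) by simp
    then have "cos (pi / 2 - pi * \<eta> / 2) \<le> cos \<bar>\<phi> x\<bar>"
      using \<eta> by (intro cos_monotone_0_pi_le) (auto simp: field_simps)
    then show ?thesis using le_sin_half_pi[of \<eta>] \<eta> by (simp add: cos_diff)
  qed
  have "measure (choices R S) {\<omega> \<in> space (choices R S). coalesced R S \<omega> t} \<ge>
    1 - num_moves R S * (1 / \<eta>) * exp (- ((1 - cos \<theta>) * t / card P))"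
  proof (rule coalescence_probability[where g = g])
    show "0 \<le> g x" for x unfolding g_def using cos[of x] \<eta> by auto
    show "1 - cos \<theta> \<le> 1"
    proof -
      have "\<theta> \<le> pi * 1 / 2" unfolding \<theta>_def using \<eta> w2 by (intro frac_le mult_left_mono) auto
      then show ?thesis using cos_ge_zero[of \<theta>] \<theta>(1) by simp
    qed
    show "0 < \<eta>" by fact
    fix i x assume "(i, x) \<in> P"
    note site_between[OF this]
    then have in_range: "g x = cos (\<phi> x)" "g (x - 1) = cos (\<phi> x - \<theta>)" "g (x + 1) = cos (\<phi> x + \<theta>)"
      unfolding g_def \<phi>_def by (auto simp: algebra_simps)
    show "(g (x - 1) + g (x + 1)) / 2 \<le> (1 - (1 - cos \<theta>)) * g x"
      unfolding in_range by (simp add: cos_add cos_diff)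
    show "\<eta> \<le> g x \<and> g x \<le> 1"
      using cos[of x] \<open>left_end + 1 \<le> x\<close> \<open>x + 1 \<le> left_end + int (width R)\<close> unfolding in_range by simp
  qed
  then show ?thesis unfolding \<theta>_def w_def .
qed

text \<open>When few columns can move, a parabola in the rank of a column among them replaces the cosine.\<close>

lemma coalescence_parabola:
  assumes "active_columns \<noteq> {}"
  defines "n \<equiv> real (card active_columns)"
  shows "measure (choices R S) {\<omega> \<in> space (choices R S). coalesced R S \<omega> t} \<ge>
    1 - num_moves R S * ((n + 1)\<^sup>2 / 4 / n) * exp (- (4 / (n + 1)\<^sup>2 * t / card P))"
proof (rule coalescence_probability)
  define k where "k x = real (card {z \<in> active_columns. z \<le> x})" for x
  \<comment> \<open>Zero at the ranks 0 and \<open>n + 1\<close>, at least \<open>n\<close> on the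
    ranks in between, and with constant second difference -2.\<close>
  define f where "f j = j * (n + 1 - j)" for j
  let ?g = "\<lambda>x. if x \<in> active_columns then f (k x) else 0"
  have n1: "1 \<le> n" unfolding n_def using assms(1) finite_active_columns by (simp add: Suc_leI card_gt_0_iff)
  have kn: "1 \<le> k x" "k x \<le> n" if "x \<in> active_columns" for x
  proof -
    have "card {z \<in> active_columns. z \<le> x} > 0" using that finite_active_columns by (subst card_gt_0_iff) auto
    then show "1 \<le> k x" unfolding k_def by simp
    show "k x \<le> n" unfolding k_def n_def using finite_active_columns by (simp add: card_mono)
  qed
  have k_step: "k x = k (x - 1) + 1" if "x \<in> active_columns" for x
  proof -
    have "{z \<in> active_columns. z \<le> x} = insert x {z \<in> active_columns. z \<le> x - 1}" using that by auto
    then show ?thesis unfolding k_def using finite_active_columns by simp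
  qed
  have f: "n \<le> f j" if "1 \<le> j" "j \<le> n" for j
  proof -
    have "0 \<le> (j - 1) * (n - j)" using that by simp
    then show ?thesis unfolding f_def by (simp add: algebra_simps)
  qed
  have f_max: "f j \<le> (n + 1)\<^sup>2 / 4" for j
  proof -
    have "0 \<le> (n + 1 - 2 * j)\<^sup>2" by simp
    then show ?thesis unfolding f_def by (simp add: power2_eq_square algebra_simps)
  qed
  show "0 \<le> ?g x" for x using f[OF kn, of x] n1 by auto
  have "4 \<le> (n + 1)\<^sup>2" using n1 power_mono[of 2 "n + 1" 2] by simp
  then show "4 / (n + 1)\<^sup>2 \<le> 1" using n1 by (subst divide_le_eq_1_pos) auto
  show "0 < n" using n1 by simp
  fix i x assume "(i, x) \<in> P" "0 < gap highest lowest i x"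
  then have x: "x \<in> active_columns" unfolding active_columns_def by blast
  show "n \<le> ?g x \<and> ?g x \<le> (n + 1)\<^sup>2 / 4" using x f[OF kn[OF x]] f_max by simp
  \<comment> \<open>A neighbouring column that cannot move has weight 0, at most the value of the
    parabola at the adjacent rank. So gaps between the active columns only help, and the count
    \<open>n\<close> replaces the width.\<close>
  have "?g (x - 1) \<le> f (k x - 1)"
  proof (cases "x - 1 \<in> active_columns")
    case True
    then show ?thesis using k_step[OF x] by simp
  next
    case False
    then show ?thesis unfolding f_def using kn[OF x] by simp
  qed
  moreover have "?g (x + 1) \<le> f (k x + 1)"
  proof (cases "x + 1 \<in> active_columns")
    case True
    then show ?thesis using k_step[OF True] by simp
  next
    case False
    then show ?thesis unfolding f_def using kn[OF x] by simp
  qed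
  moreover have "(f (k x - 1) + f (k x + 1)) / 2 = f (k x) - 1"
    unfolding f_def by (simp add: field_simps)
  \<comment> \<open>Averaging lowers the parabola by exactly 1, which is at least the fraction
    \<open>4 / (n + 1)^2\<close> of any of its values.\<close>
  moreover have "4 / (n + 1)\<^sup>2 * f (k x) \<le> 4 / (n + 1)\<^sup>2 * ((n + 1)\<^sup>2 / 4)"
    by (intro mult_left_mono f_max) simp
  moreover have "4 / (n + 1)\<^sup>2 * ((n + 1)\<^sup>2 / 4) = 1" using n1 by simp
  ultimately show "(?g (x - 1) + ?g (x + 1)) / 2 \<le> (1 - 4 / (n + 1)\<^sup>2) * ?g x"
    using x by (simp add: left_diff_distrib)
qed

end

text \<open>The cosine argument uses \<open>\<beta> = pi * (1 - 1 / ln w)\<close>, and \<open>1 - 3 / w\<^sup>2\<close> is the error of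
  \<open>1 - cos z \<approx> z\<^sup>2 / 2\<close>; below 16 any large constant does.\<close>

definition correction :: "nat \<Rightarrow> real" where
  "correction w = (if w < 16 then 6 else
     2 * ((1 + ln (ln w) / ln (w / 2 - 1)) / ((1 - 1 / ln w)\<^sup>2 * (1 - 3 / (real w)\<^sup>2)) - 1))"

text \<open>Ensures \<open>1 / ln w \<le> 1 / 2\<close>, the range of \<open>\<eta>\<close> in the
  cosine argument.\<close>

lemma ln_ge_2: "16 \<le> w \<Longrightarrow> 2 \<le> ln (real w)"
proof -
  assume w: "16 \<le> w"
  have "exp (2 :: real) = exp 1 * exp 1" using exp_add[of "1 :: real" 1] by simp
  also have "\<dots> \<le> 3 * 3" using exp_le by (intro mult_mono) auto
  finally have "exp 2 \<le> real w" using w by simp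
  then show ?thesis using w by (subst ln_ge_iff) auto
qed

lemma correction_parts:
  assumes "16 \<le> w"
  defines "D \<equiv> (1 - 1 / ln (real w))\<^sup>2 * (1 - 3 / (real w)\<^sup>2)"
  shows "0 < D" "D \<le> 1" "0 \<le> ln (ln (real w)) / ln (real w / 2 - 1)"
    and "1 + correction w / 2 = (1 + ln (ln (real w)) / ln (real w / 2 - 1)) / D"
proof -
  have l: "2 \<le> ln (real w)" using ln_ge_2[OF assms(1)] .
  have a: "0 < 1 - 1 / ln (real w)" "1 - 1 / ln (real w) \<le> 1" using l by (auto simp: field_simps)
  have "(16 :: real)\<^sup>2 \<le> (real w)\<^sup>2" using assms(1) by (intro power_mono) auto
  then have "3 / (real w)\<^sup>2 < 1" using assms(1) by (subst divide_less_eq_1_pos) auto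
  then have b: "0 < 1 - 3 / (real w)\<^sup>2" "1 - 3 / (real w)\<^sup>2 \<le> 1" by auto
  show "0 < D" unfolding D_def using a b by (intro mult_pos_pos) auto
  show "D \<le> 1" unfolding D_def using a b by (intro mult_le_one power_le_one) auto
  show "0 \<le> ln (ln (real w)) / ln (real w / 2 - 1)"
    using l assms(1) by (intro divide_nonneg_nonneg ln_ge_zero) auto
  show "1 + correction w / 2 = (1 + ln (ln (real w)) / ln (real w / 2 - 1)) / D"
  proof -
    have c: "correction w = 2 * ((1 + ln (ln (real w)) / ln (real w / 2 - 1)) / D - 1)"
      unfolding correction_def D_def by (rule if_not_P) (use assms(1) in simp)
    have "1 + 2 * (X - 1) / 2 = X" for X :: real by (simp add: field_simps)
    then show ?thesis unfolding c .
  qed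
qed

lemma correction_nonneg: "0 \<le> correction w"
proof (cases "w < 16")
  case False
  then have w: "16 \<le> w" by simp
  note c = correction_parts[OF w]
  have "1 \<le> (1 + ln (ln (real w)) / ln (real w / 2 - 1)) / ((1 - 1 / ln (real w))\<^sup>2 * (1 - 3 / (real w)\<^sup>2))"
    using c(1-3) by (simp add: le_divide_eq_1)
  then show ?thesis using c(4) by linarith
qed (simp add: correction_def)

section \<open>Combination of the two weights\<close>

context component
begin

lemma coalescence_time:
  assumes \<epsilon>: "0 < \<epsilon>"
    and t: "(2 + correction (width R)) / pi\<^sup>2 * real (card P) * (real (width R))\<^sup>2 * ln (num_moves R S / \<epsilon>) \<le> real t"
  shows "measure (choices R S) {\<omega> \<in> space (choices R S). coalesced R S \<omega> t} \<ge> 1 - \<epsilon>"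
proof -
  obtain m :: nat where m: "num_moves R S = real m" "card active_columns \<le> m"
    using num_moves_nat by blast
  consider "1 \<le> \<epsilon>" | "m = 0" | "\<epsilon> < 1" "1 \<le> m" by linarith
  then show ?thesis
  proof cases
    case 1
    then show ?thesis using measure_nonneg[of "choices R S"] by (meson diff_le_0_iff_le order_trans)
  next
    case 2
    have "measure (choices R S) {\<omega> \<in> space (choices R S). coalesced R S \<omega> t} \<ge>
        1 - num_moves R S * (1 / 1) * exp (- ((0 :: real) * t / card P))"
      by (rule coalescence_probability[where g = "\<lambda>_. 1"]) auto
    then show ?thesis using 2 m \<epsilon> by simp
  next
    case 3
    define W where "W = real (width R)"
    define p where "p = real (card P)"
    define L where "L = ln (m / \<epsilon>)"
    have "P \<noteq> {}"
    proof
      assume "P = {}"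
      then have "num_moves R S = 0" unfolding num_moves_eq by simp
      then show False using m 3 by simp
    qed
    then have p: "0 < p" unfolding p_def using finite_sites by (simp add: card_gt_0_iff)
    have "active_columns \<noteq> {}"
    proof
      assume "active_columns = {}"
      then have "gap highest lowest i x = 0" if "(i, x) \<in> P" for i x
      proof -
        have "0 \<le> gap highest lowest i x"
          using top_state bottom_state lowest_le_highest by (intro gap_nonneg) auto
        moreover have "\<not> 0 < gap highest lowest i x"
          using that \<open>active_columns = {}\<close> unfolding active_columns_def by blast
        ultimately show ?thesis by simp
      qed
      then have "num_moves R S = 0" unfolding num_moves_eq by (intro sum.neutral) auto
      then show False using m 3 by simp
    qed
    define n where "n = real (card active_columns)"
    have n: "1 \<le> n" "n \<le> m" "n + 1 \<le> W"
    proof -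
      have "1 \<le> card active_columns"
        using \<open>active_columns \<noteq> {}\<close> finite_active_columns by (simp add: Suc_leI card_gt_0_iff)
      then show "1 \<le> n" "n \<le> m" "n + 1 \<le> W"
        using m(2) card_active_columns_width unfolding n_def W_def by simp_all
    qed
    have L0: "0 < L" unfolding L_def using 3 \<epsilon> by (intro ln_gt_zero) (subst less_divide_eq_1_pos, auto)
    have expL: "exp (- L) = \<epsilon> / m" unfolding L_def exp_minus using 3 \<epsilon> by simp
    have tp: "(2 + correction (width R)) / pi\<^sup>2 * W\<^sup>2 * L \<le> t / p"
    proof -
      have "(2 + correction (width R)) / pi\<^sup>2 * W\<^sup>2 * L * p =
          (2 + correction (width R)) / pi\<^sup>2 * p * W\<^sup>2 * L" by (simp only: mult_ac)
      also have "\<dots> \<le> t" using t unfolding m(1) W_def p_def L_def .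
      finally show ?thesis by (simp only: pos_le_divide_eq[OF p])
    qed
    show ?thesis
    \<comment> \<open>The parabola serves narrow regions and regions in which fewer than about half
      of the columns can move; the cosine serves the rest.\<close>
    proof (cases "width R < 16 \<or> 2 * (n + 1) \<le> W")
      case True
      have pi: "pi\<^sup>2 < 16" using pi_less_4 power_strict_mono[of pi 4 2] by simp
      have "pi\<^sup>2 * (n + 1)\<^sup>2 \<le> 2 * ((2 + correction (width R)) * W\<^sup>2)"
        using True
      proof
        assume "width R < 16"
        \<comment> \<open>The value 6 makes \<open>2 * (2 + correction)\<close> equal to 16, which
          exceeds the square of \<open>pi\<close>; together with \<open>n + 1 \<le> W\<close> this
          suffices.\<close>
        then have "correction (width R) = 6" by (simp add: correction_def)
        moreover have "pi\<^sup>2 * (n + 1)\<^sup>2 \<le> 16 * W\<^sup>2" using pi n by (intro mult_mono power_mono) auto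
        ultimately show ?thesis by simp
      next
        assume "2 * (n + 1) \<le> W"
        then have "(2 * (n + 1))\<^sup>2 \<le> W\<^sup>2" using n by (intro power_mono) auto
        then have "4 * (n + 1)\<^sup>2 \<le> W\<^sup>2" by (simp only: power_mult_distrib) simp
        have "pi\<^sup>2 * (n + 1)\<^sup>2 \<le> 16 * (n + 1)\<^sup>2" using pi by (intro mult_right_mono) auto
        also have "\<dots> \<le> 2 * (2 * W\<^sup>2)" using \<open>4 * (n + 1)\<^sup>2 \<le> W\<^sup>2\<close> by simp
        also have "\<dots> \<le> 2 * ((2 + correction (width R)) * W\<^sup>2)"
          using correction_nonneg by (intro mult_left_mono mult_right_mono) auto
        finally show ?thesis .
      qed
      \<comment> \<open>An exponent of \<open>2 * L\<close> gives \<open>(\<epsilon> / m)^2\<close>: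
        one factor \<open>\<epsilon> / m\<close> cancels the initial distance \<open>m\<close>, the
        other the ratio \<open>(n + 1)^2 / (4 * n) \<le> n \<le> m\<close> of the parabola.\<close>
      then have "2 * L \<le> 4 / (n + 1)\<^sup>2 * ((2 + correction (width R)) / pi\<^sup>2 * W\<^sup>2 * L)"
      proof -
        have "0 < pi\<^sup>2 * (n + 1)\<^sup>2" using n by simp
        then have "1 \<le> 2 * ((2 + correction (width R)) * W\<^sup>2) / (pi\<^sup>2 * (n + 1)\<^sup>2)"
          using \<open>pi\<^sup>2 * (n + 1)\<^sup>2 \<le> _\<close> by (subst le_divide_eq_1_pos)
        then have "2 * L * 1 \<le> 2 * L * (2 * ((2 + correction (width R)) * W\<^sup>2) / (pi\<^sup>2 * (n + 1)\<^sup>2))"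
          using L0 by (intro mult_left_mono) auto
        also have "\<dots> = 4 / (n + 1)\<^sup>2 * ((2 + correction (width R)) / pi\<^sup>2 * W\<^sup>2 * L)"
          by (simp add: mult_ac)
        finally show ?thesis by simp
      qed
      also have "\<dots> \<le> 4 / (n + 1)\<^sup>2 * (t / p)" using tp by (intro mult_left_mono) auto
      finally have "exp (- (4 / (n + 1)\<^sup>2 * t / p)) \<le> exp (- L) * exp (- L)"
        by (simp add: exp_add[symmetric])
      then have e: "exp (- (4 / (n + 1)\<^sup>2 * t / p)) \<le> (\<epsilon> / m)\<^sup>2" unfolding expL by (simp add: power2_eq_square)
      have "(n + 1)\<^sup>2 / 4 / n \<le> n"
      proof -
        have "(n + 1)\<^sup>2 \<le> (2 * n)\<^sup>2" using n by (intro power_mono) auto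
        then show ?thesis using n by (simp add: field_simps power2_eq_square)
      qed
      then have "(n + 1)\<^sup>2 / 4 / n \<le> m" using n(2) by linarith
      then have "m * ((n + 1)\<^sup>2 / 4 / n) * exp (- (4 / (n + 1)\<^sup>2 * t / p)) \<le> m * m * (\<epsilon> / m)\<^sup>2"
        unfolding of_nat_mult by (intro mult_mono[OF mult_left_mono e]) auto
      also have "\<dots> = \<epsilon> * \<epsilon>" using 3 by (simp add: power2_eq_square)
      also have "\<dots> \<le> \<epsilon>" using 3 \<epsilon> by (simp add: mult_left_le)
      finally show ?thesis
        using coalescence_parabola[OF \<open>active_columns \<noteq> {}\<close>, of t] unfolding m(1) n_def p_def by linarith
    next
      case False
      then have w16: "16 \<le> width R" and "W < 2 * (n + 1)" by simp_all
      \<comment> \<open>Each active column accounts for at least one local move. This lower bound on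
        \<open>m\<close> is what makes the loss \<open>ln (ln W)\<close> small relative to
        \<open>L\<close>.\<close>
      then have mW: "W / 2 - 1 \<le> m" using n by simp
      have W: "16 \<le> W" using w16 unfolding W_def by simp
      define \<eta> where "\<eta> = 1 / ln W"
      have l2: "2 \<le> ln W" using ln_ge_2[OF w16] unfolding W_def .
      have \<eta>: "0 < \<eta>" "\<eta> \<le> 1 / 2" unfolding \<eta>_def using l2 by (auto simp: field_simps)
      define A where "A = ln (ln W) / ln (W / 2 - 1)"
      define D where "D = (1 - \<eta>)\<^sup>2 * (1 - 3 / W\<^sup>2)"
      have c: "0 < D" "1 + correction (width R) / 2 = (1 + A) / D"
        using correction_parts[OF w16] unfolding A_def D_def \<eta>_def W_def by auto
      define \<theta> where "\<theta> = pi * (1 - \<eta>) / W"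
      have \<theta>: "0 \<le> \<theta>" "\<theta> \<le> pi" "\<theta>\<^sup>2 / 4 \<le> 3 / W\<^sup>2"
      proof -
        show "0 \<le> \<theta>" unfolding \<theta>_def using \<eta> W by simp
        have "\<theta> \<le> pi * 1 / W" unfolding \<theta>_def using \<eta> W by (intro divide_right_mono mult_left_mono) auto
        then have le: "\<theta> \<le> pi / W" by simp
        also have "\<dots> \<le> pi / 1" using W by (intro divide_left_mono) auto
        finally show "\<theta> \<le> pi" by simp
        \<comment> \<open>The constant 3 in \<open>1 - 3 / W^2\<close> is a bound for a quarter of
          the square of \<open>pi\<close>.\<close>
        have "\<theta>\<^sup>2 \<le> (pi / W)\<^sup>2" using le \<open>0 \<le> \<theta>\<close> by (intro power_mono)
        moreover have "pi\<^sup>2 \<le> 12"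
        proof -
          have "pi \<le> 16 / 5" using pi_approx(2) by simp
          then have "pi\<^sup>2 \<le> (16 / 5)\<^sup>2" by (intro power_mono) auto
          then show ?thesis by (simp add: power2_eq_square)
        qed
        then have "(pi / W)\<^sup>2 \<le> 12 / W\<^sup>2" unfolding power_divide by (intro divide_right_mono) auto
        ultimately show "\<theta>\<^sup>2 / 4 \<le> 3 / W\<^sup>2" by simp
      qed
      \<comment> \<open>The exponent must cover \<open>L\<close> and also the logarithm of
        \<open>1 / \<eta> = ln W\<close>. Since \<open>\<epsilon> < 1\<close>, \<open>L\<close> is
        at least \<open>ln (W / 2 - 1)\<close>, so the extra term is at most the fraction
        \<open>A\<close> of \<open>L\<close>. The definition of \<open>correction\<close> is solved
        for exactly this: the factor \<open>(1 + A) / D\<close> also makes up for the losses in the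
        rate collected in \<open>D\<close>.\<close>
      have "L + ln (ln W) \<le> (1 + A) * L"
      proof -
        have "ln (W / 2 - 1) \<le> L"
        proof -
          have "m * \<epsilon> \<le> m * (1 :: real)" using 3 by (intro mult_left_mono) auto
          then have "m \<le> m / \<epsilon>" using \<epsilon> by (simp add: pos_le_divide_eq)
          then have "W / 2 - 1 \<le> m / \<epsilon>" using mW by linarith
          then show ?thesis unfolding L_def using W by simp
        qed
        moreover have "0 < ln (W / 2 - 1)" using W by simp
        moreover have "0 \<le> ln (ln W)" using l2 by simp
        ultimately have "0 \<le> A" "A * ln (W / 2 - 1) = ln (ln W)"
          unfolding A_def by simp_all
        then have "ln (ln W) \<le> A * L" using mult_left_mono[OF \<open>ln (W / 2 - 1) \<le> L\<close>, of A] by simp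
        then show ?thesis by (simp add: distrib_right)
      qed
      also have "\<dots> = D * ((1 + A) / D) * L" using c(1) by simp
      also have "\<dots> = D * (1 + correction (width R) / 2) * L" unfolding c(2) ..
      also have "\<dots> = (\<theta>\<^sup>2 / 2 * (1 - 3 / W\<^sup>2)) * ((2 + correction (width R)) / pi\<^sup>2 * W\<^sup>2 * L)"
      proof -
        have "e * q * (1 + v / 2) * L = a * e / b / 2 * q * ((2 + v) / a * b * L)"
          if "0 < a" "0 < b" for a b e q v :: real
          using that by (simp add: field_simps)
        from this[of "pi\<^sup>2" "W\<^sup>2"] show ?thesis
          unfolding D_def \<theta>_def power_divide power_mult_distrib using W by simp
      qed
      also have "\<dots> \<le> (\<theta>\<^sup>2 / 2 * (1 - \<theta>\<^sup>2 / 4)) * (t / p)"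
      proof (rule mult_mono)
        show "\<theta>\<^sup>2 / 2 * (1 - 3 / W\<^sup>2) \<le> \<theta>\<^sup>2 / 2 * (1 - \<theta>\<^sup>2 / 4)" using \<theta>(3) by (intro mult_left_mono) auto
        have "3 / W\<^sup>2 \<le> 1" using W power_mono[of 16 W 2] by (simp add: field_simps)
        then have "0 \<le> \<theta>\<^sup>2 / 2 * (1 - 3 / W\<^sup>2)" by (intro mult_nonneg_nonneg) auto
        then show "0 \<le> \<theta>\<^sup>2 / 2 * (1 - \<theta>\<^sup>2 / 4)"
          using \<open>\<theta>\<^sup>2 / 2 * (1 - 3 / W\<^sup>2) \<le> \<theta>\<^sup>2 / 2 * (1 - \<theta>\<^sup>2 / 4)\<close> by linarith
        show "0 \<le> (2 + correction (width R)) / pi\<^sup>2 * W\<^sup>2 * L"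
          using correction_nonneg[of "width R"] L0 by simp
      qed (fact tp)
      also have "\<dots> \<le> (1 - cos \<theta>) * (t / p)"
        using one_minus_cos_ge[OF \<theta>(1,2)] p by (intro mult_right_mono) auto
      finally have "exp (- ((1 - cos \<theta>) * t / p)) \<le> exp (- L) * exp (- ln (ln W))"
        by (simp add: exp_add[symmetric])
      also have "\<dots> = \<epsilon> / m * \<eta>" unfolding expL \<eta>_def using l2 by (simp add: exp_minus inverse_eq_divide)
      finally have "m * (1 / \<eta>) * exp (- ((1 - cos \<theta>) * t / p)) \<le> m * (1 / \<eta>) * (\<epsilon> / m * \<eta>)"
        using \<eta> by (intro mult_left_mono) auto
      also have "\<dots> = \<epsilon>" using \<eta> 3 by simp
      finally show ?thesis
        using coalescence_cosine[OF \<eta>, of t] w16 unfolding m(1) p_def \<theta>_def W_def by linarith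
    qed
  qed
qed

end

lemma correction_tendsto: "correction \<longlonglongrightarrow> 0"
proof (rule Lim_transform_eventually)
  show "(\<lambda>w::nat. 2 * ((1 + ln (ln (real w)) / ln (real w / 2 - 1)) /
      ((1 - 1 / ln (real w))\<^sup>2 * (1 - 3 / (real w)\<^sup>2)) - 1)) \<longlonglongrightarrow> 0"
    by real_asymp
  show "\<forall>\<^sub>F w in sequentially. 2 * ((1 + ln (ln (real w)) / ln (real w / 2 - 1)) /
      ((1 - 1 / ln (real w))\<^sup>2 * (1 - 3 / (real w)\<^sup>2)) - 1) = correction w"
    using eventually_ge_at_top[of 16] by eventually_elim (simp add: correction_def)
qed

theorem theorem7:
  "\<exists>\<delta> :: nat \<Rightarrow> real. \<delta> \<longlonglongrightarrow> 0 \<and>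
     (\<forall>(R :: tri set) (S :: tri \<Rightarrow> (int \<times> int) set) (\<epsilon> :: real) (t :: nat).
        region R \<longrightarrow> states R S \<noteq> {} \<longrightarrow> 0 < \<epsilon> \<longrightarrow>
        (2 + \<delta> (width R)) / pi\<^sup>2 * real (card (sites R S)) * (real (width R))\<^sup>2
            * ln (num_moves R S / \<epsilon>) \<le> real t \<longrightarrow>
        measure (choices R S) {\<omega> \<in> space (choices R S). coalesced R S \<omega> t} \<ge> 1 - \<epsilon>)"
proof (intro exI[of _ correction] conjI allI impI)
  show "correction \<longlonglongrightarrow> 0" by (rule correction_tendsto)
next
  fix R :: "tri set" and S :: "tri \<Rightarrow> (int \<times> int) set" and \<epsilon> :: real and t :: nat
  assume "region R" "states R S \<noteq> {}" and \<epsilon>: "0 < \<epsilon>"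
    and t: "(2 + correction (width R)) / pi\<^sup>2 * real (card (sites R S)) * (real (width R))\<^sup>2
      * ln (num_moves R S / \<epsilon>) \<le> real t"
  then interpret component R S by unfold_locales
  show "measure (choices R S) {\<omega> \<in> space (choices R S). coalesced R S \<omega> t} \<ge> 1 - \<epsilon>"
    by (rule coalescence_time[OF \<epsilon> t])
qed

end
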